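(* Let $\mathbf{1}$ denote the all-ones vector in $\mathbb{R}^{\Delta+1}$, $\mathbf{e}_0 = (1,0,\ldots,0)\in\mathbb{R}^{\Delta+1}$, and $\lambda_\Delta = (\Delta-1)^{\Delta-1}(\Delta-2)^{-\Delta}$. For all integers $\Delta\ge 3$, there exist strictly positive finite constants $a_\Delta<b_\Delta$ such that $(\lambda_\Delta,\mathbf{1}+\mathbf{e}_0h)$ belongs to the uniqueness regime for $h=0$ and for all $h\ge b_\Delta$, and does not belong to the uniqueness regime for $h\in(0,a_\Delta)$.
   Context: Model. $T_\infty$ is the infinite $\Delta$-regular tree, rooted at a node $0$, with graph distance $d(\cdot,\cdot)$; $T_\infty$ also denotes its node set. For $S \subseteq T_\infty$, $\Omega_S = \{0,1\}^S$ and $\Omega=\Omega_{T_\infty}$; for $\omega\in\Omega_S$ write $\omega_{\{i\}}$ for the spin at $i$, $\omega_{S'}$ for the restriction to $S'\subseteq S$, and $|\omega| = \sum_{i\in S}\omega_{\{i\}}$. $\tilde\Omega_S \subseteq \Omega_S$ is the set of $\omega$ with no two adjacent nodes of $S$ both having spin $1$. For disjoint $S_1,S_2$, $\omega^1\cdot\omega^2$ denotes the combined configuration. $\partial S$ is the set of nodes not in $S$ at distance at most $2$ from $S$. For a node $i$, $N(i)$ is the set consisting of $i$ and its $\Delta$ neighbors. For $\lambda>0$ and strictly positive $\boldsymbol\theta=(\theta_0,\ldots,\theta_\Delta)$, define for each node $i$ and $\omega\in\Omega_{N(i)}$ the potential $\Phi_{N(i)}(\omega) = -\log\lambda$ if $\omega_{\{i\}}=1$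 and $|\omega_{N(i)}|=1$; $\Phi_{N(i)}(\omega)=-\log\theta_k$ if $\omega_{\{i\}}=0$ and $|\omega_{N(i)}|=k$; $\Phi_{N(i)}(\omega)=\infty$ otherwise. All other potentials are zero. This family of potentials is denoted $(\lambda,\boldsymbol\theta)$. For finite $\Lambda\subseteq T_\infty$ and $\omega\in\Omega_{\Lambda\cup\partial\Lambda}$, the Hamiltonian is $\mathcal{H}_\Lambda(\omega) = \sum_{i:\,N(i)\cap\Lambda\ne\emptyset}\Phi_{N(i)}(\omega_{N(i)})$. For finite $S\subseteq\Lambda$, $\omega\in\Omega_S$ and $\eta\in\tilde\Omega_{\partial\Lambda}$, $$\mathbb{P}_{\lambda,\boldsymbol\theta,\Lambda}(S=\omega\mid\eta) = \frac{\sum_{\nu\in\Omega_\Lambda:\,\nu_S=\omega}\exp(-\mathcal{H}_\Lambda(\nu\cdot\eta))}{\sum_{\nu\in\Omega_\Lambda}\exp(-\mathcal{H}_\Lambda(\nu\cdot\eta))},\qquad \exp(-\infty)=0.$$ Uniqueness regime. An infinite-volume Gibbs measure consistent with $(\lambda,\boldsymbol\theta)$ is a probability measure $\mu$ on $\Omega$ (product $\sigma$-algebra), concentrated on configurations with no two adjacent nodes both having spin $1$, such that for all finite $S\subseteq\Lambda\subseteq T_\infty$ and $\omega\in\Omega_S$, $\mu(S=\omega) = \sum_{\eta\in\tilde\Omega_{\partial\Lambda}}\mathbb{P}_{\lambda,\boldsymbol\theta,\Lambda}(S=\omega\mid\eta)\,\mu(\partial\Lambda=\eta)$, where $\{S=\omega\}$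 is the event that the nodes of $S$ receive the spins $\omega$. $(\lambda,\boldsymbol\theta)$ belongs to the uniqueness regime if there is exactly one such measure. *)

theory Defs
  imports "HOL-Probability.Probability"
begin

section \<open>The infinite regular tree\<close>

text \<open>
  A node of the infinite \<open>\<Delta>\<close>-regular tree is a word over the alphabet \<open>{0, \<dots>, \<Delta> - 1}\<close> in which no
  letter is immediately repeated; the root is the empty word and the parent of \<open>c # x\<close> is \<open>x\<close>.
  The root thus has \<open>\<Delta>\<close> children, and every other node has one parent and \<open>\<Delta> - 1\<close> children.
  Regularity, connectedness and acyclicity are proved below.
\<close>

type_synonym node = "nat list"

definition tree :: "nat \<Rightarrow> node set" where
  "tree \<Delta> = {x. set x \<subseteq> {..<\<Delta>} \<and> distinct_adj x}"

definition edges :: "nat \<Rightarrow> (node \<times> node) set" where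
  "edges \<Delta> = {(x, y). x \<in> tree \<Delta> \<and> y \<in> tree \<Delta> \<and> (\<exists>c. y = c # x \<or> x = c # y)}"

definition tree_dist :: "nat \<Rightarrow> node \<Rightarrow> node \<Rightarrow> nat" where
  "tree_dist \<Delta> x y = (LEAST n. (x, y) \<in> edges \<Delta> ^^ n)"

definition nbhd :: "nat \<Rightarrow> node \<Rightarrow> node set" where
  "nbhd \<Delta> i = insert i {j. (i, j) \<in> edges \<Delta>}"

definition bdry :: "nat \<Rightarrow> node set \<Rightarrow> node set" where
  "bdry \<Delta> S = {i \<in> tree \<Delta> - S. \<exists>j\<in>S. tree_dist \<Delta> i j \<le> 2}"

lemma edges_sym: "(x, y) \<in> edges \<Delta> \<Longrightarrow> (y, x) \<in> edges \<Delta>"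
  by (auto simp: edges_def)

lemma tree_regular:
  assumes "x \<in> tree \<Delta>"
  shows "card {y. (x, y) \<in> edges \<Delta>} = \<Delta>"
proof (cases x)
  case Nil
  have "{y. (x, y) \<in> edges \<Delta>} = (\<lambda>c. [c]) ` {..<\<Delta>}"
    using Nil by (auto simp: edges_def tree_def)
  then show ?thesis by (simp add: card_image inj_on_def)
next
  case (Cons a z)
  have *: "{y. (x, y) \<in> edges \<Delta>} = insert z ((\<lambda>c. c # x) ` ({..<\<Delta>} - {a}))"
    using Cons assms
    by (auto simp: edges_def tree_def distinct_adj_Cons)
  have a: "a < \<Delta>" using Cons assms by (auto simp: tree_def)
  have "z \<notin> (\<lambda>c. c # x) ` ({..<\<Delta>} - {a})"
    using Cons by auto
  then have "card {y. (x, y) \<in> edges \<Delta>} = Suc (card ((\<lambda>c. c # x) ` ({..<\<Delta>} - {a})))"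
    unfolding * by simp
  also have "card ((\<lambda>c. c # x) ` ({..<\<Delta>} - {a})) = \<Delta> - 1"
    using a by (subst card_image) (auto simp: inj_on_def)
  finally show ?thesis using a by simp
qed

lemma tree_connected:
  assumes "x \<in> tree \<Delta>" "y \<in> tree \<Delta>"
  shows "(x, y) \<in> (edges \<Delta>)\<^sup>*"
proof -
  have root: "([], z) \<in> (edges \<Delta>)\<^sup>*" if "z \<in> tree \<Delta>" for z
    using that
  proof (induction z)
    case (Cons c z)
    then have "z \<in> tree \<Delta>" by (auto simp: tree_def distinct_adj_Cons)
    with Cons show ?case
      by (auto simp: edges_def intro: rtrancl_into_rtrancl)
  qed simp
  have "sym ((edges \<Delta>)\<^sup>*)"
    by (rule sym_rtrancl) (auto intro!: symI dest: edges_sym)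
  with root[OF assms(1)] root[OF assms(2)] show ?thesis
    by (meson rtrancl_trans symD)
qed

lemma tree_acyclic:
  fixes c :: "nat \<Rightarrow> node"
  assumes n: "n \<ge> 3" and inj: "inj_on c {..<n}"
    and e: "\<And>i. i < n \<Longrightarrow> (c i, c (Suc i mod n)) \<in> edges \<Delta>"
  shows False
proof -
  have "finite ((\<lambda>i. length (c i)) ` {..<n})" "(\<lambda>i. length (c i)) ` {..<n} \<noteq> {}"
    using n by (auto simp: lessThan_empty_iff)
  from Max_in[OF this] obtain m where m: "m < n"
    and mx: "length (c m) = Max ((\<lambda>i. length (c i)) ` {..<n})" by auto
  have le: "length (c i) \<le> length (c m)" if "i < n" for i
    unfolding mx using that by auto
  define p where "p = (if m = 0 then n - 1 else m - 1)"
  define s where "s = Suc m mod n"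
  have p: "p < n" "Suc p mod n = m" using m n by (auto simp: p_def)
  have s: "s < n" using n by (auto simp: s_def)
  have ps: "p \<noteq> s"
    using m n by (cases "Suc m = n") (auto simp: p_def s_def split: if_splits)
  have "c s = tl (c m)"
    using e[OF m] le[OF s] by (auto simp: edges_def s_def)
  moreover have "c p = tl (c m)"
    using e[OF p(1)] le[OF p(1)] p(2) by (auto simp: edges_def)
  ultimately have "p = s" using inj p s by (auto simp: inj_on_def)
  with ps show False by simp
qed


section \<open>Configurations\<close>

definition configs :: "node set \<Rightarrow> (node \<Rightarrow> nat) set" where
  "configs S = (\<Pi>\<^sub>E i\<in>S. {0, 1})"

definition indep_configs :: "nat \<Rightarrow> node set \<Rightarrow> (node \<Rightarrow> nat) set" where
  "indep_configs \<Delta> S =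
     {\<omega> \<in> configs S. \<forall>i\<in>S. \<forall>j\<in>S. (i, j) \<in> edges \<Delta> \<longrightarrow> \<not> (\<omega> i = 1 \<and> \<omega> j = 1)}"


section \<open>Potentials, Hamiltonian and finite-volume measures\<close>

text \<open>Only the values \<open>\<theta> 0, \<dots>, \<theta> \<Delta>\<close> of \<open>\<theta>\<close> matter: if node \<open>i\<close> has spin 0, then at most its \<open>\<Delta>\<close>
  neighbors have spin 1.\<close>

definition potential :: "nat \<Rightarrow> real \<Rightarrow> (nat \<Rightarrow> real) \<Rightarrow> node \<Rightarrow> (node \<Rightarrow> nat) \<Rightarrow> ereal" where
  "potential \<Delta> lam \<theta> i \<omega> =
     (if \<omega> i = 1 \<and> sum \<omega> (nbhd \<Delta> i) = 1 then ereal (- ln lam)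
      else if \<omega> i = 0 then ereal (- ln (\<theta> (sum \<omega> (nbhd \<Delta> i))))
      else \<infinity>)"

definition hamiltonian ::
    "nat \<Rightarrow> real \<Rightarrow> (nat \<Rightarrow> real) \<Rightarrow> node set \<Rightarrow> (node \<Rightarrow> nat) \<Rightarrow> ereal" where
  "hamiltonian \<Delta> lam \<theta> L \<omega> =
     (\<Sum>i | i \<in> tree \<Delta> \<and> nbhd \<Delta> i \<inter> L \<noteq> {}. potential \<Delta> lam \<theta> i (restrict \<omega> (nbhd \<Delta> i)))"

text \<open>The map \<open>x \<mapsto> exp (- x)\<close> on extended reals greater than \<open>-\<infinity>\<close>.\<close>

definition exp_neg :: "ereal \<Rightarrow> real" where
  "exp_neg x = (if x = \<infinity> then 0 else exp (- real_of_ereal x))"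

definition finite_vol_prob ::
    "nat \<Rightarrow> real \<Rightarrow> (nat \<Rightarrow> real) \<Rightarrow> node set \<Rightarrow> node set \<Rightarrow> (node \<Rightarrow> nat) \<Rightarrow> (node \<Rightarrow> nat) \<Rightarrow> real" where
  "finite_vol_prob \<Delta> lam \<theta> L S \<omega> \<eta> =
     (\<Sum>\<nu> | \<nu> \<in> configs L \<and> restrict \<nu> S = \<omega>.
        exp_neg (hamiltonian \<Delta> lam \<theta> L (merge L (bdry \<Delta> L) (\<nu>, \<eta>)))) /
     (\<Sum>\<nu> | \<nu> \<in> configs L.
        exp_neg (hamiltonian \<Delta> lam \<theta> L (merge L (bdry \<Delta> L) (\<nu>, \<eta>))))"


section \<open>Infinite-volume Gibbs measures\<close>

definition config_space :: "nat \<Rightarrow> (node \<Rightarrow> nat) measure" where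
  "config_space \<Delta> = (\<Pi>\<^sub>M i\<in>tree \<Delta>. count_space {0, 1})"

definition gibbs_measure ::
    "nat \<Rightarrow> real \<Rightarrow> (nat \<Rightarrow> real) \<Rightarrow> (node \<Rightarrow> nat) measure \<Rightarrow> bool" where
  "gibbs_measure \<Delta> lam \<theta> \<mu> \<longleftrightarrow>
     prob_space \<mu> \<and> sets \<mu> = sets (config_space \<Delta>) \<and>
     (AE \<omega> in \<mu>. \<omega> \<in> indep_configs \<Delta> (tree \<Delta>)) \<and>
     (\<forall>L S \<omega>. finite L \<and> L \<subseteq> tree \<Delta> \<and> S \<subseteq> L \<and> \<omega> \<in> configs S \<longrightarrow>
        measure \<mu> {x \<in> space \<mu>. restrict x S = \<omega>} =
        (\<Sum>\<eta>\<in>indep_configs \<Delta> (bdry \<Delta> L).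
           finite_vol_prob \<Delta> lam \<theta> L S \<omega> \<eta> *
           measure \<mu> {x \<in> space \<mu>. restrict x (bdry \<Delta> L) = \<eta>}))"

definition uniqueness_regime :: "nat \<Rightarrow> real \<Rightarrow> (nat \<Rightarrow> real) \<Rightarrow> bool" where
  "uniqueness_regime \<Delta> lam \<theta> \<longleftrightarrow> (\<exists>!\<mu>. gibbs_measure \<Delta> lam \<theta> \<mu>)"


section \<open>The parameters considered\<close>

definition lambda_crit :: "nat \<Rightarrow> real" where
  "lambda_crit \<Delta> = (real \<Delta> - 1) ^ (\<Delta> - 1) / (real \<Delta> - 2) ^ \<Delta>"

definition all_ones :: "nat \<Rightarrow> real" where
  "all_ones k = 1"

definition e_zero :: "nat \<Rightarrow> real" where
  "e_zero k = (if k = 0 then 1 else 0)"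

end

theory Submission
  imports Defs
begin

text \<open>
  With \<open>\<theta> = 1 + h e\<^sub>0\<close> an independent set has weight \<open>\<lambda>\<close> per occupied node and \<open>1 + h\<close> per node whose
  closed neighbourhood is empty. The proof studies the belief propagation recursion of this model.

  \<^bold>\<open>Messages.\<close> The subtree hanging off a node acts on the rest of the tree through a function
  \<open>M a b\<close> of the spin \<open>a\<close> of that node and the spin \<open>b\<close> of its parent. Since \<open>M 1 1 = 0\<close> and only ratios
  matter, it is described by the pair \<open>q = M 0 0 / M 0 1\<close> and \<open>r = M 1 0 / M 0 0\<close>. A node whose children
  \<open>y\<close> send \<open>(q\<^sub>y, r\<^sub>y)\<close> sends
  \<open>q = 1 + h / \<Prod>(1 + r\<^sub>y)\<close> and \<open>r = \<lambda> / (\<Prod>q\<^sub>y \<cdot> (\<Prod>(1 + r\<^sub>y) + h))\<close>.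
  The choice of coordinates is what makes the argument work: both components decrease in every \<open>q\<^sub>y\<close> and
  every \<open>r\<^sub>y\<close>, so that the recursion reverses the componentwise order, although the second-neighbour
  interaction makes the model look non-monotone.

  \<^bold>\<open>Uniqueness means a trivial two-cycle.\<close> Let all \<open>d = \<Delta> - 1\<close> children send the same message, and
  iterate from the least message \<open>(1, 0)\<close>. The even iterates increase, the odd ones decrease, and their
  limits \<open>lower \<le> upper\<close> are exchanged by the recursion. Messages computed from an arbitrary boundary
  condition at distance \<open>k\<close> are trapped between iterates number \<open>k - 1\<close> and \<open>k\<close>
  (\<open>messages_between_orbits\<close>), so \<open>lower = upper\<close> makes the influence of the boundary vanish
  (\<open>uniqueness_of_trivial_cycle\<close>). Conversely, every two-cycle of messages, placed alternately on the levels
  of the tree, defines consistent distributions on balls and hence a Gibbs measure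
  (\<open>gibbs_measure_of_two_cycle\<close>), and if \<open>lower\<close> and \<open>upper\<close> differ, exchanging the two parities changes
  the density at the root (\<open>nonuniqueness_of_nontrivial_cycle\<close>).

  \<^bold>\<open>The scalar problem.\<close> Eliminating \<open>q\<close> and putting \<open>g r = (1 + r)\<^sup>d + h\<close>, the second components
  \<open>r \<le> s\<close> of \<open>lower\<close> and \<open>upper\<close> satisfy \<open>s (g s)\<^sup>d g r = \<lambda> (1 + s)\<^sup>N\<close> with \<open>N = d\<^sup>2\<close>, and the same
  equation with \<open>r\<close> and \<open>s\<close> exchanged. For large \<open>h\<close> both are so small that the quotient of the equations
  forces \<open>r = s\<close> (\<open>trivial_cycle_large\<close>). For \<open>h = 0\<close> the model is the hard-core model at its critical
  fugacity, where the multiplier of the fixed point \<open>1 / (d - 1)\<close> is exactly \<open>-1\<close> and the only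
  two-cycle is the fixed point (\<open>trivial_cycle_zero\<close>). A small positive \<open>h\<close> pushes the multiplier below
  \<open>-1\<close> (\<open>fixed_point_unstable\<close>); moving away from the fixed point in opposite directions then gives a pair
  of messages which the order-reversing map spreads further apart, so that \<open>lower \<noteq> upper\<close>
  (\<open>nontrivial_cycle_small\<close>).
\<close>

section \<open>Sums over configurations\<close>

lemma finite_configs: "finite S \<Longrightarrow> finite (configs S)"
  by (simp add: configs_def finite_PiE)

lemma configs_values: "\<omega> \<in> configs S \<Longrightarrow> x \<in> S \<Longrightarrow> \<omega> x = 0 \<or> \<omega> x = 1"
  by (auto simp: configs_def PiE_def Pi_def)

lemma configs_zero: "(\<lambda>x\<in>S. 0) \<in> configs S"
  by (auto simp: configs_def)

lemma configs_restrict: "\<omega> \<in> configs S \<Longrightarrow> T \<subseteq> S \<Longrightarrow> restrict \<omega> T \<in> configs T"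
  by (auto simp: configs_def PiE_def Pi_def)

lemma configs_restrict_id: "\<omega> \<in> configs S \<Longrightarrow> restrict \<omega> S = \<omega>"
  by (auto simp: configs_def PiE_restrict)

lemma configs_merge:
  "\<sigma> \<in> configs S \<Longrightarrow> \<tau> \<in> configs T \<Longrightarrow> merge S T (\<sigma>, \<tau>) \<in> configs (S \<union> T)"
  by (auto simp: configs_def PiE_def Pi_def merge_def extensional_def)

lemma configs_ext:
  assumes "\<sigma> \<in> configs S" "\<tau> \<in> configs S" "\<And>x. x \<in> S \<Longrightarrow> \<sigma> x = \<tau> x"
  shows "\<sigma> = \<tau>"
  using assms unfolding configs_def by (blast intro: PiE_ext)

lemma restrict_merge_left: "\<sigma> \<in> configs S \<Longrightarrow> restrict (merge S T (\<sigma>, \<tau>)) S = \<sigma>"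
  by (auto simp: configs_def PiE_def extensional_def merge_def restrict_def)

lemma restrict_merge_right:
  "\<tau> \<in> configs T \<Longrightarrow> S \<inter> T = {} \<Longrightarrow> restrict (merge S T (\<sigma>, \<tau>)) T = \<tau>"
  by (auto simp: configs_def PiE_def extensional_def merge_def restrict_def fun_eq_iff)

lemma merge_restrict:
  "\<omega> \<in> configs (S \<union> T) \<Longrightarrow> merge S T (restrict \<omega> S, restrict \<omega> T) = \<omega>"
  by (auto simp: configs_def PiE_def extensional_def merge_def restrict_def fun_eq_iff)

lemma sum_configs_Un:
  fixes f :: "(node \<Rightarrow> nat) \<Rightarrow> 'a :: comm_monoid_add"
  assumes "S \<inter> T = {}"
  shows "(\<Sum>\<omega>\<in>configs (S \<union> T). f \<omega>) =
    (\<Sum>\<sigma>\<in>configs S. \<Sum>\<tau>\<in>configs T. f (merge S T (\<sigma>, \<tau>)))"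
proof -
  have "(\<Sum>\<omega>\<in>configs (S \<union> T). f \<omega>) =
    (\<Sum>p\<in>configs S \<times> configs T. f (merge S T p))"
    by (rule sum.reindex_bij_witness[where i = "merge S T" and j = "\<lambda>\<omega>. (restrict \<omega> S, restrict \<omega> T)"])
      (use assms in \<open>auto simp: merge_restrict restrict_merge_left restrict_merge_right
        configs_merge configs_restrict_id intro: configs_restrict\<close>)
  then show ?thesis by (simp add: sum.cartesian_product)
qed

lemma sum_configs_fibre:
  fixes f :: "(node \<Rightarrow> nat) \<Rightarrow> 'a :: comm_monoid_add"
  assumes "S \<inter> T = {}" "\<omega> \<in> configs S"
  shows "(\<Sum>\<nu> | \<nu> \<in> configs (S \<union> T) \<and> restrict \<nu> S = \<omega>. f \<nu>) =
    (\<Sum>\<tau>\<in>configs T. f (merge S T (\<omega>, \<tau>)))"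
  by (rule sum.reindex_bij_witness[where i = "\<lambda>\<tau>. merge S T (\<omega>, \<tau>)" and j = "\<lambda>\<nu>. restrict \<nu> T"])
    (use assms in \<open>auto simp: restrict_merge_left restrict_merge_right configs_merge merge_restrict
      configs_restrict_id intro: configs_restrict\<close>)

text \<open>Restricting to \<open>T\<close> partitions \<open>configs S\<close>, so a sum can be taken fibre by fibre.\<close>

lemma sum_configs_group:
  fixes f :: "(node \<Rightarrow> nat) \<Rightarrow> 'a :: comm_monoid_add"
  assumes "finite S" "T \<subseteq> S"
  shows "(\<Sum>\<nu> | \<nu> \<in> configs S \<and> P \<nu>. f \<nu>) =
    (\<Sum>\<omega>\<in>configs T. \<Sum>\<nu> | \<nu> \<in> configs S \<and> P \<nu> \<and> restrict \<nu> T = \<omega>. f \<nu>)"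
proof -
  have fin: "finite (configs S)" "finite (configs T)"
    using assms by (auto intro: finite_configs finite_subset)
  have "(\<Sum>\<omega>\<in>configs T. \<Sum>\<nu> | \<nu> \<in> {\<nu>\<in>configs S. P \<nu>} \<and> restrict \<nu> T = \<omega>. f \<nu>) =
    sum f {\<nu>\<in>configs S. P \<nu>}"
    by (rule sum.group) (use fin assms in \<open>auto intro: configs_restrict\<close>)
  then show ?thesis by (simp add: conj_assoc)
qed

text \<open>A weight that is a product of factors depending on disjoint blocks \<open>C x\<close> of sites is summed
  block by block; it is what makes the children of different nodes of a level independent.\<close>

lemma sum_configs_blocks:
  fixes G :: "'b \<Rightarrow> (node \<Rightarrow> nat) \<Rightarrow> 'a :: comm_semiring_1"
  assumes "finite A" "\<And>x. x \<in> A \<Longrightarrow> finite (C x)"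
    and "\<And>x y. x \<in> A \<Longrightarrow> y \<in> A \<Longrightarrow> x \<noteq> y \<Longrightarrow> C x \<inter> C y = {}"
  shows "(\<Sum>\<tau>\<in>configs (\<Union>x\<in>A. C x). \<Prod>x\<in>A. G x (restrict \<tau> (C x))) =
    (\<Prod>x\<in>A. \<Sum>\<tau>\<in>configs (C x). G x \<tau>)"
  using assms
proof (induction A rule: finite_induct)
  case empty
  then show ?case by (simp add: configs_def)
next
  case (insert a A)
  let ?U = "\<Union>x\<in>A. C x"
  have disj: "C a \<inter> ?U = {}" using insert.prems(2)[of a] insert.hyps by auto
  have "(\<Sum>\<tau>\<in>configs (\<Union>x\<in>insert a A. C x). \<Prod>x\<in>insert a A. G x (restrict \<tau> (C x))) =
    (\<Sum>\<sigma>\<in>configs (C a). \<Sum>\<tau>\<in>configs ?U.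
      G a \<sigma> * (\<Prod>x\<in>A. G x (restrict \<tau> (C x))))"
    unfolding UN_insert sum_configs_Un[OF disj]
  proof (intro sum.cong refl)
    fix \<sigma> \<tau> assume st: "\<sigma> \<in> configs (C a)" "\<tau> \<in> configs ?U"
    have "restrict (merge (C a) ?U (\<sigma>, \<tau>)) (C x) = restrict \<tau> (C x)" if "x \<in> A" for x
      using disj that by (auto simp: merge_def restrict_def fun_eq_iff)
    then show "(\<Prod>x\<in>insert a A. G x (restrict (merge (C a) ?U (\<sigma>, \<tau>)) (C x))) =
      G a \<sigma> * (\<Prod>x\<in>A. G x (restrict \<tau> (C x)))"
      using insert.hyps st by (simp add: restrict_merge_left)
  qed
  also have "\<dots> = (\<Sum>\<sigma>\<in>configs (C a). G a \<sigma>) *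
      (\<Sum>\<tau>\<in>configs ?U. \<Prod>x\<in>A. G x (restrict \<tau> (C x)))"
    by (simp add: sum_product)
  also have "\<dots> = (\<Prod>x\<in>insert a A. \<Sum>\<tau>\<in>configs (C x). G x \<tau>)"
    using insert.hyps insert.prems by (subst insert.IH) auto
  finally show ?case .
qed

lemma sum_configs_prod:
  fixes g :: "node \<Rightarrow> nat \<Rightarrow> 'a :: comm_semiring_1"
  assumes "finite S"
  shows "(\<Sum>\<tau>\<in>configs S. \<Prod>y\<in>S. g y (\<tau> y)) = (\<Prod>y\<in>S. g y 0 + g y 1)"
proof -
  have "(\<Prod>y\<in>S. \<Sum>a\<in>{0,1}. g y a) = (\<Sum>\<tau>\<in>configs S. \<Prod>y\<in>S. g y (\<tau> y))"
    unfolding configs_def by (rule prod_sum_PiE) (use assms in auto)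
  then show ?thesis by simp
qed

lemma sum_configs_eq_0_iff:
  assumes "\<tau> \<in> configs S" "finite S"
  shows "sum \<tau> S = 0 \<longleftrightarrow> \<tau> = (\<lambda>x\<in>S. 0)"
proof
  assume "sum \<tau> S = 0"
  then show "\<tau> = (\<lambda>x\<in>S. 0)"
    using assms by (intro configs_ext[of _ S]) (auto simp: configs_zero)
qed auto


section \<open>Levels and balls of the tree\<close>

definition children :: "nat \<Rightarrow> node \<Rightarrow> node set" where
  "children \<Delta> x = {y \<in> tree \<Delta>. y \<noteq> [] \<and> tl y = x}"

definition level :: "nat \<Rightarrow> nat \<Rightarrow> node set" where
  "level \<Delta> n = {x \<in> tree \<Delta>. length x = n}"

definition tree_ball :: "nat \<Rightarrow> nat \<Rightarrow> node set" where
  "tree_ball \<Delta> n = {x \<in> tree \<Delta>. length x \<le> n}"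

lemma finite_tree_ball [simp]: "finite (tree_ball \<Delta> n)"
  by (rule finite_subset[OF _ finite_lists_length_le[of "{..<\<Delta>}" n]])
    (auto simp: tree_ball_def tree_def)

lemma level_subset_ball: "m \<le> n \<Longrightarrow> level \<Delta> m \<subseteq> tree_ball \<Delta> n"
  by (auto simp: level_def tree_ball_def)

lemma ball_mono: "m \<le> n \<Longrightarrow> tree_ball \<Delta> m \<subseteq> tree_ball \<Delta> n"
  by (auto simp: tree_ball_def)

lemma finite_level [simp]: "finite (level \<Delta> n)"
  by (rule finite_subset[OF level_subset_ball[OF order_refl]]) simp

lemma ball_Suc: "tree_ball \<Delta> (Suc n) = tree_ball \<Delta> n \<union> level \<Delta> (Suc n)"
  by (auto simp: tree_ball_def level_def)

lemma ball_level_disjoint: "n < k \<Longrightarrow> tree_ball \<Delta> n \<inter> level \<Delta> k = {}"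
  by (auto simp: tree_ball_def level_def)

lemma ball_0: "tree_ball \<Delta> 0 = {[]}"
  by (auto simp: tree_ball_def tree_def)

lemma level_0: "level \<Delta> 0 = {[]}"
  by (auto simp: level_def tree_def)

lemma tree_tl: "x \<in> tree \<Delta> \<Longrightarrow> tl x \<in> tree \<Delta>"
  by (cases x) (auto simp: tree_def distinct_adj_Cons)

lemma Nil_in_tree [simp]: "[] \<in> tree \<Delta>"
  by (simp add: tree_def)

lemma children_subset_level: "x \<in> level \<Delta> n \<Longrightarrow> children \<Delta> x \<subseteq> level \<Delta> (Suc n)"
  by (auto simp: children_def level_def)

lemma length_children: "y \<in> children \<Delta> x \<Longrightarrow> length y = Suc (length x)"
  by (cases y) (auto simp: children_def)

lemma children_subset_tree: "children \<Delta> x \<subseteq> tree \<Delta>"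
  by (auto simp: children_def)

lemma finite_children [simp]: "finite (children \<Delta> x)"
proof (rule finite_subset)
  show "children \<Delta> x \<subseteq> (\<lambda>c. c # x) ` {..<\<Delta>}"
  proof
    fix y assume "y \<in> children \<Delta> x"
    then show "y \<in> (\<lambda>c. c # x) ` {..<\<Delta>}"
      by (cases y) (auto simp: children_def tree_def)
  qed
qed simp

lemma UN_children_level: "(\<Union>x\<in>level \<Delta> n. children \<Delta> x) = level \<Delta> (Suc n)"
proof
  show "level \<Delta> (Suc n) \<subseteq> (\<Union>x\<in>level \<Delta> n. children \<Delta> x)"
  proof
    fix y assume y: "y \<in> level \<Delta> (Suc n)"
    then have "tl y \<in> level \<Delta> n" "y \<in> children \<Delta> (tl y)"
      using tree_tl[of y] by (auto simp: level_def children_def)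
    then show "y \<in> (\<Union>x\<in>level \<Delta> n. children \<Delta> x)" by blast
  qed
qed (use children_subset_level in blast)

lemma children_disjoint: "x \<noteq> y \<Longrightarrow> children \<Delta> x \<inter> children \<Delta> y = {}"
  by (auto simp: children_def)

lemma children_image:
  assumes "x \<in> tree \<Delta>"
  shows "children \<Delta> x = (\<lambda>c. c # x) ` ({..<\<Delta>} - (if x = [] then {} else {hd x}))"
    (is "?L = ?R")
proof (intro set_eqI iffI)
  fix y assume "y \<in> ?L"
  then show "y \<in> ?R"
    by (cases y; cases x) (auto simp: children_def tree_def)
next
  fix y assume "y \<in> ?R"
  then show "y \<in> ?L"
    using assms by (cases x) (auto simp: children_def tree_def)
qed

lemma card_children:
  assumes "x \<in> tree \<Delta>"
  shows "card (children \<Delta> x) = (if x = [] then \<Delta> else \<Delta> - 1)"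
proof -
  have "x \<noteq> [] \<Longrightarrow> hd x < \<Delta>" using assms by (cases x) (auto simp: tree_def)
  then show ?thesis
    unfolding children_image[OF assms] by (subst card_image) (auto simp: inj_on_def)
qed

lemma edges_iff:
  assumes "x \<in> tree \<Delta>"
  shows "(x, y) \<in> edges \<Delta> \<longleftrightarrow> y \<in> children \<Delta> x \<or> (x \<noteq> [] \<and> y = tl x)"
proof
  assume "(x, y) \<in> edges \<Delta>"
  then show "y \<in> children \<Delta> x \<or> (x \<noteq> [] \<and> y = tl x)"
    by (auto simp: edges_def children_def)
next
  assume "y \<in> children \<Delta> x \<or> (x \<noteq> [] \<and> y = tl x)"
  then show "(x, y) \<in> edges \<Delta>"
    using assms tree_tl[OF assms] by (cases x; cases y) (auto simp: edges_def children_def)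
qed

lemma nbhd_eq:
  assumes "x \<in> tree \<Delta>"
  shows "nbhd \<Delta> x = insert x (children \<Delta> x \<union> (if x = [] then {} else {tl x}))"
  using edges_iff[OF assms] by (auto simp: nbhd_def)

lemma nbhd_subset_tree: "x \<in> tree \<Delta> \<Longrightarrow> nbhd \<Delta> x \<subseteq> tree \<Delta>"
  by (auto simp: nbhd_def edges_def)

lemma nbhd_sym: "x \<in> tree \<Delta> \<Longrightarrow> y \<in> nbhd \<Delta> x \<Longrightarrow> x \<in> nbhd \<Delta> y"
  using edges_sym by (auto simp: nbhd_def)

lemma nbhd_subset_ball: "x \<in> tree_ball \<Delta> n \<Longrightarrow> nbhd \<Delta> x \<subseteq> tree_ball \<Delta> (Suc n)"
  using tree_tl[of x \<Delta>] children_subset_tree[of \<Delta> x] length_children[of _ \<Delta> x]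
  by (fastforce simp: nbhd_eq tree_ball_def split: if_splits)

text \<open>The part of a configuration around a node is split into the node, its parent and its children.
  The root gets a fictitious parent with spin \<open>0\<close>, so that it needs no separate treatment.\<close>

definition pspin :: "(node \<Rightarrow> nat) \<Rightarrow> node \<Rightarrow> nat" where
  "pspin \<omega> x = (if x = [] then 0 else \<omega> (tl x))"

lemma sum_nbhd:
  assumes "x \<in> tree \<Delta>"
  shows "sum \<omega> (nbhd \<Delta> x) = \<omega> x + pspin \<omega> x + sum \<omega> (children \<Delta> x)"
proof (cases x)
  case Nil
  have "x \<notin> children \<Delta> x" using length_children[of x \<Delta> x] by auto
  with Nil show ?thesis using assms by (simp add: nbhd_eq pspin_def)
next
  case (Cons c z)
  have *: "x \<notin> insert z (children \<Delta> x)" "z \<notin> children \<Delta> x"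
    using Cons length_children[of _ \<Delta> x] by force+
  have "nbhd \<Delta> x = insert x (insert z (children \<Delta> x))"
    using Cons assms by (auto simp: nbhd_eq)
  then show ?thesis using Cons * by (simp add: pspin_def)
qed


subsection \<open>The boundary of a finite set\<close>

lemma edges_length: "(x, y) \<in> edges \<Delta> \<Longrightarrow> length y \<le> Suc (length x)"
  by (auto simp: edges_def)

lemma edges_relpow_length: "(x, y) \<in> edges \<Delta> ^^ n \<Longrightarrow> length y \<le> length x + n"
proof (induction n arbitrary: y)
  case (Suc n)
  then obtain z where "(x, z) \<in> edges \<Delta> ^^ n" "(z, y) \<in> edges \<Delta>" by auto
  with Suc.IH[of z] edges_length[of z y] show ?case by fastforce
qed simp

lemma tree_dist_le: "(x, y) \<in> edges \<Delta> ^^ n \<Longrightarrow> tree_dist \<Delta> x y \<le> n"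
  by (simp add: tree_dist_def Least_le)

lemma length_le_tree_dist:
  assumes "x \<in> tree \<Delta>" "y \<in> tree \<Delta>"
  shows "length y \<le> length x + tree_dist \<Delta> x y"
proof -
  obtain n where "(x, y) \<in> edges \<Delta> ^^ n"
    using tree_connected[OF assms] rtrancl_imp_relpow by blast
  then have "(x, y) \<in> edges \<Delta> ^^ tree_dist \<Delta> x y"
    unfolding tree_dist_def by (rule LeastI)
  then show ?thesis by (rule edges_relpow_length)
qed

lemma tree_dist_commute:
  assumes "x \<in> tree \<Delta>" "y \<in> tree \<Delta>"
  shows "tree_dist \<Delta> x y = tree_dist \<Delta> y x"
proof -
  have "(x, y) \<in> edges \<Delta> ^^ n \<Longrightarrow> (y, x) \<in> edges \<Delta> ^^ n" for x y n
  proof (induction n arbitrary: y)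
    case (Suc n)
    then show ?case by (metis edges_sym relpow_Suc_E relpow_Suc_I2)
  qed simp
  then show ?thesis unfolding tree_dist_def by metis
qed

lemma bdry_subset_tree: "bdry \<Delta> L \<subseteq> tree \<Delta>"
  by (auto simp: bdry_def)

lemma bdry_disjoint: "L \<inter> bdry \<Delta> L = {}"
  by (auto simp: bdry_def)

lemma bdry_subset_ball:
  assumes "L \<subseteq> tree_ball \<Delta> n"
  shows "bdry \<Delta> L \<subseteq> tree_ball \<Delta> (n + 2)"
proof
  fix i assume "i \<in> bdry \<Delta> L"
  then obtain j where i: "i \<in> tree \<Delta>" and j: "j \<in> L" "tree_dist \<Delta> i j \<le> 2"
    by (auto simp: bdry_def)
  have jt: "j \<in> tree \<Delta>" "length j \<le> n" using j assms by (auto simp: tree_ball_def)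
  have "length i \<le> length j + tree_dist \<Delta> i j"
    using length_le_tree_dist[OF jt(1) i] tree_dist_commute[OF i jt(1)] by simp
  then show "i \<in> tree_ball \<Delta> (n + 2)" using i j jt by (auto simp: tree_ball_def)
qed

text \<open>Two nodes of one closed neighbourhood are at distance at most \<open>2\<close>. This is why the boundary of \<open>L\<close>
  contains everything the potentials meeting \<open>L\<close> can see.\<close>

lemma nbhd_subset_bdry:
  assumes i: "i \<in> tree \<Delta>" and L: "nbhd \<Delta> i \<inter> L \<noteq> {}"
  shows "nbhd \<Delta> i \<subseteq> L \<union> bdry \<Delta> L"
proof
  fix k assume k: "k \<in> nbhd \<Delta> i"
  obtain j where j: "j \<in> nbhd \<Delta> i" "j \<in> L" using L by auto
  have step: "\<exists>n\<le>1. (a, b) \<in> edges \<Delta> ^^ n" if "b \<in> nbhd \<Delta> a" for a b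
  proof (cases "a = b")
    case True
    then show ?thesis by (intro exI[of _ 0]) auto
  next
    case False
    with that show ?thesis by (intro exI[of _ 1]) (auto simp: nbhd_def)
  qed
  obtain m n where "m \<le> 1" "n \<le> 1" "(k, i) \<in> edges \<Delta> ^^ m" "(i, j) \<in> edges \<Delta> ^^ n"
    using step[of i k] step[of j i] step[OF nbhd_sym[OF i k]] j by meson
  then have "(k, j) \<in> edges \<Delta> ^^ (m + n)" "m + n \<le> 2"
    by (auto simp: relpow_add)
  then have "tree_dist \<Delta> k j \<le> 2" using tree_dist_le order_trans by blast
  moreover have "k \<in> tree \<Delta>" using nbhd_subset_tree[OF i] k by auto
  ultimately show "k \<in> L \<union> bdry \<Delta> L" using j by (auto simp: bdry_def)
qed

lemma bdry_ball: "bdry \<Delta> (tree_ball \<Delta> n) = level \<Delta> (n + 1) \<union> level \<Delta> (n + 2)"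
proof (intro equalityI subsetI)
  fix x assume "x \<in> bdry \<Delta> (tree_ball \<Delta> n)"
  then have "x \<in> tree_ball \<Delta> (n + 2)" "x \<notin> tree_ball \<Delta> n"
    using bdry_subset_ball[of "tree_ball \<Delta> n" \<Delta> n] by (auto simp: bdry_def)
  then show "x \<in> level \<Delta> (n + 1) \<union> level \<Delta> (n + 2)"
    by (auto simp: tree_ball_def level_def)
next
  fix x assume x: "x \<in> level \<Delta> (n + 1) \<union> level \<Delta> (n + 2)"
  have xt: "x \<in> tree \<Delta>" "x \<noteq> []" "x \<notin> tree_ball \<Delta> n" using x by (auto simp: level_def tree_ball_def)
  \<comment> \<open>the neighbourhood of the parent meets the ball and contains \<open>x\<close>\<close>
  have t: "tl x \<in> tree \<Delta>" using xt tree_tl by auto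
  have "x \<in> nbhd \<Delta> (tl x)" using xt t by (simp add: nbhd_eq) (simp add: children_def)
  moreover have "nbhd \<Delta> (tl x) \<inter> tree_ball \<Delta> n \<noteq> {}"
  proof (cases "tl x = []")
    case True
    then show ?thesis by (auto simp: nbhd_def tree_ball_def)
  next
    case False
    then have "tl (tl x) \<in> nbhd \<Delta> (tl x) \<inter> tree_ball \<Delta> n"
      using x t tree_tl[OF t] by (auto simp: nbhd_eq tree_ball_def level_def)
    then show ?thesis by auto
  qed
  ultimately show "x \<in> bdry \<Delta> (tree_ball \<Delta> n)"
    using nbhd_subset_bdry[OF t] xt by blast
qed

lemma nbhd_meets_ball:
  "{i \<in> tree \<Delta>. nbhd \<Delta> i \<inter> tree_ball \<Delta> n \<noteq> {}} = tree_ball \<Delta> (Suc n)"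
proof (intro equalityI subsetI; clarsimp)
  fix i j assume i: "i \<in> tree \<Delta>" and "nbhd \<Delta> i \<inter> tree_ball \<Delta> n \<noteq> {}"
  then obtain j where j: "j \<in> nbhd \<Delta> i" "j \<in> tree_ball \<Delta> n" by auto
  then show "i \<in> tree_ball \<Delta> (Suc n)" using nbhd_subset_ball[of j] nbhd_sym[OF i] by auto
next
  fix i assume i: "i \<in> tree_ball \<Delta> (Suc n)"
  then have "i \<in> tree \<Delta>" by (auto simp: tree_ball_def)
  moreover have "i \<in> tree_ball \<Delta> n \<or> i \<noteq> [] \<and> tl i \<in> tree_ball \<Delta> n"
    using i tree_tl[of i] by (auto simp: tree_ball_def)
  ultimately show "i \<in> tree \<Delta> \<and> nbhd \<Delta> i \<inter> tree_ball \<Delta> n \<noteq> {}" by (auto simp: nbhd_eq)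
qed

lemma nbhd_meets_subset_ball:
  assumes "L \<subseteq> tree_ball \<Delta> n"
  shows "{i \<in> tree \<Delta>. nbhd \<Delta> i \<inter> L \<noteq> {}} \<subseteq> tree_ball \<Delta> (Suc n)"
  using assms nbhd_meets_ball[of \<Delta> n] by blast

lemma finite_subset_ball:
  assumes "finite S" "S \<subseteq> tree \<Delta>"
  obtains n where "S \<subseteq> tree_ball \<Delta> n"
proof
  show "S \<subseteq> tree_ball \<Delta> (Max (insert 0 (length ` S)))"
    using assms by (auto simp: tree_ball_def)
qed


section \<open>The homogeneous message map\<close>

text \<open>A message is a pair \<open>(q, r)\<close>. The pairs that occur are those above \<open>(1, 0)\<close>: a node at spin \<open>0\<close> is
  weighted at least as much next to an unoccupied parent as next to an occupied one.\<close>

definition valid :: "real \<times> real \<Rightarrow> bool" where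
  "valid z \<longleftrightarrow> 1 \<le> fst z \<and> 0 \<le> snd z"

definition below :: "real \<times> real \<Rightarrow> real \<times> real \<Rightarrow> bool" where
  "below z w \<longleftrightarrow> fst z \<le> fst w \<and> snd z \<le> snd w"

lemma below_trans: "below x y \<Longrightarrow> below y z \<Longrightarrow> below x z"
  by (auto simp: below_def)

lemma valid_above: "valid z \<Longrightarrow> below z w \<Longrightarrow> valid w"
  by (auto simp: valid_def below_def)

lemma valid_iff: "valid z \<longleftrightarrow> below (1, 0) z"
  by (simp add: valid_def below_def)

locale message_map =
  fixes d :: nat and lam h :: real
  assumes d_ge_2: "d \<ge> 2" and lam_gt_0: "lam > 0" and h_ge_0: "h \<ge> 0"
begin

text \<open>The message sent by a node all of whose \<open>d\<close> children send \<open>z\<close>.\<close>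

definition step :: "real \<times> real \<Rightarrow> real \<times> real" where
  "step z = (1 + h / (1 + snd z) ^ d, lam / (fst z ^ d * ((1 + snd z) ^ d + h)))"

lemma denominators_pos:
  assumes "valid z"
  shows "(1 + snd z) ^ d > 0" "fst z ^ d > 0" "(1 + snd z) ^ d + h > 0"
  using assms h_ge_0 by (auto simp: valid_def intro!: add_pos_nonneg zero_less_power)

text \<open>Both numerators are constants and both denominators grow with either component. With \<open>q r\<close> in
  place of \<open>r\<close> as second coordinate this would fail.\<close>

lemma step_antimono:
  assumes "valid z" "below z w"
  shows "below (step w) (step z)"
proof -
  have "(1 + snd z) ^ d \<le> (1 + snd w) ^ d" "fst z ^ d \<le> fst w ^ d"
    using assms by (auto simp: valid_def below_def intro!: power_mono)
  moreover have "valid w" using assms valid_above by blast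
  ultimately show ?thesis
    using denominators_pos[OF assms(1)] denominators_pos[of w] h_ge_0 lam_gt_0
    by (auto simp: below_def step_def intro!: divide_left_mono mult_mono mult_pos_pos)
qed

lemma step_valid:
  assumes "valid z"
  shows "valid (step z)"
proof -
  note pos = denominators_pos[OF assms]
  have "0 \<le> h / (1 + snd z) ^ d" "0 \<le> lam / (fst z ^ d * ((1 + snd z) ^ d + h))"
    using divide_nonneg_pos[OF h_ge_0 pos(1)] divide_pos_pos[OF lam_gt_0 mult_pos_pos[OF pos(2,3)]]
    by simp_all
  then show ?thesis by (simp only: valid_def step_def fst_conv snd_conv) simp
qed

lemma tendsto_step:
  assumes "X \<longlonglongrightarrow> z" "valid z"
  shows "(\<lambda>n. step (X n)) \<longlonglongrightarrow> step z"
proof -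
  have "(1 + snd z) ^ d \<noteq> 0" "fst z ^ d * ((1 + snd z) ^ d + h) \<noteq> 0"
    using denominators_pos[OF assms(2)] by (metis less_irrefl mult_pos_pos)+
  then show ?thesis unfolding step_def by (intro tendsto_intros assms)
qed

subsection \<open>The extremal two-cycle\<close>

definition orbit :: "nat \<Rightarrow> real \<times> real" where
  "orbit n = (step ^^ n) (1, 0)"

lemma orbit_Suc: "orbit (Suc n) = step (orbit n)"
  by (simp add: orbit_def)

lemma orbit_valid: "valid (orbit n)"
  by (induction n) (simp_all add: orbit_Suc step_valid, simp add: orbit_def valid_def)

text \<open>The orbit starts at the least message, so its first two steps do not go below the start; applying the
  order-reversing map again and again yields all other comparisons.\<close>

lemma orbit_mono:
  "below (orbit (2 * n)) (orbit (2 * n + 2)) \<and> below (orbit (2 * n + 3)) (orbit (2 * n + 1)) \<and>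
   below (orbit (2 * n)) (orbit (2 * n + 1))"
proof -
  have anti: "below (orbit m) (orbit k) \<Longrightarrow> below (orbit (Suc k)) (orbit (Suc m))" for m k
    by (simp add: orbit_Suc step_antimono orbit_valid)
  have "below (orbit (2 * n)) (orbit (2 * n + 2)) \<and> below (orbit (2 * n)) (orbit (2 * n + 1))"
  proof (induction n)
    case 0
    have "orbit 0 = (1, 0)" by (simp add: orbit_def)
    then show ?case using orbit_valid by (simp add: valid_iff)
  next
    case (Suc n)
    have "below (orbit (2 * n + 3)) (orbit (2 * n + 1))"
      using anti[of "2 * n" "2 * n + 2"] Suc by (simp add: numeral_3_eq_3)
    from anti[OF this] have 1: "below (orbit (2 * n + 2)) (orbit (2 * n + 4))"
      by (simp add: numeral_eq_Suc)
    have "below (orbit (2 * n + 2)) (orbit (2 * n + 1))"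
      using anti[of "2 * n" "2 * n + 1"] Suc by simp
    from anti[OF this] have "below (orbit (2 * n + 2)) (orbit (2 * n + 3))"
      by (simp add: numeral_eq_Suc)
    with 1 show ?case by (simp add: numeral_eq_Suc)
  qed
  then show ?thesis using anti[of "2 * n" "2 * n + 2"] by (simp add: numeral_eq_Suc)
qed

lemma orbit_limits_exist:
  obtains z w where "(\<lambda>n. orbit (2 * n)) \<longlonglongrightarrow> z" "(\<lambda>n. orbit (2 * n + 1)) \<longlonglongrightarrow> w"
proof -
  have inc: "incseq (\<lambda>n. fst (orbit (2 * n)))" "incseq (\<lambda>n. snd (orbit (2 * n)))"
    and dec: "decseq (\<lambda>n. fst (orbit (2 * n + 1)))" "decseq (\<lambda>n. snd (orbit (2 * n + 1)))"
    using orbit_mono by (auto simp: incseq_Suc_iff decseq_Suc_iff below_def numeral_eq_Suc)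
  have "fst (orbit (2 * n)) \<le> fst (orbit 1)" "snd (orbit (2 * n)) \<le> snd (orbit 1)" for n
    using orbit_mono[of n] decseqD[OF dec(1), of 0 n] decseqD[OF dec(2), of 0 n]
    by (auto simp: below_def)
  moreover have "1 \<le> fst (orbit (2 * n + 1))" "0 \<le> snd (orbit (2 * n + 1))" for n
    using orbit_valid[of "2 * n + 1"] by (auto simp: valid_def)
  note bounds = this calculation
  obtain a where "(\<lambda>n. fst (orbit (2 * n))) \<longlonglongrightarrow> a"
    by (rule incseq_convergent[OF inc(1), of "fst (orbit 1)"]) (use bounds in auto)
  moreover obtain b where "(\<lambda>n. snd (orbit (2 * n))) \<longlonglongrightarrow> b"
    by (rule incseq_convergent[OF inc(2), of "snd (orbit 1)"]) (use bounds in auto)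
  moreover obtain a' where "(\<lambda>n. fst (orbit (2 * n + 1))) \<longlonglongrightarrow> a'"
    by (rule decseq_convergent[OF dec(1), of 1]) (use bounds in auto)
  moreover obtain b' where "(\<lambda>n. snd (orbit (2 * n + 1))) \<longlonglongrightarrow> b'"
    by (rule decseq_convergent[OF dec(2), of 0]) (use bounds in auto)
  ultimately have "(\<lambda>n. orbit (2 * n)) \<longlonglongrightarrow> (a, b)" "(\<lambda>n. orbit (2 * n + 1)) \<longlonglongrightarrow> (a', b')"
    by (auto dest: tendsto_Pair)
  then show thesis using that by blast
qed

definition lower :: "real \<times> real" where "lower = lim (\<lambda>n. orbit (2 * n))"
definition upper :: "real \<times> real" where "upper = lim (\<lambda>n. orbit (2 * n + 1))"

lemma orbit_tendsto:
  shows "(\<lambda>n. orbit (2 * n)) \<longlonglongrightarrow> lower" and "(\<lambda>n. orbit (2 * n + 1)) \<longlonglongrightarrow> upper"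
  using orbit_limits_exist by (metis lower_def limI) (use orbit_limits_exist in \<open>metis upper_def limI\<close>)

lemma below_limit:
  assumes "X \<longlonglongrightarrow> z" "Y \<longlonglongrightarrow> w" "\<And>n. below (X n) (Y n)"
  shows "below z w"
  using assms LIMSEQ_le[OF tendsto_fst tendsto_fst, OF assms(1,2)]
    LIMSEQ_le[OF tendsto_snd tendsto_snd, OF assms(1,2)]
  by (auto simp: below_def)

lemma lower_valid: "valid lower" and upper_valid: "valid upper"
  using below_limit[OF tendsto_const orbit_tendsto(1)] below_limit[OF tendsto_const orbit_tendsto(2)]
    orbit_valid by (auto simp: valid_iff)

lemma step_lower: "step lower = upper"
proof -
  have "(\<lambda>n. orbit (2 * n + 1)) \<longlonglongrightarrow> step lower"
    using tendsto_step[OF orbit_tendsto(1) lower_valid] by (simp add: orbit_Suc)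
  then show ?thesis using LIMSEQ_unique orbit_tendsto(2) by blast
qed

lemma step_upper: "step upper = lower"
proof -
  have "(\<lambda>n. orbit (2 * Suc n)) \<longlonglongrightarrow> step upper"
    using tendsto_step[OF orbit_tendsto(2) upper_valid] by (simp add: orbit_Suc)
  moreover have "(\<lambda>n. orbit (2 * Suc n)) \<longlonglongrightarrow> lower"
    using orbit_tendsto(1) by (rule LIMSEQ_Suc[where f = "\<lambda>n. orbit (2 * n)"])
  ultimately show ?thesis using LIMSEQ_unique by blast
qed

lemma lower_below_upper: "below lower upper"
  using below_limit[OF orbit_tendsto] orbit_mono by blast

text \<open>If the image of \<open>z\<close> lies above \<open>w\<close> and the image of \<open>w\<close> below \<open>z\<close>, the orbit can never enter the
  order interval between \<open>z\<close> and \<open>w\<close>: its even members stay below it and its odd members above it. A strict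
  pair of this kind is therefore a certificate for \<open>lower \<noteq> upper\<close>.\<close>

lemma subcycle_between:
  assumes z: "valid z" "below z w" and sub: "below w (step z)" "below (step w) z"
  shows "below lower z" "below w upper"
proof -
  have w: "valid w" using z valid_above by blast
  have "below (orbit (2 * n)) z \<and> below w (orbit (2 * n + 1))" for n
  proof (induction n)
    case 0
    have "orbit 0 = (1, 0)" by (simp add: orbit_def)
    then have "below (orbit 0) z" using z by (simp add: valid_iff)
    then have "below (step z) (orbit 1)"
      using step_antimono[OF orbit_valid, of 0 z] by (simp add: orbit_Suc)
    then show ?case using \<open>below (orbit 0) z\<close> sub below_trans by auto
  next
    case (Suc n)
    have "below (orbit (2 * n + 2)) (step w)"
      using step_antimono[OF w, of "orbit (2 * n + 1)"] Suc by (simp add: orbit_Suc)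
    then have 1: "below (orbit (2 * n + 2)) z" using sub below_trans by blast
    then have "below (step z) (orbit (2 * n + 3))"
      using step_antimono[OF orbit_valid, of "2 * n + 2" z] by (simp add: orbit_Suc numeral_eq_Suc)
    from below_trans[OF sub(1) this] 1 show ?case by (simp add: numeral_eq_Suc)
  qed
  then show "below lower z" "below w upper"
    using below_limit[OF orbit_tendsto(1) tendsto_const] below_limit[OF tendsto_const orbit_tendsto(2)]
    by blast+
qed

subsection \<open>The cycle in terms of the second component\<close>

definition g :: "real \<Rightarrow> real" where "g r = (1 + r) ^ d + h"

lemma g_pos: "r \<ge> 0 \<Longrightarrow> g r > 0"
  using h_ge_0 by (auto simp: g_def intro!: add_pos_nonneg)

lemma g_ge_1: "r \<ge> 0 \<Longrightarrow> g r \<ge> 1"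
  using h_ge_0 one_le_power[of "1 + r" d] by (auto simp: g_def intro: add_increasing2)

lemma g_mono: "0 \<le> r \<Longrightarrow> r \<le> s \<Longrightarrow> g r \<le> g s"
  by (auto simp: g_def intro!: power_mono)

lemma q_eq: "r \<ge> 0 \<Longrightarrow> 1 + h / (1 + r) ^ d = g r / (1 + r) ^ d"
  by (simp add: g_def field_simps)

lemma step_Pair_snd:
  assumes "r \<ge> 0" "s \<ge> 0"
  shows "snd (step (1 + h / (1 + s) ^ d, r)) = lam * (1 + s) ^ (d * d) / (g s ^ d * g r)"
proof -
  have "(1 + s) ^ d > 0" using assms by auto
  then show ?thesis
    unfolding q_eq[OF assms(2)] by (simp add: step_def g_def power_divide power_mult)
qed

lemma step_fst: "fst (step z) = 1 + h / (1 + snd z) ^ d"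
  by (simp add: step_def)

text \<open>The first component of a message is a function of the second component of its predecessor. On a
  two-cycle the predecessor of the predecessor is the message itself, which eliminates \<open>q\<close> altogether.\<close>

lemma cycle_equations:
  defines "r \<equiv> snd lower" and "s \<equiv> snd upper"
  shows "0 < r" "r \<le> s"
    and "s * g s ^ d * g r = lam * (1 + s) ^ (d * d)"
    and "r * g r ^ d * g s = lam * (1 + r) ^ (d * d)"
    and "r = s \<Longrightarrow> lower = upper"
    and "s \<le> lam / (1 + h)"
proof -
  show rs: "r \<le> s" using lower_below_upper by (simp add: r_def s_def below_def)
  have r0: "r \<ge> 0" using lower_valid by (simp add: r_def valid_def)
  have lo: "lower = (1 + h / (1 + s) ^ d, r)" and up: "upper = (1 + h / (1 + r) ^ d, s)"
    using step_fst[of upper] step_fst[of lower] unfolding step_lower step_upper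
    by (auto simp: r_def s_def prod_eq_iff)
  have s_eq: "s = lam * (1 + s) ^ (d * d) / (g s ^ d * g r)"
    using step_Pair_snd[of r s] step_lower rs r0 unfolding lo[symmetric] by (simp add: s_def)
  have r_eq: "r = lam * (1 + r) ^ (d * d) / (g r ^ d * g s)"
    using step_Pair_snd[of s r] step_upper rs r0 unfolding up[symmetric] by (simp add: r_def)
  show "0 < r"
    using g_pos[of r] g_pos[of s] r0 rs lam_gt_0 by (subst r_eq) auto
  show "s * g s ^ d * g r = lam * (1 + s) ^ (d * d)"
    using s_eq g_pos[of r] g_pos[of s] r0 rs by (simp add: field_simps)
  show "r * g r ^ d * g s = lam * (1 + r) ^ (d * d)"
    using r_eq g_pos[of r] g_pos[of s] r0 rs by (simp add: field_simps)
  show "r = s \<Longrightarrow> lower = upper" unfolding lo up by simp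
  have "below upper (step (1, 0))"
    using step_antimono[of "(1,0)" lower] lower_valid step_lower by (simp add: valid_iff below_def)
  then show "s \<le> lam / (1 + h)" by (simp add: s_def step_def below_def)
qed

text \<open>Dividing the two cycle equations shows that \<open>x \<mapsto> x (g x)\<^bsup>d - 1\<^esup> / (1 + x)\<^sup>N\<close>, \<open>N = d\<^sup>2\<close>, takes
  the same value at both points of the cycle. The bound on \<open>\<lambda>\<close> puts both points into the interval from \<open>0\<close> to
  \<open>1 / N\<close>, on which \<open>x / (1 + x)\<^sup>N\<close> is strictly increasing; \<open>g\<close> increases everywhere.\<close>

lemma trivial_cycle_large:
  assumes "lam * real (d * d) \<le> 1 + h"
  shows "lower = upper"
proof (rule ccontr)
  assume "lower \<noteq> upper"
  define r s N where "r = snd lower" and "s = snd upper" and "N = d * d"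
  note cyc = cycle_equations[folded r_def s_def N_def]
  have rs: "0 < r" "r < s" using cyc \<open>lower \<noteq> upper\<close> by force+
  have gp: "g r > 0" "g s > 0" "g r \<le> g s" using rs g_pos g_mono by auto
  have "s * real N \<le> lam / (1 + h) * real N" using cyc(6) by (intro mult_right_mono) auto
  also have "\<dots> \<le> 1" using assms h_ge_0 by (simp add: N_def divide_simps)
  finally have Ns: "real N * s < 1 + s" using rs by (simp add: mult.commute)
  have d1: "g r ^ d = g r * g r ^ (d - 1)" "g s ^ d = g s * g s ^ (d - 1)"
    using d_ge_2 by (metis Suc_diff_1 gr0I not_numeral_le_zero power_Suc)+
  have "(lam * (1 + s) ^ N) * (1 + r) ^ N = (lam * (1 + r) ^ N) * (1 + s) ^ N" by simp
  then have "s * g s ^ d * g r * (1 + r) ^ N = r * g r ^ d * g s * (1 + s) ^ N"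
    using cyc(3,4) by simp
  then have "(s * (1 + r) ^ N * g s ^ (d - 1)) * (g r * g s) = (r * (1 + s) ^ N * g r ^ (d - 1)) * (g r * g s)"
    unfolding d1 by (simp add: algebra_simps)
  then have eq: "s * (1 + r) ^ N * g s ^ (d - 1) = r * (1 + s) ^ N * g r ^ (d - 1)"
    using gp by simp
  have "s * (1 + r) ^ N * g r ^ (d - 1) \<le> s * (1 + r) ^ N * g s ^ (d - 1)"
    using gp rs by (intro mult_left_mono power_mono) auto
  then have le: "s * (1 + r) ^ N \<le> r * (1 + s) ^ N"
    unfolding eq using gp by simp
  \<comment> \<open>Bernoulli's inequality for \<open>(1 + r) / (1 + s) = 1 - (s - r) / (1 + s)\<close>\<close>
  have "1 + real N * (- (s - r) / (1 + s)) \<le> (1 + - (s - r) / (1 + s)) ^ N"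
    using rs by (intro Bernoulli_inequality) (simp add: field_simps)
  also have "1 + - (s - r) / (1 + s) = (1 + r) / (1 + s)" using rs by (simp add: field_simps)
  finally have "1 + real N * (- (s - r) / (1 + s)) \<le> (1 + r) ^ N / (1 + s) ^ N"
    by (simp only: power_divide)
  also have "\<dots> \<le> r / s" using le rs by (simp add: field_simps)
  finally have "s - r \<le> s * (real N * (s - r) / (1 + s))" using rs by (simp add: field_simps)
  then have "(s - r) * (1 + s) \<le> (s - r) * (real N * s)" using rs by (simp add: field_simps)
  then show False using rs Ns by simp
qed

end

subsection \<open>The critical fugacity\<close>

lemma strict_Bernoulli:
  fixes x :: real
  assumes "x > -1" "x \<noteq> 0" "n \<ge> 2"
  shows "1 + real n * x < (1 + x) ^ n"
proof -
  obtain m where m: "n = Suc m" "m \<ge> 1" using assms(3) by (cases n) auto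
  have "real m * x\<^sup>2 > 0" using assms m by simp
  then have "1 + real n * x < (1 + x) * (1 + real m * x)"
    using m by (simp add: algebra_simps power2_eq_square)
  also have "\<dots> \<le> (1 + x) * (1 + x) ^ m"
    using assms by (intro mult_left_mono Bernoulli_inequality) auto
  finally show ?thesis using m by simp
qed

locale critical_message_map = message_map +
  assumes lam_critical: "lam = real d ^ d / (real d - 1) ^ (d + 1)"
begin

text \<open>The right-hand side is a strictly convex function of \<open>r\<close>, and for the critical fugacity the line
  \<open>d\<^sup>2 r\<close> is its tangent at \<open>1 / (d - 1)\<close>.\<close>

lemma critical_tangent:
  fixes r :: real
  assumes "r > 0" "r \<noteq> 1 / (real d - 1)"
  shows "real d ^ 2 * r < (1 + r) + (1 + r) ^ (d + 1) / lam"
proof -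
  define D where "D = real d - 1"
  have D: "D > 0" "real d = D + 1" using d_ge_2 by (auto simp: D_def)
  define x where "x = (1 + r) * D / real d - 1"
  have x1: "1 + x = (1 + r) * D / real d" by (simp add: x_def)
  have "x \<noteq> 0"
  proof
    assume "x = 0"
    then have "(1 + r) * D = D + 1" using x1 D by simp
    then have "r * D = 1" by (simp add: algebra_simps)
    then have "r = 1 / D" using D by (simp add: field_simps)
    then show False using assms by (simp add: D_def)
  qed
  moreover have "1 + x > 0" unfolding x1 using assms D by simp
  then have "x > -1" by simp
  ultimately have "1 + real (d + 1) * x < (1 + x) ^ (d + 1)"
    using d_ge_2 by (intro strict_Bernoulli) auto
  also have "\<dots> = (1 + r) ^ (d + 1) / lam / real d"
    unfolding x1 lam_critical D_def[symmetric]
    using D by (simp add: power_mult_distrib power_divide ac_simps)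
  finally have "1 + real (d + 1) * x < (1 + r) ^ (d + 1) / lam / real d" .
  moreover have "real d > 0" using D by simp
  ultimately have "real d * (1 + real (d + 1) * x) < (1 + r) ^ (d + 1) / lam"
    by (simp only: pos_less_divide_eq mult.commute)
  moreover have "real d * (1 + real (d + 1) * x) = real d ^ 2 * r - (1 + r)"
  proof -
    have "real d * x = (1 + r) * D - real d" using D by (simp add: x_def field_simps)
    moreover have "real d * (1 + real (d + 1) * x) = real d + (real d + 1) * (real d * x)"
      by (simp add: algebra_simps)
    ultimately have "real d * (1 + real (d + 1) * x) = real d + (real d + 1) * ((1 + r) * D - real d)"
      by simp
    then show ?thesis unfolding D(2) by (simp add: algebra_simps power2_eq_square)
  qed
  ultimately show ?thesis by simp
qed

text \<open>Let \<open>f x = \<lambda> / (1 + x)\<^sup>d\<close> be the hard-core recursion. A point of a two-cycle of \<open>f\<close> is a solution of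
  \<open>x (1 + f x)\<^sup>d = \<lambda>\<close>. The logarithm \<open>\<psi>\<close> of the left-hand side has derivative
  \<open>1 / x - d\<^sup>2 f x / ((1 + x) (1 + f x))\<close>, which is positive away from \<open>1 / (d - 1)\<close> by the tangent
  inequality; so \<open>\<psi>\<close> is injective, and \<open>1 / (d - 1)\<close> is a solution.\<close>

lemma hard_core_two_cycle:
  fixes r s :: real
  assumes "r > 0" "s > 0" "s * (1 + r) ^ d = lam" "r * (1 + s) ^ d = lam"
  shows "r = 1 / (real d - 1)"
proof -
  define f where "f = (\<lambda>x::real. lam / (1 + x) ^ d)"
  define \<psi> where "\<psi> = (\<lambda>x. ln x + real d * ln (1 + f x))"
  define c where "c = 1 / (real d - 1)"
  have c: "c > 0" using d_ge_2 by (simp add: c_def)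
  have fpos: "f x > 0" if "x > 0" for x
    using that lam_gt_0 by (simp add: f_def)
  have deriv: "(\<psi> has_real_derivative 1 / x - real d ^ 2 * f x / ((1 + x) * (1 + f x))) (at x)"
    if "x > 0" for x
  proof -
    have "d = Suc (d - 1)" using d_ge_2 by simp
    then have p: "(1 + x) ^ d = (1 + x) * (1 + x) ^ (d - 1)" by (metis power_Suc)
    have f': "(f has_real_derivative - (real d * f x / (1 + x))) (at x)"
      unfolding f_def using that
      by (auto intro!: derivative_eq_intros simp: p divide_simps) 
    show ?thesis
      unfolding \<psi>_def using that fpos[OF that]
      by (auto intro!: derivative_eq_intros f' simp: divide_simps power2_eq_square)
  qed
  have pos: "1 / x - real d ^ 2 * f x / ((1 + x) * (1 + f x)) > 0" if "x > 0" "x \<noteq> c" for x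
  proof -
    have "real d ^ 2 * x < (1 + x) * (1 + 1 / f x)"
      using critical_tangent[of x] that by (simp add: c_def f_def algebra_simps)
    then have "real d ^ 2 * x * f x < (1 + x) * (1 + 1 / f x) * f x"
      using fpos[OF that(1)] by (rule mult_strict_right_mono)
    also have "\<dots> = (1 + x) * (1 + f x)"
      using fpos[OF that(1)] by (simp add: field_simps)
    finally have less: "real d ^ 2 * x * f x < (1 + x) * (1 + f x)" .
    have "1 / x - real d ^ 2 * f x / ((1 + x) * (1 + f x)) =
      ((1 + x) * (1 + f x) - real d ^ 2 * x * f x) / (x * ((1 + x) * (1 + f x)))"
      using that fpos[OF that(1)] by (simp add: divide_simps)
    then show ?thesis using less that fpos[OF that(1)] by simp
  qed
  have cont: "continuous_on {a..b} \<psi>" if "a > 0" for a b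
    using that deriv by (intro DERIV_continuous_on[of _ _ "\<lambda>x. 1 / x - real d ^ 2 * f x / ((1 + x) * (1 + f x))"])
      (auto intro: has_field_derivative_at_within)
  have mono: "\<psi> a < \<psi> b" if "0 < a" "a < b" "c \<le> a \<or> b \<le> c" for a b
  proof (rule DERIV_pos_imp_increasing_open[OF that(2) _ cont[OF that(1)]])
    fix x assume "a < x" "x < b"
    then have "x > 0" "x \<noteq> c" using that by auto
    then show "\<exists>y. (\<psi> has_real_derivative y) (at x) \<and> y > 0"
      using deriv pos by blast
  qed
  have fixed: "\<psi> x = ln lam" if "x > 0" "x * (1 + f x) ^ d = lam" for x
    unfolding that(2)[symmetric] using that(1) fpos[OF that(1)]
    by (simp add: \<psi>_def ln_mult ln_realpow)
  have "f r = s" using assms by (simp add: f_def field_simps)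
  then have "\<psi> r = ln lam" using fixed[of r] assms by simp
  moreover have "\<psi> c = ln lam"
  proof (rule fixed[OF c])
    have s: "1 + c = real d / (real d - 1)" using d_ge_2 by (simp add: c_def field_simps)
    have "f c = c" using d_ge_2 unfolding f_def s lam_critical
      by (simp add: power_divide c_def)
    then have "c * (1 + f c) ^ d = c * (real d / (real d - 1)) ^ d" by (simp only: s)
    then show "c * (1 + f c) ^ d = lam"
      by (simp add: lam_critical power_divide c_def)
  qed
  ultimately show ?thesis
    using mono[of r c] mono[of c r] assms(1) c by (force simp: c_def)
qed

lemma trivial_cycle_zero:
  assumes "h = 0"
  shows "lower = upper"
proof -
  define r s where "r = snd lower" and "s = snd upper"
  note cyc = cycle_equations[folded r_def s_def]
  have g0: "g x = (1 + x) ^ d" for x unfolding g_def by (simp add: assms)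
  have rs: "r > 0" "s > 0" using cyc by auto
  have "s * (1 + r) ^ d = lam" "r * (1 + s) ^ d = lam"
    using cyc(3,4) rs by (simp_all add: g0 power_mult[symmetric])
  then have "r = s" using hard_core_two_cycle[of r s] hard_core_two_cycle[of s r] rs by simp
  then show ?thesis using cyc(5) by simp
qed

text \<open>The claim says that the logarithmic derivative of \<open>x (g x)\<^bsup>d - 1\<^esup> / (1 + x)\<^sup>N\<close> is negative at the fixed
  point. With \<open>\<epsilon> = h / g r\<close> the fixed-point equation reads \<open>r (1 + r)\<^sup>d = \<lambda> (1 - \<epsilon>)\<^bsup>d + 1\<^esup>\<close>. If the claim
  failed, then \<open>r \<le> 1 / ((d - 1) (1 + d \<epsilon>))\<close>, and inserting this bound and the critical \<open>\<lambda>\<close> gives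
  \<open>((1 - \<epsilon>) (1 + d \<epsilon>))\<^bsup>d + 1\<^esup> \<le> (1 + (d - 1) \<epsilon>)\<^sup>d\<close>. To first order in \<open>\<epsilon>\<close> the two sides are
  \<open>1 + (d + 1) (d - 1) \<epsilon>\<close> and \<open>1 + d (d - 1) \<epsilon>\<close>, so this is false for small \<open>\<epsilon>\<close>; Bernoulli's
  inequality controls the remainder.\<close>

lemma fixed_point_unstable:
  assumes r: "r > 0" and h: "0 < h" "h < (real d - 1) / (real d * (real d + 1))"
    and fp: "r * g r ^ d * g r = lam * (1 + r) ^ (d * d)"
  defines "\<epsilon> \<equiv> h / g r"
  shows "1 + r < real d * r * (1 + (real d - 1) * \<epsilon>)"
proof (rule ccontr)
  assume neg: "\<not> ?thesis"
  define D where "D = real d - 1"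
  have D: "D > 0" "real d = D + 1" using d_ge_2 by (auto simp: D_def)
  define u X y where "u = 1 + real d * \<epsilon>" and "X = 1 + D * \<epsilon>" and "y = real d * \<epsilon>\<^sup>2 / X"
  have g: "g r > 0" "g r \<ge> 1" "1 + r > 0"
    using g_pos[of r] g_ge_1[of r] r by auto
  have eps: "0 < \<epsilon>" "\<epsilon> \<le> h" "\<epsilon> < 1"
    using g h r by (auto simp: \<epsilon>_def divide_simps mult_le_cancel_left1) (simp add: g_def)
  have uX: "u > 0" "X > 0" using eps D by (auto simp: u_def X_def add_pos_pos)
  have "r * (D * u) = real d * r * (1 + D * \<epsilon>) - r"
    unfolding u_def D(2) by (simp add: algebra_simps)
  then have "r * (D * u) \<le> 1" using neg by (simp add: D_def)
  moreover have "D * u > 0" using D uX by simp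
  ultimately have small: "r \<le> 1 / (D * u)" by (simp only: pos_le_divide_eq)
  have ge: "g r * (1 - \<epsilon>) = (1 + r) ^ d" using g by (simp add: \<epsilon>_def field_simps g_def)
  have eq: "r * (1 + r) ^ d = lam * (1 - \<epsilon>) ^ (d + 1)"
  proof -
    have "lam * (1 + r) ^ (d * d) * (1 - \<epsilon>) ^ (d + 1) = r * (g r * (1 - \<epsilon>)) ^ (d + 1)"
      unfolding fp[symmetric] by (simp add: power_mult_distrib)
    also have "\<dots> = r * ((1 + r) ^ d * (1 + r) ^ (d * d))"
      unfolding ge by (simp add: power_mult)
    finally show ?thesis using g by simp
  qed
  have "r * (1 + r) ^ d \<le> 1 / (D * u) * (1 + 1 / (D * u)) ^ d"
    using small r D uX by (intro mult_mono power_mono) auto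
  also have "1 + 1 / (D * u) = real d * X / (D * u)"
    using D uX by (simp add: field_simps) (simp add: u_def X_def algebra_simps D(2))
  finally have "lam * (1 - \<epsilon>) ^ (d + 1) \<le> real d ^ d * X ^ d / (D * u) ^ (d + 1)"
    unfolding eq by (simp add: power_divide power_mult_distrib)
  then have "real d ^ d * (1 - \<epsilon>) ^ (d + 1) / D ^ (d + 1) \<le> real d ^ d * X ^ d / (D ^ (d + 1) * u ^ (d + 1))"
    by (simp only: lam_critical D_def[symmetric] power_mult_distrib times_divide_eq_left)
  then have "((1 - \<epsilon>) * u) ^ (d + 1) \<le> X ^ d"
    using D uX by (simp add: power_mult_distrib divide_simps ac_simps split: if_splits)
  moreover have "(1 - \<epsilon>) * u = X * (1 + - y)"
    using uX by (simp add: y_def field_simps) (simp add: u_def X_def algebra_simps D(2) power2_eq_square)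
  ultimately have "X ^ (d + 1) * (1 + - y) ^ (d + 1) \<le> X ^ d"
    by (simp only: power_mult_distrib)
  moreover have "X * (1 + - y) > 0"
    unfolding \<open>(1 - \<epsilon>) * u = X * (1 + - y)\<close>[symmetric] using eps uX by simp
  then have "y \<le> 1" using uX by (simp add: zero_less_mult_iff)
  then have "1 + real (d + 1) * (- y) \<le> (1 + - y) ^ (d + 1)"
    by (intro Bernoulli_inequality) simp
  then have "X ^ (d + 1) * (1 + real (d + 1) * (- y)) \<le> X ^ (d + 1) * (1 + - y) ^ (d + 1)"
    using uX by (intro mult_left_mono) auto
  ultimately have "X ^ d * (X * (1 - real (d + 1) * y)) \<le> X ^ d * 1" by (simp add: algebra_simps)
  then have "X * (1 - real (d + 1) * y) \<le> 1" using uX by simp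
  moreover have "X * (1 - real (d + 1) * y) = X - real (d + 1) * (real d * \<epsilon>\<^sup>2)"
    using uX by (simp add: y_def field_simps)
  ultimately have "\<epsilon> * D \<le> \<epsilon> * (real (d + 1) * (real d * \<epsilon>))"
    by (simp add: X_def power2_eq_square algebra_simps)
  then have "D \<le> real (d + 1) * (real d * \<epsilon>)" using eps by simp
  also have "\<dots> \<le> real (d + 1) * (real d * h)" using eps by (intro mult_left_mono) auto
  also have "\<dots> = h * (real d * (real d + 1))" by (simp add: algebra_simps)
  also have "\<dots> < D"
  proof -
    have "real d * (real d + 1) > 0" using d_ge_2 by simp
    then show ?thesis using h(2) unfolding D_def by (simp only: pos_less_divide_eq)
  qed
  finally show False by simp
qed

text \<open>Around the fixed point \<open>r\<close> take the pair \<open>r - t\<close>, \<open>r + t\<close>. The two inequalities required by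
  \<open>subcycle_between\<close> compare \<open>\<lambda>\<close> with one function \<open>exp \<circ> \<Psi>\<close> at \<open>t\<close> and at \<open>- t\<close>. As \<open>exp (\<Psi> 0) = \<lambda>\<close>, the
  single fact that \<open>\<Psi>\<close> has negative derivative at \<open>0\<close> gives both.\<close>

lemma nontrivial_cycle_small:
  assumes h: "0 < h" "h < (real d - 1) / (real d * (real d + 1))"
  shows "snd lower < snd upper"
proof -
  define F where "F = (\<lambda>x. x * g x ^ d * g x - lam * (1 + x) ^ (d * d))"
  have "\<exists>x\<ge>0. x \<le> lam \<and> F x = 0"
  proof (rule IVT')
    show "F 0 \<le> 0" using lam_gt_0 by (simp add: F_def)
    have "(1 + lam) ^ (d * d) \<le> g lam ^ d * 1"
      unfolding power_mult using h_ge_0 lam_gt_0 by (auto simp: g_def intro!: power_mono)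
    also have "\<dots> \<le> g lam ^ d * g lam"
      using lam_gt_0 g_ge_1[of lam] by (intro mult_left_mono) simp_all
    finally show "0 \<le> F lam" using lam_gt_0 by (simp add: F_def)
    show "continuous_on {0..lam} F" unfolding F_def g_def by (intro continuous_intros)
  qed (use lam_gt_0 in simp)
  then obtain r where "r \<ge> 0" "F r = 0" by blast
  moreover then have "r \<noteq> 0" using lam_gt_0 by (auto simp: F_def)
  ultimately have r: "r > 0" and fp: "r * g r ^ d * g r = lam * (1 + r) ^ (d * d)"
    by (auto simp: F_def)
  define \<Psi> where "\<Psi> = (\<lambda>t. ln (r + t) + real d * ln (g (r + t)) - real (d * d) * ln (1 + (r + t)) + ln (g (r - t)))"
  have gr: "g r > 0" using g_pos r by simp
  define \<epsilon> where "\<epsilon> = h / g r"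
  have d1: "(1 + r) ^ d = (1 + r) * (1 + r) ^ (d - 1)"
    using d_ge_2 by (metis Suc_diff_1 gr0I not_numeral_le_zero power_Suc)
  have G: "real d * (1 + r) ^ (d - 1) / g r = real d * (1 - \<epsilon>) / (1 + r)"
  proof -
    have "g r * (1 - \<epsilon>) = (1 + r) * (1 + r) ^ (d - 1)"
      using gr unfolding d1[symmetric] by (simp add: \<epsilon>_def field_simps g_def)
    then have "(1 + r) ^ (d - 1) = g r * (1 - \<epsilon>) / (1 + r)" using r by simp
    then show ?thesis using gr by simp
  qed
  let ?G = "real d * (1 + r) ^ (d - 1) / g r"
  have "(\<Psi> has_real_derivative 1 / r + real d * ?G - real (d * d) / (1 + r) - ?G) (at 0)"
    unfolding \<Psi>_def g_def using r gr
    by (auto intro!: derivative_eq_intros simp: g_def)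
  moreover have "1 / r + real d * ?G - real (d * d) / (1 + r) - ?G < 0"
  proof -
    let ?K = "real d * (1 + (real d - 1) * \<epsilon>)"
    have "1 / r + real d * ?G - real (d * d) / (1 + r) - ?G =
      1 / r + (real d * (real d * (1 - \<epsilon>)) - real d * real d - real d * (1 - \<epsilon>)) / (1 + r)"
      unfolding G by (simp add: diff_divide_distrib)
    also have "real d * (real d * (1 - \<epsilon>)) - real d * real d - real d * (1 - \<epsilon>) = - ?K"
      by (simp add: algebra_simps)
    also have "1 / r + - ?K / (1 + r) = ((1 + r) - r * ?K) / (r * (1 + r))"
      using r by (simp add: diff_frac_eq mult.commute[of r ?K])
    finally show ?thesis
      using fixed_point_unstable[OF r h fp] r by (simp add: \<epsilon>_def divide_neg_pos ac_simps)
  qed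
  ultimately obtain e1 e2 where e1: "e1 > 0" "\<And>t. t > 0 \<Longrightarrow> t < e1 \<Longrightarrow> \<Psi> 0 > \<Psi> (0 + t)"
    and e2: "e2 > 0" "\<And>t. t > 0 \<Longrightarrow> t < e2 \<Longrightarrow> \<Psi> 0 < \<Psi> (0 - t)"
    using DERIV_neg_dec_right[of \<Psi> _ 0] DERIV_neg_dec_left[of \<Psi> _ 0] by metis
  define t where "t = min (r / 2) (min (e1 / 2) (e2 / 2))"
  have t: "0 < t" "t < r" "t < e1" "t < e2" using r e1 e2 by (auto simp: t_def)
  define a b where "a = r - t" and "b = r + t"
  have ab: "0 < a" "a < b" using t by (auto simp: a_def b_def)
  have g_ab: "g a > 0" "g b > 0" using g_pos ab by auto
  have exp_\<Psi>: "exp (ln x + real d * ln (g x) - real (d * d) * ln (1 + x) + ln (g y)) =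
      x * g x ^ d * g y / (1 + x) ^ (d * d)" if "x > 0" "y > 0" for x y
    using that g_pos[of x] g_pos[of y]
    by (simp add: exp_add exp_diff exp_of_nat_mult flip: of_nat_mult)
  have \<Psi>0: "exp (\<Psi> 0) = lam" using exp_\<Psi>[OF r r] r fp by (simp add: \<Psi>_def)
  have "exp (\<Psi> t) < lam" "exp (\<Psi> (- t)) > lam"
    unfolding \<Psi>0[symmetric] using e1(2)[of t] e2(2)[of t] t by auto
  moreover have "exp (\<Psi> t) = b * g b ^ d * g a / (1 + b) ^ (d * d)"
    "exp (\<Psi> (- t)) = a * g a ^ d * g b / (1 + a) ^ (d * d)"
    using exp_\<Psi>[of b a] exp_\<Psi>[of a b] ab by (auto simp: \<Psi>_def a_def b_def)
  ultimately have "b * g b ^ d * g a / (1 + b) ^ (d * d) < lam"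
    "lam < a * g a ^ d * g b / (1 + a) ^ (d * d)" by auto
  then have b_le: "b \<le> lam * (1 + b) ^ (d * d) / (g b ^ d * g a)"
    and a_ge: "lam * (1 + a) ^ (d * d) / (g a ^ d * g b) \<le> a"
    using ab g_ab by (simp_all add: field_simps)
  let ?z = "(1 + h / (1 + b) ^ d, a)" and ?w = "(1 + h / (1 + a) ^ d, b)"
  have "valid ?z" using ab h by (simp add: valid_def)
  moreover have "below ?z ?w"
    using ab h by (auto simp: below_def intro!: divide_left_mono power_mono)
  moreover have "below ?w (step ?z)"
    using b_le ab step_Pair_snd[of a b] step_fst[of ?z] by (simp add: below_def)
  moreover have "below (step ?w) ?z"
    using a_ge ab step_Pair_snd[of b a] step_fst[of ?w] by (simp add: below_def)
  ultimately have "below lower ?z" "below ?w upper" by (rule subcycle_between)+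
  then show ?thesis using ab by (simp add: below_def)
qed

end


section \<open>The recursion over levels\<close>

definition theta :: "real \<Rightarrow> nat \<Rightarrow> real" where
  "theta h k = all_ones k + e_zero k * h"

definition inside :: "nat \<Rightarrow> nat \<Rightarrow> node set" where
  "inside \<Delta> n = {x \<in> tree \<Delta>. length x < n}"

lemma inside_Suc: "inside \<Delta> (Suc n) = inside \<Delta> n \<union> level \<Delta> n"
  by (auto simp: inside_def level_def)

lemma inside_Suc_ball: "inside \<Delta> (Suc n) = tree_ball \<Delta> n"
  by (auto simp: inside_def tree_ball_def)

lemma inside_level_disjoint: "inside \<Delta> n \<inter> level \<Delta> n = {}"
  by (auto simp: inside_def level_def)

lemma finite_inside [simp]: "finite (inside \<Delta> n)"
  by (rule finite_subset[OF _ finite_tree_ball[of \<Delta> n]]) (auto simp: inside_def tree_ball_def)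

lemma nbhd_inside: "x \<in> inside \<Delta> n \<Longrightarrow> nbhd \<Delta> x \<subseteq> tree_ball \<Delta> n"
  using nbhd_subset_ball[of x \<Delta> "n - 1"] by (cases n) (auto simp: inside_def tree_ball_def)

lemma exp_neg_add: "x \<noteq> -\<infinity> \<Longrightarrow> y \<noteq> -\<infinity> \<Longrightarrow> exp_neg (x + y) = exp_neg x * exp_neg y"
  by (cases x; cases y) (auto simp: exp_neg_def simp flip: exp_add)

lemma exp_neg_sum:
  assumes "finite A" "\<And>i. i \<in> A \<Longrightarrow> f i \<noteq> -\<infinity>"
  shows "exp_neg (sum f A) = (\<Prod>i\<in>A. exp_neg (f i)) \<and> sum f A \<noteq> -\<infinity>"
  using assms
proof (induction A rule: finite_induct)
  case empty
  then show ?case by (simp add: exp_neg_def)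
next
  case (insert i A)
  then show ?case by (simp add: exp_neg_add)
qed

locale covering_model =
  fixes \<Delta> :: nat and lam h :: real
  assumes \<Delta>_ge_3: "\<Delta> \<ge> 3" and lam_pos: "lam > 0" and h_nonneg: "h \<ge> 0"
begin

text \<open>The factor \<open>exp (- \<Phi>)\<close> of one node, as a function of its spin, the spin of its parent and the sum of the
  spins of its children.\<close>

definition loc_weight :: "nat \<Rightarrow> nat \<Rightarrow> nat \<Rightarrow> real" where
  "loc_weight a b s =
    (if a = 1 then (if b = 0 \<and> s = 0 then lam else 0) else if b = 0 \<and> s = 0 then 1 + h else 1)"

definition site_weight :: "(node \<Rightarrow> nat) \<Rightarrow> node \<Rightarrow> real" where
  "site_weight \<omega> x = loc_weight (\<omega> x) (pspin \<omega> x) (sum \<omega> (children \<Delta> x))"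

lemma loc_weight_nonneg: "loc_weight a b s \<ge> 0"
  using lam_pos h_nonneg by (auto simp: loc_weight_def)

lemma site_weight_nonneg: "site_weight \<omega> x \<ge> 0"
  by (simp add: site_weight_def loc_weight_nonneg)

lemma site_weight_cong:
  assumes "x \<in> tree \<Delta>" "\<And>y. y \<in> nbhd \<Delta> x \<Longrightarrow> \<omega> y = \<omega>' y"
  shows "site_weight \<omega> x = site_weight \<omega>' x"
proof -
  have "sum \<omega> (children \<Delta> x) = sum \<omega>' (children \<Delta> x)"
    using assms by (intro sum.cong) (auto simp: nbhd_eq)
  then show ?thesis
    using assms by (auto simp: site_weight_def pspin_def nbhd_eq)
qed

lemma exp_neg_potential:
  assumes x: "x \<in> tree \<Delta>" and \<omega>: "\<omega> x = 0 \<or> \<omega> x = 1"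
  shows "exp_neg (potential \<Delta> lam (theta h) x (restrict \<omega> (nbhd \<Delta> x))) = site_weight \<omega> x"
    and "potential \<Delta> lam (theta h) x (restrict \<omega> (nbhd \<Delta> x)) \<noteq> -\<infinity>"
proof -
  have "sum (restrict \<omega> (nbhd \<Delta> x)) (nbhd \<Delta> x) = sum \<omega> (nbhd \<Delta> x)"
    by (intro sum.cong) auto
  moreover have "restrict \<omega> (nbhd \<Delta> x) x = \<omega> x" by (simp add: nbhd_def)
  ultimately show "exp_neg (potential \<Delta> lam (theta h) x (restrict \<omega> (nbhd \<Delta> x))) = site_weight \<omega> x"
    using \<omega> lam_pos h_nonneg sum_nbhd[OF x, of \<omega>]
    by (auto simp: potential_def exp_neg_def site_weight_def loc_weight_def theta_def
      all_ones_def e_zero_def)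
  show "potential \<Delta> lam (theta h) x (restrict \<omega> (nbhd \<Delta> x)) \<noteq> -\<infinity>"
    by (auto simp: potential_def)
qed

lemma exp_neg_hamiltonian:
  assumes L: "finite L" "L \<subseteq> tree \<Delta>" and \<omega>: "\<omega> \<in> configs (L \<union> bdry \<Delta> L)"
  shows "exp_neg (hamiltonian \<Delta> lam (theta h) L \<omega>) =
    (\<Prod>i | i \<in> tree \<Delta> \<and> nbhd \<Delta> i \<inter> L \<noteq> {}. site_weight \<omega> i)"
proof -
  obtain n where "L \<subseteq> tree_ball \<Delta> n" using finite_subset_ball[OF L] .
  then have fin: "finite {i \<in> tree \<Delta>. nbhd \<Delta> i \<inter> L \<noteq> {}}"
    by (rule finite_subset[OF nbhd_meets_subset_ball]) simp
  have spin: "\<omega> i = 0 \<or> \<omega> i = 1" if "i \<in> tree \<Delta>" "nbhd \<Delta> i \<inter> L \<noteq> {}" for i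
    using nbhd_subset_bdry[OF that] configs_values[OF \<omega>, of i] by (auto simp: nbhd_def)
  show ?thesis
    unfolding hamiltonian_def using exp_neg_sum[OF fin] exp_neg_potential spin
    by (auto intro!: prod.cong)
qed

text \<open>The weight of a configuration on a ball of radius \<open>n\<close>: nodes at depth below \<open>n\<close> see all their
  neighbours and contribute their own factor, while \<open>M x\<close> stands for the whole subtree rooted at the node
  \<open>x\<close> of depth \<open>n\<close>, whose factor involves the missing children.\<close>

definition ball_weight :: "nat \<Rightarrow> (node \<Rightarrow> nat \<Rightarrow> nat \<Rightarrow> real) \<Rightarrow> (node \<Rightarrow> nat) \<Rightarrow> real" where
  "ball_weight n M \<sigma> =
    (\<Prod>x\<in>inside \<Delta> n. site_weight \<sigma> x) * (\<Prod>x\<in>level \<Delta> n. M x (\<sigma> x) (pspin \<sigma> x))"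

text \<open>One step of belief propagation: the message of \<open>x\<close> is obtained by summing out its children.\<close>

definition absorb :: "(node \<Rightarrow> nat \<Rightarrow> nat \<Rightarrow> real) \<Rightarrow> node \<Rightarrow> nat \<Rightarrow> nat \<Rightarrow> real" where
  "absorb M x a b = (\<Sum>\<tau>\<in>configs (children \<Delta> x).
    loc_weight a b (sum \<tau> (children \<Delta> x)) * (\<Prod>y\<in>children \<Delta> x. M y (\<tau> y) a))"

text \<open>Each factor that involves the outermost level belongs to exactly one node of the level before: its own
  factor and the messages of its children.\<close>

lemma ball_weight_Suc:
  assumes in_ball: "\<And>x. x \<in> tree_ball \<Delta> n \<Longrightarrow> \<omega> x = \<sigma> x"
    and in_level: "\<And>x. x \<in> level \<Delta> (Suc n) \<Longrightarrow> \<omega> x = \<tau> x"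
  shows "ball_weight (Suc n) M \<omega> = ball_weight n (\<lambda>x a b.
    loc_weight a b (sum \<tau> (children \<Delta> x)) * (\<Prod>y\<in>children \<Delta> x. M y (\<tau> y) a)) \<sigma>"
proof -
  let ?L = "level \<Delta> (Suc n)"
  have "site_weight \<omega> x = site_weight \<sigma> x" if "x \<in> inside \<Delta> n" for x
    using that nbhd_inside[OF that] in_ball by (intro site_weight_cong) (auto simp: inside_def)
  then have 1: "(\<Prod>x\<in>inside \<Delta> n. site_weight \<omega> x) = (\<Prod>x\<in>inside \<Delta> n. site_weight \<sigma> x)" by simp
  have level: "\<omega> x = \<sigma> x" "pspin \<omega> x = pspin \<sigma> x"
    "\<And>y. y \<in> children \<Delta> x \<Longrightarrow> \<omega> y = \<tau> y" if "x \<in> level \<Delta> n" for x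
    using that in_ball in_level children_subset_level[OF that] tree_tl[of x \<Delta>]
    by (auto simp: pspin_def level_def tree_ball_def)
  have "(\<Prod>y\<in>?L. M y (\<omega> y) (pspin \<omega> y)) =
    (\<Prod>x\<in>level \<Delta> n. \<Prod>y\<in>children \<Delta> x. M y (\<omega> y) (pspin \<omega> y))"
    unfolding UN_children_level[symmetric]
    by (rule prod.UNION_disjoint) (auto dest: children_disjoint)
  also have "\<dots> = (\<Prod>x\<in>level \<Delta> n. \<Prod>y\<in>children \<Delta> x. M y (\<tau> y) (\<sigma> x))"
  proof (intro prod.cong refl)
    fix x y assume "x \<in> level \<Delta> n" "y \<in> children \<Delta> x"
    then show "M y (\<omega> y) (pspin \<omega> y) = M y (\<tau> y) (\<sigma> x)"
      using level[of x] by (auto simp: pspin_def children_def)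
  qed
  finally have 2: "(\<Prod>y\<in>?L. M y (\<omega> y) (pspin \<omega> y)) = \<dots>" .
  have 3: "(\<Prod>x\<in>level \<Delta> n. site_weight \<omega> x) =
    (\<Prod>x\<in>level \<Delta> n. loc_weight (\<sigma> x) (pspin \<sigma> x) (sum \<tau> (children \<Delta> x)))"
    unfolding site_weight_def
  proof (intro prod.cong refl)
    fix x assume x: "x \<in> level \<Delta> n"
    have "sum \<omega> (children \<Delta> x) = sum \<tau> (children \<Delta> x)"
      using level[OF x] by (intro sum.cong) auto
    then show "loc_weight (\<omega> x) (pspin \<omega> x) (sum \<omega> (children \<Delta> x)) =
      loc_weight (\<sigma> x) (pspin \<sigma> x) (sum \<tau> (children \<Delta> x))"
      using level[OF x] by simp
  qed
  show ?thesis
    unfolding ball_weight_def inside_Suc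
    by (subst prod.union_disjoint) (simp_all add: inside_level_disjoint 1 2 3 prod.distrib)
qed

lemma sum_outer_level:
  "(\<Sum>\<tau>\<in>configs (level \<Delta> (Suc n)).
      ball_weight (Suc n) M (merge (tree_ball \<Delta> n) (level \<Delta> (Suc n)) (\<sigma>, \<tau>))) =
    ball_weight n (absorb M) \<sigma>"
proof -
  let ?G = "\<lambda>x \<tau>. loc_weight (\<sigma> x) (pspin \<sigma> x) (sum \<tau> (children \<Delta> x)) *
    (\<Prod>y\<in>children \<Delta> x. M y (\<tau> y) (\<sigma> x))"
  let ?L = "level \<Delta> (Suc n)"
  have weight: "ball_weight (Suc n) M (merge (tree_ball \<Delta> n) ?L (\<sigma>, \<tau>)) =
      (\<Prod>x\<in>inside \<Delta> n. site_weight \<sigma> x) *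
      (\<Prod>x\<in>level \<Delta> n. ?G x (restrict \<tau> (children \<Delta> x)))" for \<tau>
  proof -
    have "ball_weight (Suc n) M (merge (tree_ball \<Delta> n) ?L (\<sigma>, \<tau>)) = ball_weight n (\<lambda>x a b.
      loc_weight a b (sum \<tau> (children \<Delta> x)) * (\<Prod>y\<in>children \<Delta> x. M y (\<tau> y) a)) \<sigma>"
      using ball_level_disjoint[of n "Suc n" \<Delta>] by (intro ball_weight_Suc) (auto simp: merge_def)
    then show ?thesis by (simp add: ball_weight_def)
  qed
  have "(\<Sum>\<tau>\<in>configs ?L. \<Prod>x\<in>level \<Delta> n. ?G x (restrict \<tau> (children \<Delta> x))) =
    (\<Prod>x\<in>level \<Delta> n. \<Sum>\<tau>\<in>configs (children \<Delta> x). ?G x \<tau>)"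
    unfolding UN_children_level[symmetric]
    by (rule sum_configs_blocks) (auto dest: children_disjoint)
  then show ?thesis
    unfolding weight sum_distrib_left[symmetric] by (simp add: ball_weight_def absorb_def)
qed

text \<open>Peeling off the levels between the two radii one at a time turns the marginal of a ball weight into a
  ball weight whose messages have been propagated inwards.\<close>

lemma ball_weight_marginal:
  assumes \<omega>: "\<omega> \<in> configs (tree_ball \<Delta> m)"
  shows "(\<Sum>\<nu> | \<nu> \<in> configs (tree_ball \<Delta> (m + k)) \<and> restrict \<nu> (tree_ball \<Delta> m) = \<omega>.
      ball_weight (m + k) M \<nu>) = ball_weight m ((absorb ^^ k) M) \<omega>"
proof (induction k arbitrary: M)
  case 0
  have "{\<nu> \<in> configs (tree_ball \<Delta> m). restrict \<nu> (tree_ball \<Delta> m) = \<omega>} = {\<omega>}"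
    using \<omega> configs_restrict_id by auto
  then show ?case by (simp del: restrict_apply add: restrict_def)
next
  case (Suc k)
  let ?B = "tree_ball \<Delta> (m + k)" and ?L = "level \<Delta> (Suc (m + k))"
  let ?Bm = "tree_ball \<Delta> m"
  have sub: "?Bm \<subseteq> ?B" by (rule ball_mono) simp
  have rr: "restrict (restrict \<nu> ?B) ?Bm = restrict \<nu> ?Bm" for \<nu> :: "node \<Rightarrow> nat"
    using sub by (simp add: Int_absorb1)
  have "(\<Sum>\<nu> | \<nu> \<in> configs (?B \<union> ?L) \<and> restrict \<nu> ?Bm = \<omega>. ball_weight (Suc (m + k)) M \<nu>) =
    (\<Sum>\<sigma>\<in>configs ?B. \<Sum>\<nu> | \<nu> \<in> configs (?B \<union> ?L) \<and> restrict \<nu> ?Bm = \<omega> \<and> restrict \<nu> ?B = \<sigma>.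
      ball_weight (Suc (m + k)) M \<nu>)"
    by (rule sum_configs_group) auto
  also have "\<dots> = (\<Sum>\<sigma>\<in>configs ?B. if restrict \<sigma> ?Bm = \<omega> then ball_weight (m + k) (absorb M) \<sigma> else 0)"
  proof (intro sum.cong refl)
    fix \<sigma> assume \<sigma>: "\<sigma> \<in> configs ?B"
    have "{\<nu>. \<nu> \<in> configs (?B \<union> ?L) \<and> restrict \<nu> ?Bm = \<omega> \<and> restrict \<nu> ?B = \<sigma>} =
      (if restrict \<sigma> ?Bm = \<omega> then {\<nu>. \<nu> \<in> configs (?B \<union> ?L) \<and> restrict \<nu> ?B = \<sigma>} else {})"
      using rr by auto
    then show "(\<Sum>\<nu> | \<nu> \<in> configs (?B \<union> ?L) \<and> restrict \<nu> ?Bm = \<omega> \<and> restrict \<nu> ?B = \<sigma>.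
        ball_weight (Suc (m + k)) M \<nu>) =
      (if restrict \<sigma> ?Bm = \<omega> then ball_weight (m + k) (absorb M) \<sigma> else 0)"
      using sum_configs_fibre[OF ball_level_disjoint[OF lessI] \<sigma>, of "ball_weight (Suc (m + k)) M"]
        sum_outer_level[of "m + k" M \<sigma>] by simp
  qed
  also have "\<dots> = (\<Sum>\<sigma> | \<sigma> \<in> configs ?B \<and> restrict \<sigma> ?Bm = \<omega>. ball_weight (m + k) (absorb M) \<sigma>)"
    by (simp add: sum.inter_filter finite_configs)
  finally show ?case
    using Suc.IH[of "absorb M"]
    by (simp only: ball_Suc add_Suc_right funpow.simps comp_apply funpow_swap1)
qed


subsection \<open>Normalised messages\<close>

text \<open>An occupied node forces all its children to be empty. An empty node has children of arbitrary spins,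
  independent of each other but for the extra weight \<open>h\<close> when they and the parent are all empty.\<close>

lemma absorb_explicit:
  shows "absorb M x 1 0 = lam * (\<Prod>y\<in>children \<Delta> x. M y 0 1)"
    and "absorb M x 1 1 = 0"
    and "absorb M x 0 1 = (\<Prod>y\<in>children \<Delta> x. M y 0 0 + M y 1 0)"
    and "absorb M x 0 0 =
      (\<Prod>y\<in>children \<Delta> x. M y 0 0 + M y 1 0) + h * (\<Prod>y\<in>children \<Delta> x. M y 0 0)"
proof -
  let ?C = "children \<Delta> x"
  have zero: "(\<Sum>\<tau>\<in>configs ?C. (if sum \<tau> ?C = 0 then c else 0) * (\<Prod>y\<in>?C. M y (\<tau> y) a)) =
    c * (\<Prod>y\<in>?C. M y 0 a)" for c a
  proof -
    have "(\<Sum>\<tau>\<in>configs ?C. (if sum \<tau> ?C = 0 then c else 0) * (\<Prod>y\<in>?C. M y (\<tau> y) a)) =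
      (\<Sum>\<tau>\<in>configs ?C. if \<tau> = (\<lambda>x\<in>?C. 0) then c * (\<Prod>y\<in>?C. M y 0 a) else 0)"
      by (intro sum.cong refl) (simp add: sum_configs_eq_0_iff del: sum_eq_0_iff)
    then show ?thesis by (simp add: finite_configs configs_zero)
  qed
  show "absorb M x 1 0 = lam * (\<Prod>y\<in>?C. M y 0 1)"
    using zero[of lam 1] by (simp add: absorb_def loc_weight_def)
  show "absorb M x 1 1 = 0" by (simp add: absorb_def loc_weight_def)
  show "absorb M x 0 1 = (\<Prod>y\<in>?C. M y 0 0 + M y 1 0)"
    using sum_configs_prod[of ?C "\<lambda>y t. M y t 0"] by (simp add: absorb_def loc_weight_def)
  have "absorb M x 0 0 = (\<Sum>\<tau>\<in>configs ?C. (\<Prod>y\<in>?C. M y (\<tau> y) 0) +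
      (if sum \<tau> ?C = 0 then h else 0) * (\<Prod>y\<in>?C. M y (\<tau> y) 0))"
    unfolding absorb_def by (intro sum.cong refl) (simp add: loc_weight_def algebra_simps)
  then show "absorb M x 0 0 = (\<Prod>y\<in>?C. M y 0 0 + M y 1 0) + h * (\<Prod>y\<in>?C. M y 0 0)"
    using sum_configs_prod[of ?C "\<lambda>y t. M y t 0"] zero[of h 0] by (simp add: sum.distrib)
qed

text \<open>The message with \<open>q = fst (v x)\<close>, \<open>r = snd (v x)\<close>, scaled such that its value at spins \<open>0\<close>, \<open>1\<close> is \<open>1\<close>.\<close>

definition msg :: "(node \<Rightarrow> real \<times> real) \<Rightarrow> node \<Rightarrow> nat \<Rightarrow> nat \<Rightarrow> real" where
  "msg v x a b = (if a = 0 then (if b = 0 then fst (v x) else 1)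
    else if b = 0 then snd (v x) * fst (v x) else 0)"

definition tree_step :: "(node \<Rightarrow> real \<times> real) \<Rightarrow> node \<Rightarrow> real \<times> real" where
  "tree_step v x =
    (let P = \<Prod>y\<in>children \<Delta> x. 1 + snd (v y) in
      (1 + h / P, lam / ((\<Prod>y\<in>children \<Delta> x. fst (v y)) * (P + h))))"

text \<open>Scaling a message multiplies every ball weight by the same constant, so for the purpose of
  probabilities messages only matter up to node-dependent positive factors.\<close>

definition prop_on :: "node set \<Rightarrow> (node \<Rightarrow> nat \<Rightarrow> nat \<Rightarrow> real) \<Rightarrow> (node \<Rightarrow> real \<times> real) \<Rightarrow> bool" where
  "prop_on A M v \<longleftrightarrow>
    (\<exists>c. \<forall>x\<in>A. c x > 0 \<and> (\<forall>a\<in>{0,1}. \<forall>b\<in>{0,1}. M x a b = c x * msg v x a b))"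

lemma msg_nonneg: "valid (v x) \<Longrightarrow> msg v x a b \<ge> 0"
  by (simp add: msg_def valid_def)

lemma valid_tree_step:
  assumes "\<And>y. y \<in> children \<Delta> x \<Longrightarrow> valid (v y)"
  shows "valid (tree_step v x)"
proof -
  have "(\<Prod>y\<in>children \<Delta> x. 1 + snd (v y)) \<ge> 0" "(\<Prod>y\<in>children \<Delta> x. fst (v y)) \<ge> 0"
    using assms by (auto intro!: prod_nonneg simp: valid_def) (smt (verit))
  then show ?thesis
    using h_nonneg lam_pos by (auto simp: valid_def tree_step_def Let_def)
qed

lemma prop_on_absorb:
  assumes M: "prop_on (level \<Delta> (Suc n)) M v"
    and v: "\<And>y. y \<in> level \<Delta> (Suc n) \<Longrightarrow> valid (v y)"
  shows "prop_on (level \<Delta> n) (absorb M) (tree_step v)"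
proof -
  obtain c where c: "\<And>y. y \<in> level \<Delta> (Suc n) \<Longrightarrow> c y > 0"
    "\<And>y a b. y \<in> level \<Delta> (Suc n) \<Longrightarrow> a \<in> {0,1} \<Longrightarrow> b \<in> {0,1} \<Longrightarrow> M y a b = c y * msg v y a b"
    using M unfolding prop_on_def by blast
  define P where "P x = (\<Prod>y\<in>children \<Delta> x. 1 + snd (v y))" for x
  define Q where "Q x = (\<Prod>y\<in>children \<Delta> x. fst (v y))" for x
  define C where "C x = (\<Prod>y\<in>children \<Delta> x. c y)" for x
  have "C x * (Q x * P x) > 0 \<and>
      (\<forall>a\<in>{0,1}. \<forall>b\<in>{0,1}. absorb M x a b = C x * (Q x * P x) * msg (tree_step v) x a b)"
    if x: "x \<in> level \<Delta> n" for x
  proof -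
    let ?C = "children \<Delta> x"
    have ch: "?C \<subseteq> level \<Delta> (Suc n)" using children_subset_level[OF x] .
    have pos: "C x > 0" "P x > 0" "Q x > 0"
      unfolding C_def P_def Q_def using c(1) v ch by (force simp: valid_def intro!: prod_pos)+
    have 01: "(\<Prod>y\<in>?C. M y 0 1) = C x"
      unfolding C_def using c(2) ch by (intro prod.cong) (auto simp: msg_def)
    have 00: "(\<Prod>y\<in>?C. M y 0 0) = C x * Q x"
      unfolding C_def Q_def prod.distrib[symmetric]
      using c(2) ch by (intro prod.cong) (auto simp: msg_def)
    have s0: "(\<Prod>y\<in>?C. M y 0 0 + M y 1 0) = C x * (Q x * P x)"
      unfolding C_def P_def Q_def prod.distrib[symmetric]
    proof (intro prod.cong refl)
      fix y assume "y \<in> ?C"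
      then have "y \<in> level \<Delta> (Suc n)" using ch by auto
      then show "M y 0 0 + M y 1 0 = c y * (fst (v y) * (1 + snd (v y)))"
        using c(2)[of y 0 0] c(2)[of y 1 0] by (simp add: msg_def algebra_simps)
    qed
    have step: "tree_step v x = (1 + h / P x, lam / (Q x * (P x + h)))"
      by (simp add: tree_step_def P_def Q_def Let_def)
    have "1 + h / P x = (P x + h) / P x" "P x + h > 0"
      using pos h_nonneg by (auto simp: field_simps)
    then have "lam / (Q x * (P x + h)) * (1 + h / P x) = lam / (Q x * P x)"
      using pos by simp
    then have m10: "msg (tree_step v) x 1 0 = lam / (Q x * P x)"
      by (simp add: msg_def step)
    have "absorb M x 0 0 = C x * (Q x * P x) * msg (tree_step v) x 0 0"
      using pos unfolding absorb_explicit s0 00 by (simp add: msg_def step field_simps)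
    moreover have "absorb M x 0 1 = C x * (Q x * P x) * msg (tree_step v) x 0 1"
      unfolding absorb_explicit s0 by (simp add: msg_def)
    moreover have "absorb M x 1 0 = C x * (Q x * P x) * msg (tree_step v) x 1 0"
      using pos unfolding m10 absorb_explicit 01 by simp
    moreover have "absorb M x 1 1 = C x * (Q x * P x) * msg (tree_step v) x 1 1"
      unfolding absorb_explicit by (simp add: msg_def)
    ultimately show ?thesis using pos by auto
  qed
  then show ?thesis unfolding prop_on_def by (intro exI[of _ "\<lambda>x. C x * (Q x * P x)"]) auto
qed

lemma prop_on_funpow_absorb:
  assumes "prop_on (level \<Delta> (n + k)) M v" "\<And>y. y \<in> level \<Delta> (n + k) \<Longrightarrow> valid (v y)"
  shows "prop_on (level \<Delta> n) ((absorb ^^ k) M) ((tree_step ^^ k) v) \<and>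
    (\<forall>y\<in>level \<Delta> n. valid ((tree_step ^^ k) v y))"
  using assms
proof (induction k arbitrary: n)
  case (Suc k)
  have IH: "prop_on (level \<Delta> (Suc n)) ((absorb ^^ k) M) ((tree_step ^^ k) v)"
    "\<forall>y\<in>level \<Delta> (Suc n). valid ((tree_step ^^ k) v y)"
    using Suc.IH[of "Suc n"] Suc.prems by auto
  then show ?case
    using prop_on_absorb[OF IH(1)] valid_tree_step children_subset_level by (auto simp: subset_iff)
qed simp

lemma pspin_values: "\<sigma> \<in> configs (tree_ball \<Delta> n) \<Longrightarrow> x \<in> tree_ball \<Delta> n \<Longrightarrow> pspin \<sigma> x \<in> {0, 1}"
  using configs_values[of \<sigma> "tree_ball \<Delta> n" "tl x"] tree_tl[of x \<Delta>]
  by (auto simp: pspin_def tree_ball_def)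

lemma ball_weight_prop:
  assumes "prop_on (level \<Delta> n) M v"
  obtains C where "C > 0"
    "\<And>\<sigma>. \<sigma> \<in> configs (tree_ball \<Delta> n) \<Longrightarrow> ball_weight n M \<sigma> = C * ball_weight n (msg v) \<sigma>"
proof -
  obtain c where c: "\<And>y. y \<in> level \<Delta> n \<Longrightarrow> c y > 0"
    "\<And>y a b. y \<in> level \<Delta> n \<Longrightarrow> a \<in> {0,1} \<Longrightarrow> b \<in> {0,1} \<Longrightarrow> M y a b = c y * msg v y a b"
    using assms unfolding prop_on_def by blast
  show thesis
  proof
    show "(\<Prod>x\<in>level \<Delta> n. c x) > 0" using c(1) by (simp add: prod_pos)
    fix \<sigma> assume \<sigma>: "\<sigma> \<in> configs (tree_ball \<Delta> n)"
    have "M x (\<sigma> x) (pspin \<sigma> x) = c x * msg v x (\<sigma> x) (pspin \<sigma> x)" if "x \<in> level \<Delta> n" for x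
      using c(2)[OF that, of "\<sigma> x" "pspin \<sigma> x"] configs_values[OF \<sigma>, of x] pspin_values[OF \<sigma>, of x]
        level_subset_ball[OF order_refl, of \<Delta> n] that by blast
    then show "ball_weight n M \<sigma> = (\<Prod>x\<in>level \<Delta> n. c x) * ball_weight n (msg v) \<sigma>"
      by (simp add: ball_weight_def prod.distrib)
  qed
qed

lemma ball_weight_nonneg:
  "(\<And>x. x \<in> level \<Delta> n \<Longrightarrow> valid (v x)) \<Longrightarrow> ball_weight n (msg v) \<sigma> \<ge> 0"
  by (auto simp: ball_weight_def intro!: mult_nonneg_nonneg prod_nonneg site_weight_nonneg msg_nonneg)

definition partition_fn :: "nat \<Rightarrow> (node \<Rightarrow> real \<times> real) \<Rightarrow> real" where
  "partition_fn n v = (\<Sum>\<sigma>\<in>configs (tree_ball \<Delta> n). ball_weight n (msg v) \<sigma>)"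

lemma partition_fn_pos:
  assumes "\<And>x. x \<in> level \<Delta> n \<Longrightarrow> valid (v x)"
  shows "partition_fn n v > 0"
  unfolding partition_fn_def
proof (rule sum_pos2)
  let ?z = "\<lambda>x\<in>tree_ball \<Delta> n. 0 :: nat"
  \<comment> \<open>the empty configuration has positive weight\<close>
  show "finite (configs (tree_ball \<Delta> n))" "?z \<in> configs (tree_ball \<Delta> n)"
    by (simp_all add: finite_configs configs_zero)
  have p: "pspin ?z x = 0" if "x \<in> tree_ball \<Delta> n" for x
    using that tree_tl[of x \<Delta>] by (auto simp: pspin_def tree_ball_def)
  have "site_weight ?z x = 1 + h" if "x \<in> inside \<Delta> n" for x
  proof -
    have *: "x \<in> tree_ball \<Delta> n" "children \<Delta> x \<subseteq> tree_ball \<Delta> n"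
      using that nbhd_inside[OF that] by (auto simp: inside_def tree_ball_def nbhd_eq)
    then have "sum ?z (children \<Delta> x) = 0" by (auto intro!: sum.neutral)
    then show ?thesis using * p[of x] by (simp add: site_weight_def loc_weight_def)
  qed
  moreover have "msg v x (?z x) (pspin ?z x) \<ge> 1" if "x \<in> level \<Delta> n" for x
    using assms[OF that] p[of x] that level_subset_ball[of n n \<Delta>]
    by (auto simp: msg_def valid_def)
  ultimately show "ball_weight n (msg v) ?z > 0"
    using h_nonneg unfolding ball_weight_def
    by (intro mult_pos_pos prod_pos ballI) (auto intro!: less_le_trans[OF zero_less_one] simp del: restrict_apply)
qed (use assms ball_weight_nonneg in auto)

end


section \<open>Measures with prescribed finite-dimensional distributions\<close>

text \<open>Kolmogorov's extension theorem for spins, where consistency is only required along one increasing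
  sequence of finite sets. The extension theorem is about Borel measures on products of Polish
  spaces, so the spins are embedded into the reals and rounded back to \<open>{0, 1}\<close> at the end.\<close>

lemma kolmogorov_configs:
  fixes I :: "node set" and B :: "nat \<Rightarrow> node set" and \<rho> :: "nat \<Rightarrow> (node \<Rightarrow> nat) \<Rightarrow> real"
  assumes fin: "\<And>n. finite (B n)" and mono: "\<And>n. B n \<subseteq> B (Suc n)" and I: "I = (\<Union>n. B n)"
    and nonneg: "\<And>n \<omega>. \<rho> n \<omega> \<ge> 0" and total: "\<And>n. (\<Sum>\<omega>\<in>configs (B n). \<rho> n \<omega>) = 1"
    and consistent: "\<And>n \<omega>. \<omega> \<in> configs (B n) \<Longrightarrow>
      (\<Sum>\<nu> | \<nu> \<in> configs (B (Suc n)) \<and> restrict \<nu> (B n) = \<omega>. \<rho> (Suc n) \<nu>) = \<rho> n \<omega>"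
  obtains \<mu> where "prob_space \<mu>" "sets \<mu> = sets (\<Pi>\<^sub>M i\<in>I. count_space {0, 1})"
    "\<And>n \<omega>. \<omega> \<in> configs (B n) \<Longrightarrow> measure \<mu> {x \<in> space \<mu>. restrict x (B n) = \<omega>} = \<rho> n \<omega>"
proof -
  define p where "p n = embed_pmf (\<lambda>\<omega>. if \<omega> \<in> configs (B n) then \<rho> n \<omega> else 0)" for n
  have pmf_p: "pmf (p n) \<omega> = (if \<omega> \<in> configs (B n) then \<rho> n \<omega> else 0)" for n \<omega>
    unfolding p_def
  proof (rule pmf_embed_pmf)
    have "(\<integral>\<^sup>+\<omega>. ennreal (if \<omega> \<in> configs (B n) then \<rho> n \<omega> else 0) \<partial>count_space UNIV) =
      (\<Sum>\<omega>\<in>configs (B n). ennreal (if \<omega> \<in> configs (B n) then \<rho> n \<omega> else 0))"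
      by (rule nn_integral_count_space') (auto simp: finite_configs fin)
    also have "\<dots> = ennreal (\<Sum>\<omega>\<in>configs (B n). \<rho> n \<omega>)"
      by (simp add: nonneg sum_ennreal)
    finally show "(\<integral>\<^sup>+\<omega>. ennreal (if \<omega> \<in> configs (B n) then \<rho> n \<omega> else 0) \<partial>count_space UNIV) = 1"
      by (simp add: total)
  qed (simp add: nonneg)
  have set_p: "set_pmf (p n) \<subseteq> configs (B n)" for n
    by (auto simp: set_pmf_eq pmf_p)
  have meas_p: "measure (p n) A = (\<Sum>\<omega>\<in>{\<omega> \<in> configs (B n). \<omega> \<in> A}. \<rho> n \<omega>)" for n A
  proof -
    have "measure (p n) A = measure (p n) {\<omega> \<in> configs (B n). \<omega> \<in> A}"
      using set_p[of n] by (intro measure_pmf.finite_measure_eq_AE) (auto simp: AE_measure_pmf_iff)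
    also have "\<dots> = (\<Sum>\<omega>\<in>{\<omega> \<in> configs (B n). \<omega> \<in> A}. pmf (p n) \<omega>)"
      by (rule measure_measure_pmf_finite) (simp add: finite_configs fin)
    finally show ?thesis by (simp add: pmf_p)
  qed
  have B_mono: "B n \<subseteq> B m" if "n \<le> m" for n m
    using lift_Suc_mono_le[of B, OF mono that] .
  have map_Suc: "map_pmf (\<lambda>\<nu>. restrict \<nu> (B n)) (p (Suc n)) = p n" for n
  proof (rule pmf_eqI)
    fix \<omega>
    have "pmf (map_pmf (\<lambda>\<nu>. restrict \<nu> (B n)) (p (Suc n))) \<omega> =
      (\<Sum>\<nu> | \<nu> \<in> configs (B (Suc n)) \<and> restrict \<nu> (B n) = \<omega>. \<rho> (Suc n) \<nu>)"
      by (simp add: pmf_map meas_p del: restrict_apply)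
    also have "\<dots> = pmf (p n) \<omega>"
    proof (cases "\<omega> \<in> configs (B n)")
      case True
      then show ?thesis using consistent by (simp add: pmf_p)
    next
      case False
      then have "{\<nu>. \<nu> \<in> configs (B (Suc n)) \<and> restrict \<nu> (B n) = \<omega>} = {}"
        using configs_restrict[OF _ mono] by blast
      then show ?thesis using False by (simp only: pmf_p sum.empty if_False)
    qed
    finally show "pmf (map_pmf (\<lambda>\<nu>. restrict \<nu> (B n)) (p (Suc n))) \<omega> = pmf (p n) \<omega>" .
  qed
  have map_p: "map_pmf (\<lambda>\<nu>. restrict \<nu> (B n)) (p m) = p n" if "n \<le> m" for n m
    using that
  proof (induction m rule: dec_induct)
    case base
    have "map_pmf (\<lambda>\<nu>. restrict \<nu> (B n)) (p n) = map_pmf (\<lambda>\<nu>. \<nu>) (p n)"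
      by (rule map_pmf_cong) (use set_p configs_restrict_id in blast)+
    then show ?case by (simp only: pmf.map_ident)
  next
    case (step m)
    have "p n = map_pmf (\<lambda>\<nu>. restrict \<nu> (B n)) (map_pmf (\<lambda>\<nu>. restrict \<nu> (B m)) (p (Suc m)))"
      unfolding map_Suc step.IH ..
    also have "\<dots> = map_pmf (\<lambda>\<nu>. restrict \<nu> (B n)) (p (Suc m))"
      using B_mono[OF step.hyps(1)]
      by (simp add: pmf.map_comp comp_def Int_absorb1 del: restrict_apply)
    finally show ?case ..
  qed

  define E :: "node set \<Rightarrow> nat \<Rightarrow> (node \<Rightarrow> real) measure"
    where "E J n = distr (p n) (\<Pi>\<^sub>M i\<in>J. borel) (\<lambda>\<omega>. \<lambda>i\<in>J. real (\<omega> i))" for J n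
  have E_eq: "E J m = E J n" if "J \<subseteq> B n" "n \<le> m" for J n m
  proof -
    have "E J n = distr (distr (p m) (count_space UNIV) (\<lambda>\<nu>. restrict \<nu> (B n)))
        (\<Pi>\<^sub>M i\<in>J. borel) (\<lambda>\<omega>. \<lambda>i\<in>J. real (\<omega> i))"
      unfolding E_def map_p[OF that(2), symmetric] map_pmf_rep_eq ..
    also have "\<dots> = distr (p m) (\<Pi>\<^sub>M i\<in>J. borel) ((\<lambda>\<omega>. \<lambda>i\<in>J. real (\<omega> i)) \<circ> (\<lambda>\<nu>. restrict \<nu> (B n)))"
      by (rule distr_distr) (auto simp: space_PiM)
    also have "(\<lambda>\<omega>. \<lambda>i\<in>J. real (\<omega> i)) \<circ> (\<lambda>\<nu>. restrict \<nu> (B n)) = (\<lambda>\<omega> :: node \<Rightarrow> nat. \<lambda>i\<in>J. real (\<omega> i))"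
      using that by (auto simp: fun_eq_iff restrict_def)
    finally show ?thesis unfolding E_def by (rule sym)
  qed
  \<comment> \<open>the distribution on a finite set is read off from the first member of the sequence containing it\<close>
  define N where "N J = (LEAST n. J \<subseteq> B n)" for J
  have N: "J \<subseteq> B (N J)" if J: "finite J" "J \<subseteq> I" for J
    unfolding N_def
  proof (rule LeastI_ex)
    show "\<exists>n. J \<subseteq> B n"
      using J
    proof (induction J rule: finite_induct)
      case (insert i J)
      then obtain n m where "J \<subseteq> B n" "i \<in> B m" using I by auto
      then have "insert i J \<subseteq> B (max n m)"
        using B_mono[of n "max n m"] B_mono[of m "max n m"] by auto
      then show ?case ..
    qed simp
  qed
  have N_le: "N J \<le> n" if "J \<subseteq> B n" for J n
    unfolding N_def using that by (rule Least_le)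
  define P where "P J = E J (N J)" for J
  have P_eq: "P J = E J n" if "J \<subseteq> B n" "finite J" "J \<subseteq> I" for J n
    unfolding P_def using E_eq[OF N[OF that(2,3)] N_le[OF that(1)]] by simp

  interpret polish_projective I P
    unfolding polish_projective_def
  proof (rule projective_family.intro)
    fix J H :: "node set" assume JH: "J \<subseteq> H" and H: "finite H" "H \<subseteq> I"
    have J: "finite J" "J \<subseteq> I" using JH H finite_subset by auto
    have "distr (P H) (\<Pi>\<^sub>M i\<in>J. borel) (\<lambda>f. restrict f J) =
      distr (p (N H)) (\<Pi>\<^sub>M i\<in>J. borel) ((\<lambda>f. restrict f J) \<circ> (\<lambda>\<omega>. \<lambda>i\<in>H. real (\<omega> i)))"
      unfolding P_def E_def
      by (rule distr_distr) (auto simp: space_PiM intro!: measurable_restrict_subset[OF JH])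
    also have "(\<lambda>f. restrict f J) \<circ> (\<lambda>\<omega>. \<lambda>i\<in>H. real (\<omega> i)) = (\<lambda>\<omega> :: node \<Rightarrow> nat. \<lambda>i\<in>J. real (\<omega> i))"
      using JH by (auto simp: fun_eq_iff restrict_def)
    also have "distr (p (N H)) (\<Pi>\<^sub>M i\<in>J. borel) \<dots> = P J"
      using P_eq[of J "N H"] JH N[OF H] J by (auto simp: E_def)
    finally show "P J = distr (P H) (\<Pi>\<^sub>M i\<in>J. borel) (\<lambda>f. restrict f J)" ..
  next
    fix J :: "node set"
    show "prob_space (P J)"
      unfolding P_def E_def by (rule measure_pmf.prob_space_distr) (auto simp: space_PiM)
  qed

  define round :: "(node \<Rightarrow> real) \<Rightarrow> node \<Rightarrow> nat" where "round f = (\<lambda>i\<in>I. if f i = 1 then 1 else 0)" for f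
  let ?C = "\<Pi>\<^sub>M i\<in>I. count_space {0, 1 :: nat}"
  have round_meas: "round \<in> measurable lim ?C"
  proof -
    have "(\<lambda>f. if f i = 1 then 1 else 0 :: nat) \<in> measurable (\<Pi>\<^sub>M i\<in>I. borel :: real measure) (count_space {0, 1})"
      if "i \<in> I" for i
      using that by measurable
    then have "round \<in> measurable (\<Pi>\<^sub>M i\<in>I. borel) ?C"
      unfolding round_def by (rule measurable_restrict)
    then show ?thesis by (simp add: measurable_cong_sets[OF sets_lim refl])
  qed
  define \<mu> where "\<mu> = distr lim ?C round"
  show thesis
  proof
    show "prob_space \<mu>" unfolding \<mu>_def by (rule P.prob_space_distr[OF round_meas])
    show "sets \<mu> = sets ?C" by (simp add: \<mu>_def)
    fix n \<omega> assume \<omega>: "\<omega> \<in> configs (B n)"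
    have BI: "B n \<subseteq> I" using I by auto
    let ?A = "{x \<in> space \<mu>. restrict x (B n) = \<omega>}"
    let ?X = "PiE (B n) (\<lambda>i. if \<omega> i = 1 then {1} else - {1 :: real})"
    have A: "?A = prod_emb I (\<lambda>_. count_space {0, 1}) (B n) (PiE (B n) (\<lambda>i. {\<omega> i}))"
      using \<omega> unfolding \<mu>_def prod_emb_def
      by (auto simp: space_PiM configs_def restrict_PiE_iff PiE_iff extensional_def restrict_def fun_eq_iff)
    have A_sets: "?A \<in> sets ?C"
      unfolding A using \<omega> BI configs_values[OF \<omega>] by (intro sets_PiM_I fin) auto
    have X_sets: "?X \<in> sets (\<Pi>\<^sub>M i\<in>B n. borel)"
      by (rule sets_PiM_I_finite) (auto simp: fin)
    have "round -` ?A \<inter> space lim = prod_emb I (\<lambda>_. borel) (B n) ?X"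
    proof (intro set_eqI iffI)
      fix f assume f: "f \<in> round -` ?A \<inter> space lim"
      then have "\<omega> i = (if f i = 1 then 1 else 0)" if "i \<in> B n" for i
        using that BI by (auto simp: round_def restrict_def fun_eq_iff split: if_splits)
      then show "f \<in> prod_emb I (\<lambda>_. borel) (B n) ?X"
        using f by (auto simp: prod_emb_def space_PiM)
    next
      fix f assume f: "f \<in> prod_emb I (\<lambda>_. borel) (B n) ?X"
      then have "restrict f (B n) \<in> ?X" and fs: "f \<in> space lim"
        by (auto simp: prod_emb_def space_PiM)
      then have fi: "f i \<in> (if \<omega> i = 1 then {1} else - {1})" if "i \<in> B n" for i
        using that by (auto simp: PiE_iff restrict_def split: if_splits)
      have "restrict (round f) (B n) i = \<omega> i" for i
        using fi[of i] configs_values[OF \<omega>, of i] \<omega> BI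
        by (auto simp: round_def configs_def PiE_def extensional_def split: if_splits)
      then have "restrict (round f) (B n) = \<omega>" by blast
      moreover have "round f \<in> space \<mu>"
        by (auto simp: \<mu>_def space_PiM round_def)
      ultimately show "f \<in> round -` ?A \<inter> space lim" using fs by simp
    qed
    then have "measure \<mu> ?A = measure lim (prod_emb I (\<lambda>_. borel) (B n) ?X)"
      using measure_distr[OF round_meas A_sets] by (simp only: \<mu>_def[symmetric])
    also have "\<dots> = measure (P (B n)) ?X"
      using measure_lim_emb[OF BI fin X_sets] .
    also have "\<dots> = measure (p n) ((\<lambda>\<omega>. \<lambda>i\<in>B n. real (\<omega> i)) -` ?X)"
      unfolding P_eq[OF order_refl fin BI] E_def
      by (subst measure_distr[OF _ X_sets]) (auto simp: space_PiM)
    also have "\<dots> = (\<Sum>\<nu>\<in>{\<nu> \<in> configs (B n). \<nu> \<in> (\<lambda>\<omega>. \<lambda>i\<in>B n. real (\<omega> i)) -` ?X}. \<rho> n \<nu>)"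
      by (rule meas_p)
    also have "{\<nu> \<in> configs (B n). \<nu> \<in> (\<lambda>\<omega>. \<lambda>i\<in>B n. real (\<omega> i)) -` ?X} = {\<omega>}"
    proof (intro equalityI subsetI)
      fix \<nu> assume "\<nu> \<in> {\<nu> \<in> configs (B n). \<nu> \<in> (\<lambda>\<omega>. \<lambda>i\<in>B n. real (\<omega> i)) -` ?X}"
      then have \<nu>: "\<nu> \<in> configs (B n)"
        and X: "\<And>i. i \<in> B n \<Longrightarrow> real (\<nu> i) \<in> (if \<omega> i = 1 then {1} else - {1})"
        by (auto simp: PiE_iff)
      have "\<nu> = \<omega>"
      proof (rule configs_ext[OF \<nu> \<omega>])
        fix i assume "i \<in> B n"
        then show "\<nu> i = \<omega> i"
          using X[of i] configs_values[OF \<nu>, of i] configs_values[OF \<omega>, of i] by auto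
      qed
      then show "\<nu> \<in> {\<omega>}" by simp
    next
      fix \<nu> assume "\<nu> \<in> {\<omega>}"
      then show "\<nu> \<in> {\<nu> \<in> configs (B n). \<nu> \<in> (\<lambda>\<omega>. \<lambda>i\<in>B n. real (\<omega> i)) -` ?X}"
        using \<omega> configs_values[OF \<omega>] by (auto simp: PiE_iff)
    qed
    also have "sum (\<rho> n) {\<omega>} = \<rho> n \<omega>" by simp
    finally show "measure \<mu> ?A = \<rho> n \<omega>" .
  qed
qed

lemma space_config_space: "space (config_space \<Delta>) = configs (tree \<Delta>)"
  by (auto simp: config_space_def space_PiM configs_def)

lemma sets_cylinder:
  assumes "sets \<mu> = sets (config_space \<Delta>)" "finite B" "B \<subseteq> tree \<Delta>"
  shows "{x \<in> space \<mu>. restrict x B = \<omega>} \<in> sets \<mu>"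
proof (cases "\<omega> \<in> configs B")
  case True
  have "{x \<in> space \<mu>. restrict x B = \<omega>} =
    prod_emb (tree \<Delta>) (\<lambda>_. count_space {0, 1}) B (PiE B (\<lambda>i. {\<omega> i}))"
    using True sets_eq_imp_space_eq[OF assms(1)] unfolding prod_emb_def
    by (auto simp: space_PiM config_space_def configs_def restrict_PiE_iff PiE_iff extensional_def
      restrict_def fun_eq_iff)
  also have "\<dots> \<in> sets (config_space \<Delta>)"
    unfolding config_space_def using assms configs_values[OF True] by (intro sets_PiM_I) auto
  finally show ?thesis using assms by simp
next
  case False
  then have "{x \<in> space \<mu>. restrict x B = \<omega>} = {}"
    using assms configs_restrict sets_eq_imp_space_eq[OF assms(1)] space_config_space by blast
  then show ?thesis by (simp only: sets.empty_sets)
qed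

text \<open>An event that depends only on finitely many sites is a finite disjoint union of cylinders.\<close>

lemma local_event:
  assumes "prob_space \<mu>" and \<mu>: "sets \<mu> = sets (config_space \<Delta>)" and B: "finite B" "B \<subseteq> tree \<Delta>"
  shows "{x \<in> space \<mu>. Q (restrict x B)} \<in> sets \<mu>"
    and "measure \<mu> {x \<in> space \<mu>. Q (restrict x B)} =
      (\<Sum>\<omega> | \<omega> \<in> configs B \<and> Q \<omega>. measure \<mu> {x \<in> space \<mu>. restrict x B = \<omega>})"
proof -
  interpret prob_space \<mu> by fact
  have fin: "finite {\<omega> \<in> configs B. Q \<omega>}" using B by (simp add: finite_configs)
  have eq: "{x \<in> space \<mu>. Q (restrict x B)} =
    (\<Union>\<omega>\<in>{\<omega> \<in> configs B. Q \<omega>}. {x \<in> space \<mu>. restrict x B = \<omega>})"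
    using configs_restrict[OF _ B(2)] sets_eq_imp_space_eq[OF \<mu>] space_config_space by auto
  show "{x \<in> space \<mu>. Q (restrict x B)} \<in> sets \<mu>"
    unfolding eq using fin sets_cylinder[OF \<mu> B] by (intro sets.finite_UN) auto
  show "measure \<mu> {x \<in> space \<mu>. Q (restrict x B)} =
      (\<Sum>\<omega> | \<omega> \<in> configs B \<and> Q \<omega>. measure \<mu> {x \<in> space \<mu>. restrict x B = \<omega>})"
    unfolding eq
    by (rule finite_measure_finite_Union[OF fin])
      (use sets_cylinder[OF \<mu> B] in \<open>auto simp: disjoint_family_on_def simp del: restrict_apply\<close>)
qed

lemma measure_eqI_balls:
  assumes \<mu>: "prob_space \<mu>" "sets \<mu> = sets (config_space \<Delta>)"
    and \<nu>: "prob_space \<nu>" "sets \<nu> = sets (config_space \<Delta>)"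
    and eq: "\<And>n \<omega>. n > 0 \<Longrightarrow> \<omega> \<in> configs (tree_ball \<Delta> n) \<Longrightarrow>
      measure \<mu> {x \<in> space \<mu>. restrict x (tree_ball \<Delta> n) = \<omega>} =
      measure \<nu> {x \<in> space \<nu>. restrict x (tree_ball \<Delta> n) = \<omega>}"
  shows "\<mu> = \<nu>"
proof (rule measure_eqI_PiM_infinite)
  show "sets \<mu> = PiM (tree \<Delta>) (\<lambda>_. count_space {0, 1})" "sets \<nu> = PiM (tree \<Delta>) (\<lambda>_. count_space {0, 1})"
    using \<mu> \<nu> by (simp_all add: config_space_def)
  interpret \<mu>: prob_space \<mu> by fact
  interpret \<nu>: prob_space \<nu> by fact
  show "finite_measure \<mu>" by (rule \<mu>.finite_measure)
  fix A :: "node \<Rightarrow> nat set" and J assume J: "finite J" "J \<subseteq> tree \<Delta>"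
  obtain n where n: "J \<subseteq> tree_ball \<Delta> n" using finite_subset_ball[OF J] .
  let ?B = "tree_ball \<Delta> (Suc n)"
  have JB: "J \<subseteq> ?B" using n ball_mono[of n "Suc n" \<Delta>] by auto
  have B: "?B \<subseteq> tree \<Delta>" by (auto simp: tree_ball_def)
  let ?Q = "\<lambda>\<omega>. restrict \<omega> J \<in> PiE J A"
  have emb: "prod_emb (tree \<Delta>) (\<lambda>_. count_space {0, 1}) J (PiE J A) =
      {x \<in> space (config_space \<Delta>). ?Q (restrict x ?B)}"
    using JB by (auto simp: prod_emb_def config_space_def space_PiM Int_absorb1 simp del: restrict_apply)
  have sp: "space \<mu> = space (config_space \<Delta>)" "space \<nu> = space (config_space \<Delta>)"
    using \<mu> \<nu> sets_eq_imp_space_eq by blast+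
  have "measure \<mu> {x \<in> space \<mu>. ?Q (restrict x ?B)} = measure \<nu> {x \<in> space \<nu>. ?Q (restrict x ?B)}"
    unfolding local_event(2)[OF \<mu> finite_tree_ball B, where Q = ?Q]
      local_event(2)[OF \<nu> finite_tree_ball B, where Q = ?Q]
    using eq[of "Suc n"] by (intro sum.cong refl) (simp del: restrict_apply)
  then show "emeasure \<mu> (prod_emb (tree \<Delta>) (\<lambda>_. count_space {0, 1}) J (PiE J A)) =
      emeasure \<nu> (prod_emb (tree \<Delta>) (\<lambda>_. count_space {0, 1}) J (PiE J A))"
    unfolding emb \<mu>.emeasure_eq_measure \<nu>.emeasure_eq_measure sp by simp
qed


section \<open>Gibbs measures from periodic messages\<close>

context covering_model
begin

lemma ball_weight_cong:
  assumes "\<And>x a b. x \<in> level \<Delta> n \<Longrightarrow> M x a b = M' x a b"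
  shows "ball_weight n M \<sigma> = ball_weight n M' \<sigma>"
  using assms by (simp add: ball_weight_def)

text \<open>The unknown scaling factors cancel in probabilities.\<close>

lemma marginal_ratio:
  assumes \<omega>: "\<omega> \<in> configs (tree_ball \<Delta> m)"
    and M: "prop_on (level \<Delta> (m + k)) M v" and v: "\<And>y. y \<in> level \<Delta> (m + k) \<Longrightarrow> valid (v y)"
  shows "(\<Sum>\<nu> | \<nu> \<in> configs (tree_ball \<Delta> (m + k)) \<and> restrict \<nu> (tree_ball \<Delta> m) = \<omega>.
        ball_weight (m + k) M \<nu>) / (\<Sum>\<nu>\<in>configs (tree_ball \<Delta> (m + k)). ball_weight (m + k) M \<nu>) =
    ball_weight m (msg ((tree_step ^^ k) v)) \<omega> / partition_fn m ((tree_step ^^ k) v)"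
proof -
  let ?v = "(tree_step ^^ k) v"
  obtain C where C: "C > 0" "\<And>\<sigma>. \<sigma> \<in> configs (tree_ball \<Delta> m) \<Longrightarrow>
      ball_weight m ((absorb ^^ k) M) \<sigma> = C * ball_weight m (msg ?v) \<sigma>"
    using ball_weight_prop prop_on_funpow_absorb[OF M v] by blast
  have "(\<Sum>\<nu> | \<nu> \<in> configs (tree_ball \<Delta> (m + k)) \<and> True. ball_weight (m + k) M \<nu>) =
    (\<Sum>\<omega>\<in>configs (tree_ball \<Delta> m). \<Sum>\<nu> | \<nu> \<in> configs (tree_ball \<Delta> (m + k)) \<and> True \<and>
      restrict \<nu> (tree_ball \<Delta> m) = \<omega>. ball_weight (m + k) M \<nu>)"
    by (rule sum_configs_group[OF finite_tree_ball ball_mono[OF le_add1]])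
  also have "\<dots> = (\<Sum>\<omega>\<in>configs (tree_ball \<Delta> m). C * ball_weight m (msg ?v) \<omega>)"
    by (intro sum.cong refl) (simp only: simp_thms ball_weight_marginal C(2))
  finally have "(\<Sum>\<nu>\<in>configs (tree_ball \<Delta> (m + k)). ball_weight (m + k) M \<nu>) = C * partition_fn m ?v"
    by (simp add: partition_fn_def sum_distrib_left)
  then show ?thesis
    unfolding ball_weight_marginal[OF \<omega>] C(2)[OF \<omega>] using C(1) by simp
qed

subsection \<open>The Gibbs property\<close>

text \<open>The weight of a ball factors into \<open>exp (- H)\<close> for the Hamiltonian of \<open>L\<close>, which sees \<open>L\<close> and its boundary
  only, and a remainder \<open>R\<close> that does not see \<open>L\<close>. Given the spins outside \<open>L\<close>, summing over those in \<open>L\<close>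
  therefore produces the finite-volume probability. The ball exceeds \<open>L\<close> by \<open>2\<close> so that no message
  involves a node of \<open>L\<close>.\<close>

lemma ball_weight_gibbs_property:
  assumes L: "L \<subseteq> tree_ball \<Delta> N" and S: "S \<subseteq> L" and n: "n = N + 2"
  shows "(\<Sum>\<nu> | \<nu> \<in> configs (tree_ball \<Delta> n) \<and> restrict \<nu> S = \<omega>. ball_weight n (msg v) \<nu>) =
    (\<Sum>\<eta>\<in>configs (bdry \<Delta> L). finite_vol_prob \<Delta> lam (theta h) L S \<omega> \<eta> *
      (\<Sum>\<nu> | \<nu> \<in> configs (tree_ball \<Delta> n) \<and> restrict \<nu> (bdry \<Delta> L) = \<eta>. ball_weight n (msg v) \<nu>))"
proof -
  let ?B = "tree_ball \<Delta> n" and ?D = "bdry \<Delta> L"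
  let ?f = "ball_weight n (msg v)" and ?P = "finite_vol_prob \<Delta> lam (theta h) L S \<omega>"
  define U where "U = ?B - L"
  define I0 where "I0 = {i \<in> tree \<Delta>. nbhd \<Delta> i \<inter> L \<noteq> {}}"
  have LB: "L \<subseteq> ?B" using L ball_mono[of N n \<Delta>] n by auto
  have Lt: "L \<subseteq> tree \<Delta>" "finite L"
    using L finite_subset[OF LB finite_tree_ball] by (auto simp: tree_ball_def)
  have BU: "?B = L \<union> U" "L \<inter> U = {}" "finite U" using LB by (auto simp: U_def)
  have DB: "?D \<subseteq> ?B" using bdry_subset_ball[OF L] n by simp
  have DU: "?D \<subseteq> U" using DB bdry_disjoint by (auto simp: U_def)
  have I0: "I0 \<subseteq> inside \<Delta> n"
    using nbhd_meets_subset_ball[OF L] n inside_Suc_ball[of \<Delta> "Suc N"] by (simp add: I0_def)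
  define m where "m \<sigma> \<tau> = merge L U (\<sigma>, \<tau>)" for \<sigma> \<tau> :: "node \<Rightarrow> nat"
  define E where "E \<sigma> \<tau> = exp_neg (hamiltonian \<Delta> lam (theta h) L (merge L ?D (\<sigma>, restrict \<tau> ?D)))"
    for \<sigma> \<tau> :: "node \<Rightarrow> nat"
  define R where "R \<tau> = (\<Prod>x\<in>inside \<Delta> n - I0. site_weight (m (\<lambda>_. 0) \<tau>) x) *
      (\<Prod>x\<in>level \<Delta> n. msg v x (\<tau> x) (pspin \<tau> x))" for \<tau>
  have factor: "?f (m \<sigma> \<tau>) = E \<sigma> \<tau> * R \<tau>" if \<sigma>: "\<sigma> \<in> configs L" and \<tau>: "\<tau> \<in> configs U" for \<sigma> \<tau>
  proof -
    have "merge L ?D (\<sigma>, restrict \<tau> ?D) \<in> configs (L \<union> ?D)"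
      using \<sigma> \<tau> DU by (intro configs_merge configs_restrict)
    then have "E \<sigma> \<tau> = (\<Prod>i\<in>I0. site_weight (merge L ?D (\<sigma>, restrict \<tau> ?D)) i)"
      unfolding E_def I0_def using exp_neg_hamiltonian[OF Lt(2,1)] by simp
    also have "\<dots> = (\<Prod>i\<in>I0. site_weight (m \<sigma> \<tau>) i)"
    proof (intro prod.cong refl site_weight_cong)
      fix i y assume i: "i \<in> I0" and y: "y \<in> nbhd \<Delta> i"
      then have "y \<in> L \<union> ?D" using nbhd_subset_bdry by (auto simp: I0_def)
      then show "merge L ?D (\<sigma>, restrict \<tau> ?D) y = m \<sigma> \<tau> y"
        using DU BU by (auto simp: m_def merge_def)
    qed (auto simp: I0_def)
    finally have 1: "E \<sigma> \<tau> = (\<Prod>i\<in>I0. site_weight (m \<sigma> \<tau>) i)" .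
    have 2: "(\<Prod>x\<in>inside \<Delta> n - I0. site_weight (m \<sigma> \<tau>) x) =
      (\<Prod>x\<in>inside \<Delta> n - I0. site_weight (m (\<lambda>_. 0) \<tau>) x)"
    proof (intro prod.cong refl site_weight_cong)
      fix x y assume "x \<in> inside \<Delta> n - I0" "y \<in> nbhd \<Delta> x"
      then have "y \<notin> L" by (auto simp: I0_def inside_def)
      then show "m \<sigma> \<tau> y = m (\<lambda>_. 0) \<tau> y" by (simp add: m_def merge_def)
    qed (auto simp: inside_def)
    have 3: "(\<Prod>x\<in>level \<Delta> n. msg v x (m \<sigma> \<tau> x) (pspin (m \<sigma> \<tau>) x)) =
      (\<Prod>x\<in>level \<Delta> n. msg v x (\<tau> x) (pspin \<tau> x))"
    proof (intro prod.cong refl)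
      fix x assume x: "x \<in> level \<Delta> n"
      then have "x \<in> U" "x \<noteq> []" "tl x \<in> U"
        using L n tree_tl[of x \<Delta>] by (auto simp: U_def level_def tree_ball_def)
      then show "msg v x (m \<sigma> \<tau> x) (pspin (m \<sigma> \<tau>) x) = msg v x (\<tau> x) (pspin \<tau> x)"
        using BU by (auto simp: m_def merge_def pspin_def)
    qed
    have "(\<Prod>x\<in>inside \<Delta> n. site_weight (m \<sigma> \<tau>) x) =
      (\<Prod>x\<in>inside \<Delta> n - I0. site_weight (m \<sigma> \<tau>) x) * (\<Prod>x\<in>I0. site_weight (m \<sigma> \<tau>) x)"
      using I0 by (intro prod.subset_diff) auto
    then show ?thesis
      unfolding ball_weight_def R_def 1 2 3 by (simp add: mult_ac)
  qed
  have E_nonneg: "E \<sigma> \<tau> \<ge> 0" for \<sigma> \<tau> by (simp add: E_def exp_neg_def)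
  \<comment> \<open>multiplying by the normalising constant is harmless even if it is \<open>0\<close>\<close>
  have ratio: "(\<Sum>\<sigma>\<in>configs L. if restrict \<sigma> S = \<omega> then E \<sigma> \<tau> else 0) =
    ?P (restrict \<tau> ?D) * (\<Sum>\<sigma>\<in>configs L. E \<sigma> \<tau>)" for \<tau>
  proof (cases "(\<Sum>\<sigma>\<in>configs L. E \<sigma> \<tau>) = 0")
    case True
    then have "E \<sigma> \<tau> = 0" if "\<sigma> \<in> configs L" for \<sigma>
      using that E_nonneg finite_configs[OF Lt(2)] by (simp add: sum_nonneg_eq_0_iff)
    then have "(\<Sum>\<sigma>\<in>configs L. if restrict \<sigma> S = \<omega> then E \<sigma> \<tau> else 0) = 0"
      by (intro sum.neutral) simp
    then show ?thesis using True by simp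
  next
    case False
    have "?P (restrict \<tau> ?D) = (\<Sum>\<sigma> | \<sigma> \<in> configs L \<and> restrict \<sigma> S = \<omega>. E \<sigma> \<tau>) / (\<Sum>\<sigma> | \<sigma> \<in> configs L. E \<sigma> \<tau>)"
      by (simp only: finite_vol_prob_def E_def)
    also have "(\<Sum>\<sigma> | \<sigma> \<in> configs L \<and> restrict \<sigma> S = \<omega>. E \<sigma> \<tau>) =
      (\<Sum>\<sigma>\<in>configs L. if restrict \<sigma> S = \<omega> then E \<sigma> \<tau> else 0)"
      using finite_configs[OF Lt(2)] by (rule sum.inter_filter)
    finally have "?P (restrict \<tau> ?D) * (\<Sum>\<sigma>\<in>configs L. E \<sigma> \<tau>) =
      (\<Sum>\<sigma>\<in>configs L. if restrict \<sigma> S = \<omega> then E \<sigma> \<tau> else 0) / (\<Sum>\<sigma>\<in>configs L. E \<sigma> \<tau>) *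
        (\<Sum>\<sigma>\<in>configs L. E \<sigma> \<tau>)"
      by (simp only: Collect_mem_eq)
    then show ?thesis using False by (simp del: restrict_apply)
  qed
  have rS: "restrict (m \<sigma> \<tau>) S = restrict \<sigma> S" for \<sigma> \<tau>
    using S by (auto simp: m_def merge_def restrict_def fun_eq_iff)
  have rD: "restrict (m \<sigma> \<tau>) ?D = restrict \<tau> ?D" for \<sigma> \<tau>
    using DU BU by (auto simp: m_def merge_def restrict_def fun_eq_iff)
  have "(\<Sum>\<nu> | \<nu> \<in> configs ?B \<and> restrict \<nu> S = \<omega>. ?f \<nu>) =
    (\<Sum>\<nu>\<in>configs ?B. if restrict \<nu> S = \<omega> then ?f \<nu> else 0)"
    using finite_configs[OF finite_tree_ball] by (rule sum.inter_filter)
  also have "\<dots> = (\<Sum>\<sigma>\<in>configs L. \<Sum>\<tau>\<in>configs U. (if restrict \<sigma> S = \<omega> then E \<sigma> \<tau> else 0) * R \<tau>)"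
    unfolding BU(1) sum_configs_Un[OF BU(2)] m_def[symmetric]
    by (intro sum.cong refl) (simp add: rS factor del: restrict_apply)
  also have "\<dots> = (\<Sum>\<tau>\<in>configs U. (\<Sum>\<sigma>\<in>configs L. if restrict \<sigma> S = \<omega> then E \<sigma> \<tau> else 0) * R \<tau>)"
    by (subst sum.swap) (simp only: sum_distrib_right)
  also have "\<dots> = (\<Sum>\<sigma>\<in>configs L. \<Sum>\<tau>\<in>configs U. ?P (restrict (m \<sigma> \<tau>) ?D) * ?f (m \<sigma> \<tau>))"
  proof -
    have "(\<Sum>\<sigma>\<in>configs L. \<Sum>\<tau>\<in>configs U. ?P (restrict (m \<sigma> \<tau>) ?D) * ?f (m \<sigma> \<tau>)) =
      (\<Sum>\<sigma>\<in>configs L. \<Sum>\<tau>\<in>configs U. ?P (restrict \<tau> ?D) * (E \<sigma> \<tau> * R \<tau>))"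
      by (intro sum.cong refl) (simp only: rD factor)
    also have "\<dots> = (\<Sum>\<tau>\<in>configs U. \<Sum>\<sigma>\<in>configs L. ?P (restrict \<tau> ?D) * (E \<sigma> \<tau> * R \<tau>))"
      by (rule sum.swap)
    finally show ?thesis
      unfolding ratio by (simp only: sum_distrib_left sum_distrib_right mult.assoc)
  qed
  also have "\<dots> = (\<Sum>\<nu> | \<nu> \<in> configs ?B \<and> True. ?P (restrict \<nu> ?D) * ?f \<nu>)"
    using sum_configs_Un[OF BU(2), of "\<lambda>\<nu>. ?P (restrict \<nu> ?D) * ?f \<nu>"]
    by (simp only: BU(1) m_def simp_thms Collect_mem_eq)
  also have "\<dots> = (\<Sum>\<eta>\<in>configs ?D. \<Sum>\<nu> | \<nu> \<in> configs ?B \<and> True \<and> restrict \<nu> ?D = \<eta>.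
      ?P (restrict \<nu> ?D) * ?f \<nu>)"
    by (rule sum_configs_group[OF finite_tree_ball DB])
  also have "\<dots> = (\<Sum>\<eta>\<in>configs ?D. ?P \<eta> *
      (\<Sum>\<nu> | \<nu> \<in> configs ?B \<and> restrict \<nu> ?D = \<eta>. ?f \<nu>))"
    unfolding sum_distrib_left by (intro sum.cong refl) auto
  finally show ?thesis .
qed

lemma ball_weight_adjacent:
  assumes ij: "(i, j) \<in> edges \<Delta>" and n: "i \<in> inside \<Delta> n" and spin: "\<omega> i = 1" "\<omega> j = 1"
  shows "ball_weight n M \<omega> = 0"
proof -
  have i: "i \<in> tree \<Delta>" using n by (simp add: inside_def)
  have "i \<noteq> j" "j \<in> nbhd \<Delta> i" using ij by (auto simp: nbhd_def edges_def)
  moreover have "finite (nbhd \<Delta> i)" by (rule finite_subset[OF nbhd_inside[OF n] finite_tree_ball])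
  ultimately have "\<omega> i + \<omega> j \<le> sum \<omega> (nbhd \<Delta> i)"
    using sum_mono2[of "nbhd \<Delta> i" "{i, j}" \<omega>] by (auto simp: nbhd_def)
  then have "site_weight \<omega> i = 0"
    unfolding sum_nbhd[OF i] using spin by (auto simp: site_weight_def loc_weight_def)
  then show ?thesis
    using n by (auto simp: ball_weight_def prod_zero_iff)
qed

text \<open>The sum in the definition of a Gibbs measure runs over independent boundary configurations. The other
  ones have probability \<open>0\<close>, because an inner pair of adjacent occupied nodes makes the weight vanish.\<close>

lemma gibbs_of_ball_distributions:
  assumes \<mu>: "prob_space \<mu>" "sets \<mu> = sets (config_space \<Delta>)"
    and distr: "\<And>n \<omega>. n > 0 \<Longrightarrow> \<omega> \<in> configs (tree_ball \<Delta> n) \<Longrightarrow>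
      measure \<mu> {x \<in> space \<mu>. restrict x (tree_ball \<Delta> n) = \<omega>} =
      ball_weight n (msg v) \<omega> / partition_fn n v"
  shows "gibbs_measure \<Delta> lam (theta h) \<mu>"
  unfolding gibbs_measure_def
proof (intro conjI \<mu> allI impI)
  interpret prob_space \<mu> by (rule \<mu>)
  have tb: "tree_ball \<Delta> n \<subseteq> tree \<Delta>" for n by (auto simp: tree_ball_def)
  have event: "measure \<mu> {x \<in> space \<mu>. Q (restrict x (tree_ball \<Delta> n))} =
      (\<Sum>\<omega> | \<omega> \<in> configs (tree_ball \<Delta> n) \<and> Q \<omega>. ball_weight n (msg v) \<omega>) / partition_fn n v"
    if "n > 0" for n Q
    unfolding local_event(2)[OF \<mu> finite_tree_ball tb] sum_divide_distrib
    using distr[OF that] by (intro sum.cong refl) simp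
  have adjacent: "AE \<omega> in \<mu>. \<not> (\<omega> i = 1 \<and> \<omega> j = 1)" if ij: "(i, j) \<in> edges \<Delta>" for i j
  proof -
    define n where "n = Suc (max (length i) (length j))"
    let ?B = "tree_ball \<Delta> n" and ?Q = "\<lambda>\<omega>. \<omega> i = 1 \<and> \<omega> j = (1::nat)"
    have in_ball: "i \<in> ?B" "j \<in> ?B" "i \<in> inside \<Delta> n"
      using ij by (auto simp: edges_def n_def tree_ball_def inside_def)
    define A where "A = {x \<in> space \<mu>. ?Q (restrict x ?B)}"
    have "measure \<mu> A = 0"
      unfolding A_def using event[of n ?Q] ball_weight_adjacent[OF ij in_ball(3)] by (simp add: n_def)
    moreover have "A \<in> sets \<mu>"
      unfolding A_def using local_event(1)[OF \<mu> finite_tree_ball tb, where Q = ?Q] .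
    ultimately have "A \<in> null_sets \<mu>" by (auto simp: emeasure_eq_measure)
    then show ?thesis by (rule AE_I') (use in_ball in \<open>auto simp: A_def\<close>)
  qed
  have "AE \<omega> in \<mu>. \<forall>i j. (i, j) \<in> edges \<Delta> \<longrightarrow> \<not> (\<omega> i = 1 \<and> \<omega> j = 1)"
    unfolding AE_all_countable using adjacent by auto
  then show "AE \<omega> in \<mu>. \<omega> \<in> indep_configs \<Delta> (tree \<Delta>)"
    using AE_space
  proof eventually_elim
    case (elim \<omega>)
    then have "\<omega> \<in> configs (tree \<Delta>)"
      using sets_eq_imp_space_eq[OF \<mu>(2)] space_config_space by auto
    with elim show ?case by (auto simp: indep_configs_def)
  qed
  fix L S :: "node set" and \<omega> :: "node \<Rightarrow> nat"
  assume asm: "finite L \<and> L \<subseteq> tree \<Delta> \<and> S \<subseteq> L \<and> \<omega> \<in> configs S"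
  then obtain N where N: "L \<subseteq> tree_ball \<Delta> N" using finite_subset_ball by blast
  define n where "n = N + 2"
  let ?B = "tree_ball \<Delta> n" and ?D = "bdry \<Delta> L"
  have DB: "?D \<subseteq> ?B" using bdry_subset_ball[OF N] by (simp add: n_def)
  have SB: "S \<subseteq> ?B" using asm N ball_mono[of N n \<Delta>] by (auto simp: n_def)
  have cyl: "measure \<mu> {x \<in> space \<mu>. restrict x T = \<zeta>} =
      (\<Sum>\<nu> | \<nu> \<in> configs ?B \<and> restrict \<nu> T = \<zeta>. ball_weight n (msg v) \<nu>) / partition_fn n v"
    if "T \<subseteq> ?B" for T \<zeta>
    using event[of n "\<lambda>x. restrict x T = \<zeta>"] that
    by (simp add: n_def Int_absorb1 del: restrict_apply)
  have zero: "measure \<mu> {x \<in> space \<mu>. restrict x ?D = \<eta>} = 0"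
    if \<eta>: "\<eta> \<in> configs ?D - indep_configs \<Delta> ?D" for \<eta>
  proof -
    obtain i j where ij: "i \<in> ?D" "j \<in> ?D" "(i, j) \<in> edges \<Delta>" "\<eta> i = 1" "\<eta> j = 1"
      using \<eta> by (auto simp: indep_configs_def)
    have "AE x in \<mu>. restrict x ?D \<noteq> \<eta>"
      using adjacent[OF ij(3)] by eventually_elim (use ij in \<open>metis restrict_apply'\<close>)
    then show ?thesis
      using sets_cylinder[OF \<mu>(2) _ bdry_subset_tree, of L \<eta>] finite_subset[OF DB]
      by (subst prob_eq_0) (auto simp del: restrict_apply)
  qed
  have "measure \<mu> {x \<in> space \<mu>. restrict x S = \<omega>} =
    (\<Sum>\<eta>\<in>configs ?D. finite_vol_prob \<Delta> lam (theta h) L S \<omega> \<eta> *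
      measure \<mu> {x \<in> space \<mu>. restrict x ?D = \<eta>})"
    unfolding cyl[OF SB] cyl[OF DB] using asm
    by (subst ball_weight_gibbs_property[OF N _ n_def])
      (simp_all only: sum_divide_distrib[of "\<lambda>\<eta>. _ \<eta> * _ \<eta>"] times_divide_eq_right)
  also have "\<dots> = (\<Sum>\<eta>\<in>indep_configs \<Delta> ?D. finite_vol_prob \<Delta> lam (theta h) L S \<omega> \<eta> *
      measure \<mu> {x \<in> space \<mu>. restrict x ?D = \<eta>})"
    using zero finite_configs[OF finite_subset[OF DB]]
    by (intro sum.mono_neutral_right) (auto simp: indep_configs_def simp del: restrict_apply)
  finally show "measure \<mu> {x \<in> space \<mu>. restrict x S = \<omega>} =
    (\<Sum>\<eta>\<in>indep_configs \<Delta> ?D. finite_vol_prob \<Delta> lam (theta h) L S \<omega> \<eta> *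
      measure \<mu> {x \<in> space \<mu>. restrict x ?D = \<eta>})" .
qed

definition branching :: nat where
  "branching = \<Delta> - 1"

end

sublocale covering_model \<subseteq> message_map branching lam h
  using \<Delta>_ge_3 lam_pos h_nonneg by unfold_locales (auto simp: branching_def)

context covering_model
begin

lemma tree_step_const:
  assumes x: "x \<in> tree \<Delta>" "x \<noteq> []" and v: "\<And>y. y \<in> children \<Delta> x \<Longrightarrow> v y = z"
  shows "tree_step v x = step z"
proof -
  have "card (children \<Delta> x) = branching" using card_children[OF x(1)] x(2) by (simp add: branching_def)
  then show ?thesis using v by (simp add: tree_step_def step_def Let_def)
qed

text \<open>Messages alternating between the two points of a cycle reproduce themselves under the recursion. Hence
  the distributions on balls which they define are consistent. The root, which has one child more
  than the other nodes, never sends a message and is summed over only as an inner node; this is why only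
  balls of positive radius are used.\<close>

lemma gibbs_measure_of_two_cycle:
  assumes zw: "valid z" "valid w" "step z = w" "step w = z"
  defines "v \<equiv> \<lambda>x::node. if even (length x) then z else w"
  obtains \<mu> where "gibbs_measure \<Delta> lam (theta h) \<mu>"
    "\<And>n \<omega>. n > 0 \<Longrightarrow> \<omega> \<in> configs (tree_ball \<Delta> n) \<Longrightarrow>
      measure \<mu> {x \<in> space \<mu>. restrict x (tree_ball \<Delta> n) = \<omega>} =
      ball_weight n (msg v) \<omega> / partition_fn n v"
proof -
  have valid_v: "valid (v x)" for x using zw by (simp add: v_def)
  have step_v: "tree_step v x = v x" if "x \<in> tree \<Delta>" "x \<noteq> []" for x
    using tree_step_const[OF that, of v "if even (length x) then w else z"] zw length_children[of _ \<Delta> x]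
    by (auto simp: v_def)
  define \<rho> where "\<rho> n \<omega> = ball_weight (Suc n) (msg v) \<omega> / partition_fn (Suc n) v" for n \<omega>
  have consistent: "(\<Sum>\<nu> | \<nu> \<in> configs (tree_ball \<Delta> (Suc (Suc n))) \<and>
      restrict \<nu> (tree_ball \<Delta> (Suc n)) = \<omega>. \<rho> (Suc n) \<nu>) = \<rho> n \<omega>"
    if \<omega>: "\<omega> \<in> configs (tree_ball \<Delta> (Suc n))" for n \<omega>
  proof -
    have v1: "msg ((tree_step ^^ 1) v) x a b = msg v x a b" if "x \<in> level \<Delta> (Suc n)" for x a b
    proof -
      have "x \<in> tree \<Delta>" "x \<noteq> []" using that by (auto simp: level_def)
      then show ?thesis using step_v by (simp add: msg_def)
    qed
    have w: "ball_weight (Suc n) (msg ((tree_step ^^ 1) v)) \<sigma> = ball_weight (Suc n) (msg v) \<sigma>" for \<sigma>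
      by (rule ball_weight_cong) (rule v1)
    have "prop_on (level \<Delta> (Suc n + 1)) (msg v) v"
      unfolding prop_on_def by (intro exI[of _ "\<lambda>_. 1"]) simp
    note ratio = marginal_ratio[OF \<omega> this valid_v]
    have "partition_fn (Suc n) ((tree_step ^^ 1) v) = partition_fn (Suc n) v"
      by (simp only: partition_fn_def w)
    with ratio show ?thesis
      unfolding w by (simp add: \<rho>_def partition_fn_def sum_divide_distrib[symmetric] del: restrict_apply)
  qed
  have pos: "partition_fn n v > 0" for n using partition_fn_pos valid_v by blast
  obtain \<mu> where \<mu>: "prob_space \<mu>" "sets \<mu> = sets (\<Pi>\<^sub>M i\<in>tree \<Delta>. count_space {0, 1})"
    "\<And>n \<omega>. \<omega> \<in> configs (tree_ball \<Delta> (Suc n)) \<Longrightarrow>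
      measure \<mu> {x \<in> space \<mu>. restrict x (tree_ball \<Delta> (Suc n)) = \<omega>} = \<rho> n \<omega>"
  proof (rule kolmogorov_configs[of "\<lambda>n. tree_ball \<Delta> (Suc n)" "tree \<Delta>" \<rho>])
    show "tree \<Delta> = (\<Union>n. tree_ball \<Delta> (Suc n))"
      by (auto simp: tree_ball_def intro: le_SucI)
    show "\<rho> n \<omega> \<ge> 0" for n \<omega>
      using pos[of "Suc n"] ball_weight_nonneg[of "Suc n" v \<omega>] valid_v by (simp add: \<rho>_def)
    show "(\<Sum>\<omega>\<in>configs (tree_ball \<Delta> (Suc n)). \<rho> n \<omega>) = 1" for n
      using pos[of "Suc n"] by (simp add: \<rho>_def sum_divide_distrib[symmetric] partition_fn_def)
  qed (use consistent ball_mono in auto)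
  have distr: "measure \<mu> {x \<in> space \<mu>. restrict x (tree_ball \<Delta> n) = \<omega>} =
      ball_weight n (msg v) \<omega> / partition_fn n v"
    if "n > 0" "\<omega> \<in> configs (tree_ball \<Delta> n)" for n \<omega>
    using \<mu>(3)[of \<omega> "n - 1"] that by (simp add: \<rho>_def)
  have "gibbs_measure \<Delta> lam (theta h) \<mu>"
    using gibbs_of_ball_distributions[OF \<mu>(1) _ distr] \<mu>(2) by (simp add: config_space_def)
  then show thesis using that distr by blast
qed


section \<open>Uniqueness of the Gibbs measure\<close>

subsection \<open>Boundary conditions as messages\<close>

text \<open>A boundary condition on the two levels outside a ball fixes the children and grandchildren of the
  outermost nodes of the ball. The factors of such a node and of its children become its message.\<close>

definition bdry_msg :: "(node \<Rightarrow> nat) \<Rightarrow> node \<Rightarrow> nat \<Rightarrow> nat \<Rightarrow> real" where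
  "bdry_msg \<eta> x a b = loc_weight a b (sum \<eta> (children \<Delta> x)) *
    (\<Prod>y\<in>children \<Delta> x. loc_weight (\<eta> y) a (sum \<eta> (children \<Delta> y)))"

lemma exp_neg_hamiltonian_ball:
  assumes \<nu>: "\<nu> \<in> configs (tree_ball \<Delta> n)" and \<eta>: "\<eta> \<in> configs (bdry \<Delta> (tree_ball \<Delta> n))"
  shows "exp_neg (hamiltonian \<Delta> lam (theta h) (tree_ball \<Delta> n)
      (merge (tree_ball \<Delta> n) (bdry \<Delta> (tree_ball \<Delta> n)) (\<nu>, \<eta>))) = ball_weight n (bdry_msg \<eta>) \<nu>"
proof -
  let ?B = "tree_ball \<Delta> n" and ?\<omega> = "merge (tree_ball \<Delta> n) (bdry \<Delta> (tree_ball \<Delta> n)) (\<nu>, \<eta>)"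
  have B: "?B \<subseteq> tree \<Delta>" by (auto simp: tree_ball_def)
  have outer: "?\<omega> x = \<eta> x" if "x \<in> level \<Delta> (Suc n) \<or> x \<in> level \<Delta> (Suc (Suc n))" for x
    using that unfolding bdry_ball by (auto simp: merge_def level_def tree_ball_def)
  have "exp_neg (hamiltonian \<Delta> lam (theta h) ?B ?\<omega>) = (\<Prod>i\<in>tree_ball \<Delta> (Suc n). site_weight ?\<omega> i)"
    using exp_neg_hamiltonian[OF finite_tree_ball B configs_merge[OF \<nu> \<eta>]]
    unfolding nbhd_meets_ball .
  also have "\<dots> = (\<Prod>i\<in>inside \<Delta> (Suc n). site_weight ?\<omega> i) * (\<Prod>i\<in>level \<Delta> (Suc n). site_weight ?\<omega> i)"
    unfolding inside_Suc_ball[symmetric] inside_Suc[of \<Delta> "Suc n"]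
    by (rule prod.union_disjoint) (simp_all add: inside_level_disjoint)
  also have "(\<Prod>i\<in>level \<Delta> (Suc n). site_weight ?\<omega> i) =
    (\<Prod>i\<in>level \<Delta> (Suc n). loc_weight (?\<omega> i) (pspin ?\<omega> i) (sum \<eta> (children \<Delta> i)))"
    unfolding site_weight_def
  proof (intro prod.cong refl)
    fix i assume "i \<in> level \<Delta> (Suc n)"
    from children_subset_level[OF this] have "sum ?\<omega> (children \<Delta> i) = sum \<eta> (children \<Delta> i)"
      by (intro sum.cong outer) auto
    then show "loc_weight (?\<omega> i) (pspin ?\<omega> i) (sum ?\<omega> (children \<Delta> i)) =
      loc_weight (?\<omega> i) (pspin ?\<omega> i) (sum \<eta> (children \<Delta> i))" by simp
  qed
  also have "(\<Prod>i\<in>inside \<Delta> (Suc n). site_weight ?\<omega> i) * \<dots> =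
      ball_weight (Suc n) (\<lambda>y a b. loc_weight a b (sum \<eta> (children \<Delta> y))) ?\<omega>"
    by (simp only: ball_weight_def)
  also have "\<dots> = ball_weight n (bdry_msg \<eta>) \<nu>"
    unfolding bdry_msg_def using outer by (intro ball_weight_Suc) (auto simp: merge_def)
  finally show ?thesis .
qed

text \<open>A boundary condition without adjacent occupied nodes leaves \<open>M 0 1\<close> positive, so its message can be
  normalised; the value of \<open>q\<close> is \<open>1\<close> or \<open>1 + h\<close>.\<close>

lemma bdry_msg_prop:
  assumes \<eta>: "\<eta> \<in> indep_configs \<Delta> (bdry \<Delta> (tree_ball \<Delta> n))"
  obtains u where "\<And>x. x \<in> level \<Delta> n \<Longrightarrow> valid (u x)" "prop_on (level \<Delta> n) (bdry_msg \<eta>) u"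
proof
  define c where "c x = (\<Prod>y\<in>children \<Delta> x. loc_weight (\<eta> y) 0 (sum \<eta> (children \<Delta> y)))" for x
  define u where "u x = (loc_weight 0 0 (sum \<eta> (children \<Delta> x)), bdry_msg \<eta> x 1 0 / bdry_msg \<eta> x 0 0)" for x
  have c_pos: "c x > 0" if x: "x \<in> level \<Delta> n" for x
    unfolding c_def
  proof (rule prod_pos)
    fix y assume y: "y \<in> children \<Delta> x"
    have yl: "y \<in> level \<Delta> (Suc n)" using children_subset_level[OF x] y by auto
    have "\<eta> z = 0" if z: "z \<in> children \<Delta> y" and one: "\<eta> y = 1" for z
    proof -
      have "z \<in> level \<Delta> (Suc (Suc n))" using children_subset_level[OF yl] z by auto
      moreover have "(y, z) \<in> edges \<Delta>" using edges_iff[of y \<Delta> z] z yl by (auto simp: level_def)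
      ultimately have "\<eta> z \<noteq> 1" "\<eta> z = 0 \<or> \<eta> z = 1"
        using \<eta> yl one configs_values[of \<eta> "bdry \<Delta> (tree_ball \<Delta> n)" z]
        unfolding bdry_ball indep_configs_def by auto
      then show ?thesis by simp
    qed
    then show "loc_weight (\<eta> y) 0 (sum \<eta> (children \<Delta> y)) > 0"
      using lam_pos h_nonneg by (auto simp: loc_weight_def)
  qed
  have q: "loc_weight 0 0 s \<ge> 1" for s using h_nonneg by (simp add: loc_weight_def)
  have b00: "bdry_msg \<eta> x 0 0 = fst (u x) * c x" for x
    by (simp add: bdry_msg_def u_def c_def)
  have b01: "bdry_msg \<eta> x 0 1 = c x" for x
    by (simp add: bdry_msg_def c_def loc_weight_def)
  have b11: "bdry_msg \<eta> x 1 1 = 0" for x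
    by (simp add: bdry_msg_def loc_weight_def)
  have b10: "bdry_msg \<eta> x 1 0 = snd (u x) * (fst (u x) * c x)" if "x \<in> level \<Delta> n" for x
    using c_pos[OF that] q[of "sum \<eta> (children \<Delta> x)"] b00[of x] by (simp add: u_def)
  show "valid (u x)" if "x \<in> level \<Delta> n" for x
    using q by (auto simp: valid_def u_def bdry_msg_def intro!: divide_nonneg_nonneg mult_nonneg_nonneg
      prod_nonneg loc_weight_nonneg)
  show "prop_on (level \<Delta> n) (bdry_msg \<eta>) u"
    unfolding prop_on_def
  proof (intro exI[of _ c] ballI conjI)
    fix x and a b :: nat assume x: "x \<in> level \<Delta> n" and "a \<in> {0, 1}" "b \<in> {0, 1}"
    then consider "a = 0" "b = 0" | "a = 0" "b = 1" | "a = 1" "b = 0" | "a = 1" "b = 1" by auto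
    then show "bdry_msg \<eta> x a b = c x * msg u x a b"
      using b00[of x] b01[of x] b10[OF x] b11[of x] by cases (simp_all add: msg_def)
  qed (rule c_pos)
qed

lemma finite_vol_prob_ball:
  assumes \<omega>: "\<omega> \<in> configs (tree_ball \<Delta> m)"
    and \<eta>: "\<eta> \<in> indep_configs \<Delta> (bdry \<Delta> (tree_ball \<Delta> (m + k)))"
  obtains u where "\<And>x. x \<in> level \<Delta> (m + k) \<Longrightarrow> valid (u x)"
    "finite_vol_prob \<Delta> lam (theta h) (tree_ball \<Delta> (m + k)) (tree_ball \<Delta> m) \<omega> \<eta> =
      ball_weight m (msg ((tree_step ^^ k) u)) \<omega> / partition_fn m ((tree_step ^^ k) u)"
proof -
  obtain u where u: "\<And>x. x \<in> level \<Delta> (m + k) \<Longrightarrow> valid (u x)"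
    "prop_on (level \<Delta> (m + k)) (bdry_msg \<eta>) u"
    using bdry_msg_prop[OF \<eta>] by blast
  let ?B = "tree_ball \<Delta> (m + k)"
  have "\<eta> \<in> configs (bdry \<Delta> ?B)" using \<eta> by (simp add: indep_configs_def)
  note weight = exp_neg_hamiltonian_ball[OF _ this]
  have "finite_vol_prob \<Delta> lam (theta h) ?B (tree_ball \<Delta> m) \<omega> \<eta> =
    (\<Sum>\<nu> | \<nu> \<in> configs ?B \<and> restrict \<nu> (tree_ball \<Delta> m) = \<omega>. ball_weight (m + k) (bdry_msg \<eta>) \<nu>) /
    (\<Sum>\<nu>\<in>configs ?B. ball_weight (m + k) (bdry_msg \<eta>) \<nu>)"
    unfolding finite_vol_prob_def using weight
    by (intro arg_cong2[where f = "(/)"] sum.cong) (auto simp del: restrict_apply)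
  then show thesis
    using that[OF u(1)] marginal_ratio[OF \<omega> u(2,1)] by simp
qed


subsection \<open>Contraction of the boundary influence\<close>

lemma tree_step_antimono:
  assumes "\<And>y. y \<in> children \<Delta> x \<Longrightarrow> valid (v y)" "\<And>y. y \<in> children \<Delta> x \<Longrightarrow> below (v y) (w y)"
  shows "below (tree_step w x) (tree_step v x)"
proof -
  let ?P = "\<lambda>v. \<Prod>y\<in>children \<Delta> x. 1 + snd (v y)" and ?Q = "\<lambda>v. \<Prod>y\<in>children \<Delta> x. fst (v y)"
  have w: "valid (w y)" if "y \<in> children \<Delta> x" for y using assms that valid_above by blast
  have "?P v \<le> ?P w" "?Q v \<le> ?Q w"
    using assms by (auto intro!: prod_mono simp: valid_def below_def) (smt (verit))
  moreover have "?P v > 0" "?Q v > 0" "?P w > 0" "?Q w > 0"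
    using assms(1) w by (auto intro!: prod_pos simp: valid_def) (smt (verit))+
  ultimately show ?thesis
    using h_nonneg lam_pos unfolding below_def tree_step_def Let_def
    by (auto intro!: divide_left_mono mult_mono mult_pos_pos add_pos_nonneg add_nonneg_nonneg)
qed

lemma tree_step_between:
  assumes x: "x \<in> tree \<Delta>" "x \<noteq> []" and lo: "valid lo"
    and v: "\<And>y. y \<in> children \<Delta> x \<Longrightarrow> below lo (v y) \<and> below (v y) hi"
  shows "below (step hi) (tree_step v x) \<and> below (tree_step v x) (step lo)"
  using tree_step_antimono[of x "\<lambda>_. lo" v] tree_step_antimono[of x v "\<lambda>_. hi"]
    tree_step_const[OF x, of "\<lambda>_. lo"] tree_step_const[OF x, of "\<lambda>_. hi"] v lo valid_above
  by metis

text \<open>Messages of arbitrary boundary origin lie above the least message \<open>orbit 0\<close>, hence after one step below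
  \<open>orbit 1\<close>; every further step reverses the order once more. An odd number of steps is taken so that the
  bounds have a fixed orientation, and \<open>m > 0\<close> keeps away from the root, which has one child more.\<close>

lemma messages_between_orbits:
  assumes "m > 0" "\<And>x. x \<in> level \<Delta> (m + (2 * j + 1)) \<Longrightarrow> valid (u x)" "x \<in> level \<Delta> m"
  shows "below (orbit (2 * j)) ((tree_step ^^ (2 * j + 1)) u x) \<and>
    below ((tree_step ^^ (2 * j + 1)) u x) (orbit (2 * j + 1))"
  using assms
proof (induction j arbitrary: m x)
  case 0
  have x: "x \<in> tree \<Delta>" "x \<noteq> []" using 0 by (auto simp: level_def)
  have u: "valid (u y)" if "y \<in> children \<Delta> x" for y
    using that 0(2) children_subset_level[OF 0(3)] by auto
  have o0: "orbit 0 = (1, 0)" by (simp add: orbit_def)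
  have "below (tree_step u x) (step (orbit 0))"
    using tree_step_antimono[of x "\<lambda>_. orbit 0" u] tree_step_const[OF x, of "\<lambda>_. orbit 0"]
      u orbit_valid[of 0] by (simp add: o0 valid_iff)
  moreover have "below (orbit 0) (tree_step u x)"
    using valid_tree_step[of x u] u by (simp add: o0 valid_iff)
  ultimately show ?case by (simp add: orbit_Suc)
next
  case (Suc j)
  let ?V = "(tree_step ^^ (2 * j + 1)) u"
  have V: "below (orbit (2 * j)) (?V y) \<and> below (?V y) (orbit (2 * j + 1))"
    if "y \<in> level \<Delta> (m + 2)" for y
    using Suc.IH[of "m + 2" y] Suc.prems(2) that by (simp add: add.assoc)
  have W: "below (orbit (2 * j + 2)) (tree_step ?V y) \<and> below (tree_step ?V y) (orbit (2 * j + 1))"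
    if y: "y \<in> level \<Delta> (m + 1)" for y
  proof -
    have "y \<in> tree \<Delta>" "y \<noteq> []" using y by (auto simp: level_def)
    moreover have "children \<Delta> y \<subseteq> level \<Delta> (m + 2)" using children_subset_level[OF y] by simp
    ultimately have "below (step (orbit (2 * j + 1))) (tree_step ?V y) \<and>
        below (tree_step ?V y) (step (orbit (2 * j)))"
      using V by (intro tree_step_between orbit_valid) auto
    then show ?thesis by (simp add: orbit_Suc)
  qed
  have "x \<in> tree \<Delta>" "x \<noteq> []" using Suc.prems by (auto simp: level_def)
  moreover have "children \<Delta> x \<subseteq> level \<Delta> (m + 1)"
    using children_subset_level[OF Suc.prems(3)] by simp
  ultimately have "below (step (orbit (2 * j + 1))) (tree_step (tree_step ?V) x) \<and>
      below (tree_step (tree_step ?V) x) (step (orbit (2 * j + 2)))"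
    using W by (intro tree_step_between orbit_valid) auto
  then show ?case by (simp add: orbit_Suc)
qed

lemma msg_mono: "valid (v x) \<Longrightarrow> below (v x) (w x) \<Longrightarrow> msg v x a b \<le> msg w x a b"
  by (auto simp: msg_def valid_def below_def intro!: mult_mono)

lemma ball_weight_mono:
  assumes "\<And>x. x \<in> level \<Delta> n \<Longrightarrow> valid (v x)" "\<And>x. x \<in> level \<Delta> n \<Longrightarrow> below (v x) (w x)"
  shows "ball_weight n (msg v) \<sigma> \<le> ball_weight n (msg w) \<sigma>"
  unfolding ball_weight_def using assms
  by (intro mult_left_mono prod_mono prod_nonneg)
    (auto intro: site_weight_nonneg msg_nonneg msg_mono)

lemma partition_fn_mono:
  assumes "\<And>x. x \<in> level \<Delta> n \<Longrightarrow> valid (v x)" "\<And>x. x \<in> level \<Delta> n \<Longrightarrow> below (v x) (w x)"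
  shows "partition_fn n v \<le> partition_fn n w"
  unfolding partition_fn_def using assms by (intro sum_mono ball_weight_mono)

lemma tendsto_ball_weight:
  assumes "X \<longlonglongrightarrow> z"
  shows "(\<lambda>j. ball_weight n (msg (\<lambda>_. X j)) \<sigma>) \<longlonglongrightarrow> ball_weight n (msg (\<lambda>_. z)) \<sigma>"
proof -
  have "(\<lambda>j. msg (\<lambda>_. X j) x a b) \<longlonglongrightarrow> msg (\<lambda>_. z) x a b" for x a b
    unfolding msg_def using assms by (auto intro!: tendsto_intros)
  then show ?thesis unfolding ball_weight_def by (intro tendsto_intros)
qed

lemma tendsto_partition_fn:
  "X \<longlonglongrightarrow> z \<Longrightarrow> (\<lambda>j. partition_fn n (\<lambda>_. X j)) \<longlonglongrightarrow> partition_fn n (\<lambda>_. z)"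
  unfolding partition_fn_def by (intro tendsto_sum tendsto_ball_weight)

text \<open>A Gibbs measure is a mixture of finite-volume measures, with these mixture weights.\<close>

lemma gibbs_boundary_total:
  assumes "gibbs_measure \<Delta> lam (theta h) \<mu>" and D: "finite D" "D \<subseteq> tree \<Delta>"
  shows "(\<Sum>\<eta>\<in>indep_configs \<Delta> D. measure \<mu> {x \<in> space \<mu>. restrict x D = \<eta>}) = 1"
proof -
  have \<mu>: "prob_space \<mu>" "sets \<mu> = sets (config_space \<Delta>)"
    and indep: "AE \<omega> in \<mu>. \<omega> \<in> indep_configs \<Delta> (tree \<Delta>)"
    using assms(1) by (auto simp: gibbs_measure_def)
  interpret prob_space \<mu> by (rule \<mu>)
  let ?Q = "\<lambda>\<omega>. \<omega> \<in> indep_configs \<Delta> D"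
  have "AE x in \<mu>. ?Q (restrict x D)"
    using indep
  proof eventually_elim
    case (elim \<omega>)
    then have "restrict \<omega> D \<in> configs D"
      using D configs_restrict by (auto simp: indep_configs_def)
    then show ?case using elim D by (auto simp: indep_configs_def)
  qed
  then have "prob {x \<in> space \<mu>. ?Q (restrict x D)} = 1"
    using prob_eq_1[OF local_event(1)[OF \<mu> D, where Q = ?Q]] by simp
  moreover have "{\<omega> \<in> configs D. ?Q \<omega>} = indep_configs \<Delta> D" by (auto simp: indep_configs_def)
  ultimately show ?thesis using local_event(2)[OF \<mu> D, where Q = ?Q] by (simp only: Collect_conj_eq)
qed

text \<open>Ball weights and partition functions increase with the messages. So every finite-volume probability
  on the ball, and with it their mixture under \<open>\<mu>\<close>, lies between two ratios that depend on the radius of the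
  outer ball but not on the boundary condition; as the radius grows, both converge to the same limit.\<close>

lemma gibbs_ball_distribution:
  assumes gibbs: "gibbs_measure \<Delta> lam (theta h) \<mu>" and trivial: "lower = upper"
    and m: "m > 0" and \<omega>: "\<omega> \<in> configs (tree_ball \<Delta> m)"
  shows "measure \<mu> {x \<in> space \<mu>. restrict x (tree_ball \<Delta> m) = \<omega>} =
    ball_weight m (msg (\<lambda>_. lower)) \<omega> / partition_fn m (\<lambda>_. lower)"
proof -
  let ?p = "measure \<mu> {x \<in> space \<mu>. restrict x (tree_ball \<Delta> m) = \<omega>}"
  define lo hi where "lo j = (\<lambda>_::node. orbit (2 * j))" and "hi j = (\<lambda>_::node. orbit (2 * j + 1))" for j
  let ?W = "\<lambda>v. ball_weight m (msg v) \<omega>"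
  have between: "?W (lo j) / partition_fn m (hi j) \<le> ?p \<and> ?p \<le> ?W (hi j) / partition_fn m (lo j)" for j
  proof -
    define k where "k = 2 * j + 1"
    let ?B = "tree_ball \<Delta> (m + k)"
    let ?D = "bdry \<Delta> ?B" and ?F = "finite_vol_prob \<Delta> lam (theta h) ?B (tree_ball \<Delta> m) \<omega>"
    have D: "finite ?D" "?D \<subseteq> tree \<Delta>" by (simp add: bdry_ball) (rule bdry_subset_tree)
    have lo_valid: "valid (lo j x)" and hi_valid: "valid (hi j x)" for x
      by (simp_all add: lo_def hi_def orbit_valid)
    have F: "?W (lo j) / partition_fn m (hi j) \<le> ?F \<eta> \<and> ?F \<eta> \<le> ?W (hi j) / partition_fn m (lo j)"
      if \<eta>: "\<eta> \<in> indep_configs \<Delta> ?D" for \<eta>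
    proof -
      obtain u where u: "\<And>x. x \<in> level \<Delta> (m + k) \<Longrightarrow> valid (u x)"
        "?F \<eta> = ?W ((tree_step ^^ k) u) / partition_fn m ((tree_step ^^ k) u)"
        using finite_vol_prob_ball[OF \<omega> \<eta>] by blast
      let ?v = "(tree_step ^^ k) u"
      have v: "below (lo j x) (?v x)" "below (?v x) (hi j x)" if "x \<in> level \<Delta> m" for x
        using messages_between_orbits[OF m _ that, of j u] u(1) by (auto simp: k_def lo_def hi_def)
      have v_valid: "valid (?v x)" if "x \<in> level \<Delta> m" for x
        using v(1)[OF that] lo_valid valid_above by blast
      have "?W (lo j) \<le> ?W ?v" "?W ?v \<le> ?W (hi j)"
        "partition_fn m (lo j) \<le> partition_fn m ?v" "partition_fn m ?v \<le> partition_fn m (hi j)"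
        using v v_valid lo_valid by (auto intro: ball_weight_mono partition_fn_mono)
      moreover have "0 < partition_fn m (lo j)" "0 \<le> ?W (lo j)"
        using lo_valid by (auto intro: partition_fn_pos ball_weight_nonneg)
      ultimately show ?thesis unfolding u(2) by (auto intro!: frac_le)
    qed
    have "finite ?B" "?B \<subseteq> tree \<Delta>" "tree_ball \<Delta> m \<subseteq> ?B"
      by (rule finite_tree_ball, force simp: tree_ball_def, rule ball_mono[OF le_add1])
    then have p: "?p = (\<Sum>\<eta>\<in>indep_configs \<Delta> ?D. ?F \<eta> * measure \<mu> {x \<in> space \<mu>. restrict x ?D = \<eta>})"
      using gibbs \<omega> unfolding gibbs_measure_def by blast
    have scale: "c = (\<Sum>\<eta>\<in>indep_configs \<Delta> ?D. c * measure \<mu> {x \<in> space \<mu>. restrict x ?D = \<eta>})" for c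
      using gibbs_boundary_total[OF gibbs D] by (simp add: sum_distrib_left[symmetric] del: restrict_apply)
    have "?W (lo j) / partition_fn m (hi j) \<le> ?p"
      unfolding p by (subst scale[of "?W (lo j) / partition_fn m (hi j)"], intro sum_mono mult_right_mono)
        (use F in auto)
    moreover have "?p \<le> ?W (hi j) / partition_fn m (lo j)"
      unfolding p by (subst scale[of "?W (hi j) / partition_fn m (lo j)"], intro sum_mono mult_right_mono)
        (use F in auto)
    ultimately show ?thesis ..
  qed
  have P: "partition_fn m (\<lambda>_. lower) \<noteq> 0"
    using partition_fn_pos[of m "\<lambda>_. lower"] lower_valid by simp
  have lim: "(\<lambda>j. orbit (2 * j)) \<longlonglongrightarrow> lower" "(\<lambda>j. orbit (2 * j + 1)) \<longlonglongrightarrow> lower"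
    using orbit_tendsto trivial by auto
  have "(\<lambda>j. ?W (lo j) / partition_fn m (hi j)) \<longlonglongrightarrow> ?W (\<lambda>_. lower) / partition_fn m (\<lambda>_. lower)"
    "(\<lambda>j. ?W (hi j) / partition_fn m (lo j)) \<longlonglongrightarrow> ?W (\<lambda>_. lower) / partition_fn m (\<lambda>_. lower)"
    unfolding lo_def hi_def
    by (intro tendsto_divide tendsto_ball_weight tendsto_partition_fn lim P)+
  then have "(\<lambda>j::nat. ?p) \<longlonglongrightarrow> ?W (\<lambda>_. lower) / partition_fn m (\<lambda>_. lower)"
    by (rule tendsto_sandwich[rotated 2]) (use between in auto)
  then show ?thesis using LIMSEQ_unique[OF tendsto_const] by blast
qed

lemma uniqueness_of_trivial_cycle:
  assumes "lower = upper"
  shows "uniqueness_regime \<Delta> lam (theta h)"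
proof -
  obtain \<mu> where \<mu>: "gibbs_measure \<Delta> lam (theta h) \<mu>"
    using gibbs_measure_of_two_cycle[OF lower_valid upper_valid step_lower step_upper] .
  moreover have "\<nu> = \<mu>" if \<nu>: "gibbs_measure \<Delta> lam (theta h) \<nu>" for \<nu>
    using \<mu> \<nu> gibbs_ball_distribution[OF \<mu> assms] gibbs_ball_distribution[OF \<nu> assms]
    by (intro measure_eqI_balls) (auto simp: gibbs_measure_def simp del: restrict_apply)
  ultimately show ?thesis unfolding uniqueness_regime_def by blast
qed


section \<open>Two Gibbs measures from a nontrivial cycle\<close>

text \<open>At the root the recursion runs over \<open>\<Delta>\<close> children and, by the convention that its fictitious parent has
  spin \<open>0\<close>, the resulting \<open>r\<close> is the ratio of the probabilities of spin \<open>1\<close> and spin \<open>0\<close>.\<close>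

lemma root_marginal:
  assumes v: "\<And>x. valid (v x)"
    and \<mu>: "prob_space \<mu>" "sets \<mu> = sets (config_space \<Delta>)"
    and distr: "\<And>\<omega>. \<omega> \<in> configs (tree_ball \<Delta> 1) \<Longrightarrow>
      measure \<mu> {x \<in> space \<mu>. restrict x (tree_ball \<Delta> 1) = \<omega>} =
      ball_weight 1 (msg v) \<omega> / partition_fn 1 v"
  defines "r \<equiv> snd (tree_step v [])"
  shows "measure \<mu> {x \<in> space \<mu>. restrict (restrict x (tree_ball \<Delta> 1)) {[]} = (\<lambda>x\<in>{[]}. 1)} = r / (1 + r)"
proof -
  let ?B = "tree_ball \<Delta> 1" and ?\<zeta> = "\<lambda>x\<in>{[]::node}. 1::nat"
  let ?Q = "\<lambda>\<omega>. restrict \<omega> {[]} = ?\<zeta>"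
  have B: "?B \<subseteq> tree \<Delta>" by (auto simp: tree_ball_def)
  have \<zeta>: "?\<zeta> \<in> configs (tree_ball \<Delta> 0)" by (auto simp: ball_0 configs_def)
  have init: "prop_on (level \<Delta> (0 + 1)) (msg v) v"
    unfolding prop_on_def by (intro exI[of _ "\<lambda>_. 1"]) simp
  have w0: "ball_weight 0 M \<sigma> = M [] (\<sigma> []) 0" for M \<sigma>
    by (simp add: ball_weight_def level_0 inside_def pspin_def)
  have q: "fst (tree_step v []) \<ge> 1" and r: "r \<ge> 0"
    using valid_tree_step[of "[]" v] v by (auto simp: valid_def r_def)
  have Z: "partition_fn 0 (tree_step v) = fst (tree_step v []) * (1 + r)"
    using sum_configs_prod[of "{[]}" "\<lambda>y a. msg (tree_step v) y a 0"]
    by (simp add: partition_fn_def ball_0 w0 msg_def r_def algebra_simps)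
  have "measure \<mu> {x \<in> space \<mu>. ?Q (restrict x ?B)} =
    (\<Sum>\<omega> | \<omega> \<in> configs ?B \<and> ?Q \<omega>. ball_weight 1 (msg v) \<omega> / partition_fn 1 v)"
    unfolding local_event(2)[OF \<mu> finite_tree_ball B, where Q = ?Q]
    using distr by (intro sum.cong refl) blast
  also have "\<dots> = ball_weight 0 (msg ((tree_step ^^ 1) v)) ?\<zeta> / partition_fn 0 ((tree_step ^^ 1) v)"
    using marginal_ratio[OF \<zeta> init v]
    by (simp only: sum_divide_distrib[symmetric] partition_fn_def ball_0 add_0)
  also have "\<dots> = r / (1 + r)"
    using q r by (simp add: w0 Z) (simp add: msg_def r_def)
  finally show ?thesis .
qed

text \<open>The two ways to place \<open>lower\<close> and \<open>upper\<close> on the even and odd levels give Gibbs measures with different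
  densities at the root: its children send \<open>upper\<close> in one case and \<open>lower\<close> in the other, and the recursion at
  the root is strictly decreasing.\<close>

lemma nonuniqueness_of_nontrivial_cycle:
  assumes less: "snd lower < snd upper"
  shows "\<not> uniqueness_regime \<Delta> lam (theta h)"
proof
  assume unique: "uniqueness_regime \<Delta> lam (theta h)"
  define v1 v2 where "v1 = (\<lambda>x::node. if even (length x) then lower else upper)"
    and "v2 = (\<lambda>x::node. if even (length x) then upper else lower)"
  obtain \<mu>1 where \<mu>1: "gibbs_measure \<Delta> lam (theta h) \<mu>1"
    "\<And>n \<omega>. n > 0 \<Longrightarrow> \<omega> \<in> configs (tree_ball \<Delta> n) \<Longrightarrow>
      measure \<mu>1 {x \<in> space \<mu>1. restrict x (tree_ball \<Delta> n) = \<omega>} =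
      ball_weight n (msg v1) \<omega> / partition_fn n v1"
    using gibbs_measure_of_two_cycle[OF lower_valid upper_valid step_lower step_upper]
    unfolding v1_def by blast
  obtain \<mu>2 where \<mu>2: "gibbs_measure \<Delta> lam (theta h) \<mu>2"
    "\<And>n \<omega>. n > 0 \<Longrightarrow> \<omega> \<in> configs (tree_ball \<Delta> n) \<Longrightarrow>
      measure \<mu>2 {x \<in> space \<mu>2. restrict x (tree_ball \<Delta> n) = \<omega>} =
      ball_weight n (msg v2) \<omega> / partition_fn n v2"
    using gibbs_measure_of_two_cycle[OF upper_valid lower_valid step_upper step_lower]
    unfolding v2_def by blast
  have same: "\<mu>2 = \<mu>1" using unique \<mu>1(1) \<mu>2(1) unfolding uniqueness_regime_def by blast
  have valid12: "valid (v1 x)" "valid (v2 x)" for x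
    using lower_valid upper_valid by (auto simp: v1_def v2_def)
  define r1 and r2 where "r1 = snd (tree_step v1 [])" and "r2 = snd (tree_step v2 [])"
  have space: "prob_space \<mu>1" "sets \<mu>1 = sets (config_space \<Delta>)"
    using \<mu>1(1) by (auto simp: gibbs_measure_def)
  have "r1 / (1 + r1) = r2 / (1 + r2)"
    using root_marginal[OF valid12(1) space \<mu>1(2)] root_marginal[OF valid12(2) space \<mu>2(2)[unfolded same]]
    by (simp only: r1_def r2_def zero_less_one)
  moreover have "r1 \<ge> 0" "r2 \<ge> 0"
    using valid_tree_step[of "[]"] valid12 by (auto simp: r1_def r2_def valid_def)
  ultimately have "r1 = r2" by (simp add: frac_eq_eq algebra_simps)
  moreover have "r1 < r2"
  proof -
    let ?R = "\<lambda>z :: real \<times> real. lam / (fst z ^ \<Delta> * ((1 + snd z) ^ \<Delta> + h))"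
    have odd: "odd (length y)" if "y \<in> children \<Delta> []" for y
      using length_children[OF that] by simp
    have "r1 = ?R upper" "r2 = ?R lower"
      using card_children[of "[]" \<Delta>] odd
      by (simp_all add: r1_def r2_def tree_step_def Let_def v1_def v2_def)
    moreover have "?R upper < ?R lower"
    proof (rule divide_strict_left_mono)
      have lo: "1 \<le> fst lower" "0 \<le> snd lower" and le: "fst lower \<le> fst upper"
        using lower_valid lower_below_upper by (auto simp: valid_def below_def)
      have 1: "fst lower ^ \<Delta> \<le> fst upper ^ \<Delta>" using lo le by (intro power_mono) auto
      have 2: "(1 + snd lower) ^ \<Delta> + h < (1 + snd upper) ^ \<Delta> + h"
        using lo less \<Delta>_ge_3 by (intro add_strict_right_mono power_strict_mono) auto
      have 3: "fst lower ^ \<Delta> > 0" "(1 + snd lower) ^ \<Delta> + h > 0"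
        using lo h_nonneg by (auto intro!: add_pos_nonneg zero_less_power)
      show *: "fst lower ^ \<Delta> * ((1 + snd lower) ^ \<Delta> + h) < fst upper ^ \<Delta> * ((1 + snd upper) ^ \<Delta> + h)"
        using 3 by (intro mult_le_less_imp_less 1 2 less_imp_le)
      have "0 < fst lower ^ \<Delta> * ((1 + snd lower) ^ \<Delta> + h)" using 3 by (rule mult_pos_pos)
      with * show "0 < fst upper ^ \<Delta> * ((1 + snd upper) ^ \<Delta> + h) * (fst lower ^ \<Delta> * ((1 + snd lower) ^ \<Delta> + h))"
        by (intro mult_pos_pos[of "_ * _" "_ * _"]) linarith+
    qed (rule lam_pos)
    ultimately show ?thesis by simp
  qed
  ultimately show False by simp
qed

end

section \<open>The critical hard-core model with a reward for uncovered nodes\<close>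

theorem corollary1:
  fixes \<Delta> :: nat
  assumes "\<Delta> \<ge> 3"
  shows "\<exists>a b :: real. 0 < a \<and> a < b \<and>
    uniqueness_regime \<Delta> (lambda_crit \<Delta>) (\<lambda>k. all_ones k + e_zero k * 0) \<and>
    (\<forall>h\<ge>b. uniqueness_regime \<Delta> (lambda_crit \<Delta>) (\<lambda>k. all_ones k + e_zero k * h)) \<and>
    (\<forall>h. 0 < h \<and> h < a \<longrightarrow>
       \<not> uniqueness_regime \<Delta> (lambda_crit \<Delta>) (\<lambda>k. all_ones k + e_zero k * h))"
proof -
  define d where "d = \<Delta> - 1"
  define lam where "lam = lambda_crit \<Delta>"
  have d: "d \<ge> 2" "\<Delta> = d + 1" using assms by (auto simp: d_def)
  have lam_eq: "lam = real d ^ d / (real d - 1) ^ (d + 1)"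
    by (simp add: lam_def lambda_crit_def d(2))
  then have lam: "lam > 0" using d by simp
  have theta_eq: "(\<lambda>k. all_ones k + e_zero k * h) = theta h" for h
    by (simp add: theta_def fun_eq_iff)
  have model: "covering_model \<Delta> lam h" and map: "critical_message_map d lam h" if "h \<ge> 0" for h
    using that assms lam d lam_eq by (unfold_locales; simp)+
  \<comment> \<open>the thresholds under which \<open>nontrivial_cycle_small\<close> and \<open>trivial_cycle_large\<close> apply; the summand \<open>1\<close> in
    \<open>b\<close> makes \<open>a < b\<close> evident\<close>
  define a b where "a = (real d - 1) / (real d * (real d + 1))" and "b = lam * real (d * d) + 1"
  have "real d * 1 < real d * (real d + 1)" using d by (intro mult_strict_left_mono) auto
  then have "real d - 1 < real d * (real d + 1)" by linarith
  then have "a > 0" "a < 1" using d by (simp_all add: a_def)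
  moreover have "b > 1" using lam d by (simp add: b_def)
  moreover have "uniqueness_regime \<Delta> lam (theta 0)"
  proof -
    interpret covering_model \<Delta> lam 0 by (rule model) simp
    have "branching = d" by (simp add: branching_def d_def)
    then interpret critical_message_map branching lam 0 using map[of 0] by simp
    show ?thesis by (rule uniqueness_of_trivial_cycle) (rule trivial_cycle_zero, simp)
  qed
  moreover have "uniqueness_regime \<Delta> lam (theta h)" if "h \<ge> b" for h
  proof -
    have h: "h \<ge> 0" using that \<open>b > 1\<close> by simp
    interpret covering_model \<Delta> lam h by (rule model[OF h])
    have "branching = d" by (simp add: branching_def d_def)
    then show ?thesis
      using uniqueness_of_trivial_cycle trivial_cycle_large that by (simp add: b_def)
  qed
  moreover have "\<not> uniqueness_regime \<Delta> lam (theta h)" if "0 < h" "h < a" for h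
  proof -
    have h: "h \<ge> 0" using that by simp
    interpret covering_model \<Delta> lam h by (rule model[OF h])
    have "branching = d" by (simp add: branching_def d_def)
    then interpret critical_message_map branching lam h using map[OF h] by simp
    show ?thesis
      using nontrivial_cycle_small that nonuniqueness_of_nontrivial_cycle
      unfolding a_def \<open>branching = d\<close> by blast
  qed
  ultimately show ?thesis
    unfolding theta_eq lam_def by (intro exI[of _ a] exI[of _ b]) auto
qed

end
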